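(* Let Assumptions 1, 2, 3 (stated in the context) hold. Let the disturbances be uniformly bounded such that $\max_{t\in[T-k]}\sum_{\tau=0}^{k-1}\|w_{t+\tau}\|\le D_k$. Let $C:=\max(\Omega,\Gamma)$, $\delta:=\max(\delta_{\mathcal S},\delta_{\mathcal T})$, $\xi:=1-\sqrt\delta>0$, and take $k$ and $\kappa$ such that $$\kappa\ge\max\left(\kappa_0,\ \frac{\log\frac{(1-\sqrt\delta)(1-\delta)}{2C^2LN}}{\log\delta}\right),\qquad k\ge\frac{2\log\frac{\delta^{5/2}(1-\delta)}{4C^3}}{\log\delta}.$$ Let $x_{0:T}$ be the state trajectory generated by $DTPC_k$. Then the following input-to-state stability bound holds: $$\|x_t\|\le\begin{cases}\dfrac{C}{\xi}(1-\xi)^{\max(0,t-k)}\|x_0\|+\dfrac{W}{\xi}, & t\le T-k,\\[2mm] \dfrac{C^2}{\xi^2}(1-\xi)^{T-2k}\,\delta^{t+k-T}\|x_0\|+\dfrac{2CW}{\xi^2}, & \text{otherwise},\end{cases}$$ where $W:=\frac{10C^3LN}{(1-\delta)^2}D_k$. Further, the dynamic regret satisfies $$\mathrm{cost}(DTPC_k)-\mathrm{cost}(OPT)=O\left(\left[\left(D_k+\frac{\|x_0\|+D_k}{\xi^2}\right)^2\delta^{\kappa}+\left(D_k+\frac{\delta^k(\|x_0\|+D_k)}{\xi}\right)^2\delta^{k}\right]T+\eta\|x_0\|^2\right),$$ where $\eta=\Theta(\max(\delta^k,\delta^\kappa))$.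
   Context: Notation. $[T]=\{0,1,\dots,T\}$; $v_{0:T}$ denotes $(v_0,\dots,v_T)$; $\|\cdot\|$ is the Euclidean norm of vectors and operator norm of matrices; $\sigma_{min}$ is the minimum singular value; $M^\dagger$ is the Moore-Penrose pseudo-inverse. In $O(\cdot)$ and $\Theta(\cdot)$ the hidden constants do not depend on $T,k,\kappa,\|x_0\|,D_k$ or $\xi$. System. $\mathcal G=(\mathcal V,\mathcal E)$ is a graph with $N$ nodes and shortest-path distance $d_{\mathcal G}$; $\mathcal N_{\mathcal G}[i]=\{i\}\cup\{j:(i,j)\in\mathcal E\}$; $\mathcal N^\kappa_{\mathcal G}[i]=\{j\in\mathcal V: d_{\mathcal G}(i,j)\le\kappa\}$. Vectors and matrices are partitioned into blocks indexed by nodes: $x=(x[i])_{i\in\mathcal V}$, $M=(M[i,j])_{i,j\in\mathcal V}$. The dynamics are $x_{t+1}=Ax_t+Bu_t+w_t$, $t\in[T-1]$, with given $x_0$, where $x_t[i],w_t[i]\in\mathbb R^{n_{x_i}}$, $u_t[i]\in\mathbb R^{n_{u_i}}$ and $A[i,j]=0$, $B[i,j]=0$ whenever $j\notin\mathcal N_{\mathcal G}[i]$. Costs are $f_t(x)=\sum_{i}f_t[i](x[i])$ ($t=0,\dots,T$) and $c_t(u)=\sum_i c_t[i](u[i])$ ($t=1,\dots,T$). The cost of a trajectory is $\sum_{t=0}^Tf_t(x_t)+\sum_{t=0}^{T-1}c_{t+1}(u_t)$; $\mathrm{cost}(ALG)$ is the cost of the trajectory generated by algorithm $ALG$; $OPT$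 is the offline minimizer of this cost subject to the dynamics and initial state $x_0$. Truncation. $M^{(i,\kappa)}[j,l]=M[j,l]$ if $j\in\mathcal N^\kappa_{\mathcal G}[i]$ and $0$ otherwise; for vectors, $x^{(i,\kappa)}[j]=x[j]$ if $j\in\mathcal N^\kappa_{\mathcal G}[i]$ and $0$ otherwise. Truncated problem. For horizon $p$, initial state $x$, disturbances $\zeta=(\zeta_0,\dots,\zeta_{p-1})$ and terminal cost $g$, $\tilde\psi_t^p(x,\zeta,\mathcal N^\kappa_{\mathcal G}[i];g)$ is the minimizer over $y_{0:p},v_{0:p-1}$ of $\sum_{\tau=0}^{p-1}f_{t+\tau}(y_\tau)+\sum_{\tau=1}^{p}c_{t+\tau}(v_{\tau-1})+g(y_p)$ subject to $y_{\tau+1}=A^{(i,\kappa)}y_\tau+B^{(i,\kappa)}v_\tau+\zeta_\tau^{(i,\kappa)}$ ($\tau\in[p-1]$), $y_0=x^{(i,\kappa)}$. Algorithm $DTPC_k$ (prediction horizon $k$, truncation radius $\kappa$, terminal cost $F$). For each $t=0,\dots,T-1$, each agent $i$ solves $\tilde\psi_t^k(x_t,w_{t:t+k-1},\mathcal N_{\mathcal G}^\kappa[i];F)$ if $t<T-k$, and $\tilde\psi_t^{T-t}(x_t,w_{t:T-1},\mathcal N_{\mathcal G}^\kappa[i];f_T)$ if $t\ge T-k$, and sets $u_t[i]=v_0[i]$ from its solution; then $u_t=(u_t[i])_i$ is applied to the system. $(A,B)$ is $(L,\gamma)$-stabilizable ($L>1$, $\gamma\in(0,1)$) if there is $K$ with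 $\|K\|\le L$ and $\|(A-BK)^t\|\le L\gamma^t$ for all $t\in\mathbb Z_+$. Assumption 1. (1) $\|A\|,\|B\|,\|B^\dagger\|\le L$. (2) With $d$ the controllability index, the reduced controllability matrix $\mathcal C^d=[B\ AB\ \cdots\ A^{d-1}B]$ (full row rank) satisfies $\sigma_{min}(\mathcal C^d)\ge\sigma>0$. (3) There is $\kappa_0<\mathrm{diam}(\mathcal G)$ such that for all $i\in\mathcal V$ and $\kappa\ge\kappa_0$, $(A^{(i,\kappa)},B^{(i,\kappa)})$ is $(L,\gamma)$-stabilizable. Assumption 2. (1) $f_t,c_t$ are $\mu$-strongly convex, $L$-smooth, twice continuously differentiable for all $t$. (2) $F$ is $\mu$-strongly convex, $L$-smooth, twice continuously differentiable and a K-function, i.e. $F(x)=\beta(\|x\|)$ with $\beta$ strictly increasing, $\beta(0)=0$. (3) $f_t,c_t$ are non-negative with $f_t(0)=c_t(0)=0$ for all $t=1,\dots,T$, and likewise for $f_0$. Assumption 3. There is a subexponential function $p(\cdot)$ (i.e. $\lim_{d\to\infty}(\log p(d))/d=0$) with $|\{j\in\mathcal V:d_{\mathcal G}(i,j)=d\}|\le p(d)$ for all $i$ and all distances $d$. Spatial constants: $\mu_J:=\frac{(1-\gamma)^2}{L^2(1+L^2)}$, $L_H:=2L+1$, $\mu_H:=\left(\frac1\mu+\left(1+\frac{2L_H}{\mu}+\frac{L_H^2}{\mu^2}\right)\frac{L_H}{\mu_J}\right)^{-1}$, $\rho:=\left(\frac{L_H^2-\mu_H^2}{L_H^2+\mu_H^2}\right)^{1/2}$,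 $\alpha:=\frac{L_H}{\mu_H^2\rho}$, $\delta_{\mathcal S}:=\frac{\rho+1}{2}$, $\Gamma:=\frac{4\alpha^2\delta_{\mathcal S}L}{(1-\delta_{\mathcal S})^2}\left(\sup_{d\in\mathbb Z_+}(\rho/\delta_{\mathcal S})^dp(d)\right)^2p(1)$. Temporal constants: $\Omega>0$ and $\delta_{\mathcal T}\in(0,1)$ are the constants (known from earlier work) in the following Lipschitz property. Let $\Psi_t^p(x,\zeta,\bar x)$ be the minimizer of $\sum_{\tau=0}^{p}f_{t+\tau}(y_\tau)+\sum_{\tau=1}^pc_{t+\tau}(v_{\tau-1})$ subject to $y_{\tau+1}=Ay_\tau+Bv_\tau+\zeta_\tau$ ($\tau\in[p-1]$), $y_0=x$, $y_p=\bar x$. Under Assumptions 1 and 2, for every horizon $p\ge d$ and all $(x,\zeta,\bar x),(x',\zeta',\bar x')$, the predicted states at step $m$ differ in norm by at most $\Omega\big(\delta_{\mathcal T}^m\|x-x'\|+\delta_{\mathcal T}^{p-m}\|\bar x-\bar x'\|+\sum_{l=0}^{p-1}\delta_{\mathcal T}^{|m-l|}\|\zeta_l-\zeta'_l\|\big)$. *)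

theory Defs
  imports "HOL-Analysis.Analysis" "HOL-Library.Extended_Nat"
begin

text \<open>
  A graph on the finite vertex type \<open>'v\<close> is a symmetric relation \<open>E\<close>. Distances take values in
  \<^typ>\<open>enat\<close>; vertices in different components have distance \<open>\<infinity>\<close>.
\<close>

definition gdist :: "('v \<times> 'v) set \<Rightarrow> 'v \<Rightarrow> 'v \<Rightarrow> enat" where
  "gdist E i j = (INF n\<in>{n. (i, j) \<in> E ^^ n}. enat n)"

definition gdiam :: "('v \<times> 'v) set \<Rightarrow> enat" where
  "gdiam E = (SUP i. SUP j. gdist E i j)"

definition nbhd :: "('v \<times> 'v) set \<Rightarrow> 'v \<Rightarrow> 'v set" where
  "nbhd E i = insert i {j. (i, j) \<in> E}"

definition nbhd_upto :: "('v \<times> 'v) set \<Rightarrow> nat \<Rightarrow> 'v \<Rightarrow> 'v set" where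
  "nbhd_upto E \<kappa> i = {j. gdist E i j \<le> enat \<kappa>}"


text \<open>
  A partition of the coordinates \<open>'n\<close> of \<^typ>\<open>real^'n\<close> into blocks indexed by the nodes is a
  map \<open>b :: 'n \<Rightarrow> 'v\<close>: block \<open>i\<close> consists of the coordinates \<open>a\<close> with \<open>b a = i\<close>, so its dimension
  is the size of that fibre. The block \<open>x[i]\<close> is identified with the vector that agrees with \<open>x\<close>
  on block \<open>i\<close> and vanishes elsewhere.
\<close>

definition restrict_vec :: "('n \<Rightarrow> 'v) \<Rightarrow> 'v set \<Rightarrow> real^'n \<Rightarrow> real^'n" where
  "restrict_vec b S x = (\<chi> a. if b a \<in> S then x $ a else 0)"

definition restrict_rows :: "('n \<Rightarrow> 'v) \<Rightarrow> 'v set \<Rightarrow> real^'m^'n \<Rightarrow> real^'m^'n" where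
  "restrict_rows b S M = (\<chi> a c. if b a \<in> S then M $ a $ c else 0)"

definition block_sparse ::
  "('v \<times> 'v) set \<Rightarrow> ('n \<Rightarrow> 'v) \<Rightarrow> ('m \<Rightarrow> 'v) \<Rightarrow> real^'m^'n \<Rightarrow> bool" where
  "block_sparse E br bc M \<longleftrightarrow> (\<forall>a c. bc c \<notin> nbhd E (br a) \<longrightarrow> M $ a $ c = 0)"

definition separable :: "('n::finite \<Rightarrow> 'v::finite) \<Rightarrow> (real^'n \<Rightarrow> real) \<Rightarrow> bool" where
  "separable b f \<longleftrightarrow>
     (\<exists>floc :: 'v \<Rightarrow> real^'n \<Rightarrow> real. \<forall>x. f x = (\<Sum>i\<in>UNIV. floc i (restrict_vec b {i} x)))"


abbreviation opnorm :: "real^'m::finite^'n::finite \<Rightarrow> real" where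
  "opnorm M \<equiv> onorm ((*v) M)"

definition mat_pow :: "real^'n::finite^'n \<Rightarrow> nat \<Rightarrow> real^'n^'n" where
  "mat_pow M t = (((**) M) ^^ t) (mat 1)"

definition is_pinv :: "real^'m::finite^'n::finite \<Rightarrow> real^'n^'m \<Rightarrow> bool" where
  "is_pinv M X \<longleftrightarrow>
     M ** X ** M = M \<and> X ** M ** X = X \<and>
     transpose (M ** X) = M ** X \<and> transpose (X ** M) = X ** M"

text \<open>
  The controllability matrix \<open>[B  AB  \<dots>  A\<^sup>d\<^sup>-\<^sup>1B]\<close> is kept as the sequence of its column
  blocks; its column set and its Gram matrix (the matrix times its transpose) are the union,
  respectively the sum, over the blocks. The rank is the dimension of the span of the columns.
\<close>

definition ctrb_block :: "real^'n::finite^'n \<Rightarrow> real^'m::finite^'n \<Rightarrow> nat \<Rightarrow> real^'m^'n" where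
  "ctrb_block A B j = mat_pow A j ** B"

definition ctrb_full_row_rank ::
  "real^'n::finite^'n \<Rightarrow> real^'m::finite^'n \<Rightarrow> nat \<Rightarrow> bool" where
  "ctrb_full_row_rank A B d \<longleftrightarrow> dim (\<Union>j<d. columns (ctrb_block A B j)) = CARD('n)"

definition controllability_index ::
  "real^'n::finite^'n \<Rightarrow> real^'m::finite^'n \<Rightarrow> nat \<Rightarrow> bool" where
  "controllability_index A B d \<longleftrightarrow>
     ctrb_full_row_rank A B d \<and> (\<forall>d'<d. \<not> ctrb_full_row_rank A B d')"

definition ctrb_gram ::
  "real^'n::finite^'n \<Rightarrow> real^'m::finite^'n \<Rightarrow> nat \<Rightarrow> real^'n^'n" where
  "ctrb_gram A B d = (\<Sum>j<d. ctrb_block A B j ** transpose (ctrb_block A B j))"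

text \<open>
  A matrix of full row rank has as many singular values as rows, namely the nonnegative roots of
  the eigenvalues of its Gram matrix. There are finitely many and at least one, so the infimum is
  the minimum.
\<close>

definition ctrb_sigma_min ::
  "real^'n::finite^'n \<Rightarrow> real^'m::finite^'n \<Rightarrow> nat \<Rightarrow> real" where
  "ctrb_sigma_min A B d =
     Inf {s. 0 \<le> s \<and> (\<exists>z. z \<noteq> 0 \<and> ctrb_gram A B d *v z = s\<^sup>2 *\<^sub>R z)}"

definition stabilizable ::
  "real \<Rightarrow> real \<Rightarrow> real^'n::finite^'n \<Rightarrow> real^'m::finite^'n \<Rightarrow> bool" where
  "stabilizable L \<gamma> A B \<longleftrightarrow>
     1 < L \<and> 0 < \<gamma> \<and> \<gamma> < 1 \<and>
     (\<exists>K :: real^'n^'m. opnorm K \<le> L \<and> (\<forall>t. opnorm (mat_pow (A - B ** K) t) \<le> L * \<gamma> ^ t))"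


definition networked_system ::
  "('v \<times> 'v) set \<Rightarrow> ('n \<Rightarrow> 'v) \<Rightarrow> ('m \<Rightarrow> 'v) \<Rightarrow> real^'n^'n \<Rightarrow> real^'m^'n \<Rightarrow> bool" where
  "networked_system E bx bu A B \<longleftrightarrow>
     sym E \<and> block_sparse E bx bx A \<and> block_sparse E bx bu B"

definition system_assms ::
  "('v::finite \<times> 'v) set \<Rightarrow> ('n::finite \<Rightarrow> 'v) \<Rightarrow> real^'n^'n \<Rightarrow> real^'m::finite^'n \<Rightarrow>
   real \<Rightarrow> real \<Rightarrow> real \<Rightarrow> nat \<Rightarrow> nat \<Rightarrow> bool" where
  "system_assms E bx A B L \<gamma> \<sigma> d \<kappa>\<^sub>0 \<longleftrightarrow>
     opnorm A \<le> L \<and> opnorm B \<le> L \<and> (\<exists>X. is_pinv B X \<and> opnorm X \<le> L) \<and>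
     controllability_index A B d \<and> 0 < \<sigma> \<and> \<sigma> \<le> ctrb_sigma_min A B d \<and>
     enat \<kappa>\<^sub>0 < gdiam E \<and>
     (\<forall>i. \<forall>\<kappa>\<ge>\<kappa>\<^sub>0. stabilizable L \<gamma>
        (restrict_rows bx (nbhd_upto E \<kappa> i) A) (restrict_rows bx (nbhd_upto E \<kappa> i) B))"

definition subexponential :: "(nat \<Rightarrow> real) \<Rightarrow> bool" where
  "subexponential p \<longleftrightarrow> (\<forall>d. 0 < p d) \<and> (\<lambda>d. ln (p d) / real d) \<longlonglongrightarrow> 0"

definition subexponential_growth :: "('v::finite \<times> 'v) set \<Rightarrow> (nat \<Rightarrow> real) \<Rightarrow> bool" where
  "subexponential_growth E p \<longleftrightarrow>
     subexponential p \<and> (\<forall>i d. real (card {j. gdist E i j = enat d}) \<le> p d)"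


definition strongly_convex :: "real \<Rightarrow> ('a::real_inner \<Rightarrow> real) \<Rightarrow> bool" where
  "strongly_convex \<mu> f \<longleftrightarrow> 0 < \<mu> \<and> convex_on UNIV (\<lambda>x. f x - \<mu> / 2 * (norm x)\<^sup>2)"

definition smooth :: "real \<Rightarrow> ('a::real_inner \<Rightarrow> real) \<Rightarrow> bool" where
  "smooth L f \<longleftrightarrow> (\<exists>g. (\<forall>x. GDERIV f x :> g x) \<and> L-lipschitz_on UNIV g)"

definition twice_cont_diff :: "(real^'n::finite \<Rightarrow> real) \<Rightarrow> bool" where
  "twice_cont_diff f \<longleftrightarrow>
     (\<exists>(g :: real^'n \<Rightarrow> real^'n) (H :: real^'n \<Rightarrow> real^'n^'n).
        (\<forall>x. GDERIV f x :> g x) \<and>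
        (\<forall>x. (g has_derivative (\<lambda>h. H x *v h)) (at x)) \<and> continuous_on UNIV H)"

definition regular_cost :: "real \<Rightarrow> real \<Rightarrow> (real^'n::finite \<Rightarrow> real) \<Rightarrow> bool" where
  "regular_cost \<mu> L f \<longleftrightarrow> strongly_convex \<mu> f \<and> smooth L f \<and> twice_cont_diff f"

definition K_function :: "('a::real_normed_vector \<Rightarrow> real) \<Rightarrow> bool" where
  "K_function F \<longleftrightarrow>
     (\<exists>\<beta> :: real \<Rightarrow> real. strict_mono_on {0..} \<beta> \<and> \<beta> 0 = 0 \<and> (\<forall>x. F x = \<beta> (norm x)))"

definition stage_cost_assms ::
  "('n::finite \<Rightarrow> 'v::finite) \<Rightarrow> ('m::finite \<Rightarrow> 'v) \<Rightarrow> real \<Rightarrow> real \<Rightarrow> nat \<Rightarrow>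
   (nat \<Rightarrow> real^'n \<Rightarrow> real) \<Rightarrow> (nat \<Rightarrow> real^'m \<Rightarrow> real) \<Rightarrow> bool" where
  "stage_cost_assms bx bu \<mu> L T f c \<longleftrightarrow>
     (\<forall>t\<in>{0..T}. separable bx (f t) \<and> regular_cost \<mu> L (f t) \<and>
                 (\<forall>x. 0 \<le> f t x) \<and> f t 0 = 0) \<and>
     (\<forall>t\<in>{1..T}. separable bu (c t) \<and> regular_cost \<mu> L (c t) \<and>
                 (\<forall>u. 0 \<le> c t u) \<and> c t 0 = 0)"

definition terminal_cost_assms :: "real \<Rightarrow> real \<Rightarrow> (real^'n::finite \<Rightarrow> real) \<Rightarrow> bool" where
  "terminal_cost_assms \<mu> L F \<longleftrightarrow> regular_cost \<mu> L F \<and> K_function F"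


definition trajectory ::
  "real^'n::finite^'n \<Rightarrow> real^'m::finite^'n \<Rightarrow> nat \<Rightarrow> (nat \<Rightarrow> real^'n) \<Rightarrow> real^'n \<Rightarrow>
   (nat \<Rightarrow> real^'n) \<Rightarrow> (nat \<Rightarrow> real^'m) \<Rightarrow> bool" where
  "trajectory A B T w x\<^sub>0 x u \<longleftrightarrow>
     x 0 = x\<^sub>0 \<and> (\<forall>t<T. x (Suc t) = A *v x t + B *v u t + w t)"

definition traj_cost ::
  "(nat \<Rightarrow> 'x \<Rightarrow> real) \<Rightarrow> (nat \<Rightarrow> 'u \<Rightarrow> real) \<Rightarrow> nat \<Rightarrow> (nat \<Rightarrow> 'x) \<Rightarrow> (nat \<Rightarrow> 'u) \<Rightarrow> real" where
  "traj_cost f c T x u = (\<Sum>t\<le>T. f t (x t)) + (\<Sum>t<T. c (t + 1) (u t))"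

text \<open>
  Only the entries \<open>0..p\<close> of states and \<open>0..p-1\<close> of inputs are relevant in a problem of horizon
  \<open>p\<close>; minimizers are therefore predicates on sequences, unconstrained beyond the horizon.
\<close>

definition is_offline_opt ::
  "real^'n::finite^'n \<Rightarrow> real^'m::finite^'n \<Rightarrow> (nat \<Rightarrow> real^'n \<Rightarrow> real) \<Rightarrow> (nat \<Rightarrow> real^'m \<Rightarrow> real) \<Rightarrow>
   nat \<Rightarrow> (nat \<Rightarrow> real^'n) \<Rightarrow> real^'n \<Rightarrow> (nat \<Rightarrow> real^'n) \<Rightarrow> (nat \<Rightarrow> real^'m) \<Rightarrow> bool" where
  "is_offline_opt A B f c T w x\<^sub>0 x u \<longleftrightarrow>
     is_arg_min (\<lambda>(x, u). traj_cost f c T x u) (\<lambda>(x, u). trajectory A B T w x\<^sub>0 x u) (x, u)"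

definition is_truncated_opt ::
  "('v \<times> 'v) set \<Rightarrow> ('n::finite \<Rightarrow> 'v) \<Rightarrow> real^'n^'n \<Rightarrow> real^'m::finite^'n \<Rightarrow>
   (nat \<Rightarrow> real^'n \<Rightarrow> real) \<Rightarrow> (nat \<Rightarrow> real^'m \<Rightarrow> real) \<Rightarrow> nat \<Rightarrow> nat \<Rightarrow>
   real^'n \<Rightarrow> (nat \<Rightarrow> real^'n) \<Rightarrow> nat \<Rightarrow> 'v \<Rightarrow> (real^'n \<Rightarrow> real) \<Rightarrow>
   (nat \<Rightarrow> real^'n) \<Rightarrow> (nat \<Rightarrow> real^'m) \<Rightarrow> bool" where
  "is_truncated_opt E bx A B f c t p x \<zeta> \<kappa> i g y v \<longleftrightarrow>
     (let S = nbhd_upto E \<kappa> i in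
      is_arg_min
        (\<lambda>(y, v). (\<Sum>\<tau><p. f (t + \<tau>) (y \<tau>)) + (\<Sum>\<tau>=1..p. c (t + \<tau>) (v (\<tau> - 1))) + g (y p))
        (\<lambda>(y, v). trajectory (restrict_rows bx S A) (restrict_rows bx S B) p
                    (\<lambda>\<tau>. restrict_vec bx S (\<zeta> \<tau>)) (restrict_vec bx S x) y v)
        (y, v))"

definition is_terminal_opt ::
  "real^'n::finite^'n \<Rightarrow> real^'m::finite^'n \<Rightarrow>
   (nat \<Rightarrow> real^'n \<Rightarrow> real) \<Rightarrow> (nat \<Rightarrow> real^'m \<Rightarrow> real) \<Rightarrow> nat \<Rightarrow> nat \<Rightarrow>
   real^'n \<Rightarrow> (nat \<Rightarrow> real^'n) \<Rightarrow> real^'n \<Rightarrow> (nat \<Rightarrow> real^'n) \<Rightarrow> (nat \<Rightarrow> real^'m) \<Rightarrow> bool" where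
  "is_terminal_opt A B f c t p x \<zeta> xbar y v \<longleftrightarrow>
     is_arg_min
       (\<lambda>(y, v). (\<Sum>\<tau>\<le>p. f (t + \<tau>) (y \<tau>)) + (\<Sum>\<tau>=1..p. c (t + \<tau>) (v (\<tau> - 1))))
       (\<lambda>(y, v). trajectory A B p \<zeta> x y v \<and> y p = xbar)
       (y, v)"

definition dtpc_trajectory ::
  "('v \<times> 'v) set \<Rightarrow> ('n::finite \<Rightarrow> 'v) \<Rightarrow> ('m::finite \<Rightarrow> 'v) \<Rightarrow> real^'n^'n \<Rightarrow> real^'m^'n \<Rightarrow>
   (nat \<Rightarrow> real^'n \<Rightarrow> real) \<Rightarrow> (nat \<Rightarrow> real^'m \<Rightarrow> real) \<Rightarrow> (real^'n \<Rightarrow> real) \<Rightarrow>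
   nat \<Rightarrow> nat \<Rightarrow> nat \<Rightarrow> (nat \<Rightarrow> real^'n) \<Rightarrow> real^'n \<Rightarrow>
   (nat \<Rightarrow> real^'n) \<Rightarrow> (nat \<Rightarrow> real^'m) \<Rightarrow> bool" where
  "dtpc_trajectory E bx bu A B f c F T k \<kappa> w x\<^sub>0 x u \<longleftrightarrow>
     trajectory A B T w x\<^sub>0 x u \<and>
     (\<forall>t<T. \<forall>i. \<exists>y v.
        is_truncated_opt E bx A B f c t (if t + k < T then k else T - t) (x t)
          (\<lambda>\<tau>. w (t + \<tau>)) \<kappa> i (if t + k < T then F else f T) y v \<and>
        restrict_vec bu {i} (u t) = restrict_vec bu {i} (v 0))"


definition mu_J :: "real \<Rightarrow> real \<Rightarrow> real" where
  "mu_J L \<gamma> = (1 - \<gamma>)\<^sup>2 / (L\<^sup>2 * (1 + L\<^sup>2))"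

definition L_H :: "real \<Rightarrow> real" where
  "L_H L = 2 * L + 1"

definition mu_H :: "real \<Rightarrow> real \<Rightarrow> real \<Rightarrow> real" where
  "mu_H L \<gamma> \<mu> =
     inverse (1 / \<mu> + (1 + 2 * L_H L / \<mu> + (L_H L)\<^sup>2 / \<mu>\<^sup>2) * (L_H L / mu_J L \<gamma>))"

definition rho_S :: "real \<Rightarrow> real \<Rightarrow> real \<Rightarrow> real" where
  "rho_S L \<gamma> \<mu> =
     sqrt (((L_H L)\<^sup>2 - (mu_H L \<gamma> \<mu>)\<^sup>2) / ((L_H L)\<^sup>2 + (mu_H L \<gamma> \<mu>)\<^sup>2))"

definition alpha_S :: "real \<Rightarrow> real \<Rightarrow> real \<Rightarrow> real" where
  "alpha_S L \<gamma> \<mu> = L_H L / ((mu_H L \<gamma> \<mu>)\<^sup>2 * rho_S L \<gamma> \<mu>)"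

definition delta_S :: "real \<Rightarrow> real \<Rightarrow> real \<Rightarrow> real" where
  "delta_S L \<gamma> \<mu> = (rho_S L \<gamma> \<mu> + 1) / 2"

definition Gamma_S :: "real \<Rightarrow> real \<Rightarrow> real \<Rightarrow> (nat \<Rightarrow> real) \<Rightarrow> real" where
  "Gamma_S L \<gamma> \<mu> p =
     4 * (alpha_S L \<gamma> \<mu>)\<^sup>2 * delta_S L \<gamma> \<mu> * L / (1 - delta_S L \<gamma> \<mu>)\<^sup>2 *
     (SUP d. (rho_S L \<gamma> \<mu> / delta_S L \<gamma> \<mu>) ^ d * p d)\<^sup>2 * p 1"

text \<open>
  \<open>\<Omega>\<close> and \<open>\<delta>\<close> are decay constants of the system \<open>(A, B)\<close>: one pair serves all cost sequences
  satisfying the standing assumptions with parameters \<open>\<mu>\<close> and \<open>L\<close>.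
\<close>

definition temporal_decay ::
  "('n::finite \<Rightarrow> 'v::finite) \<Rightarrow> ('m::finite \<Rightarrow> 'v) \<Rightarrow> real^'n^'n \<Rightarrow> real^'m^'n \<Rightarrow>
   real \<Rightarrow> real \<Rightarrow> nat \<Rightarrow> real \<Rightarrow> real \<Rightarrow> bool" where
  "temporal_decay bx bu A B \<mu> L d \<Omega> \<delta> \<longleftrightarrow>
     0 < \<Omega> \<and> 0 < \<delta> \<and> \<delta> < 1 \<and>
     (\<forall>T f c t p x \<zeta> xbar x' \<zeta>' xbar' y v y' v'.
        stage_cost_assms bx bu \<mu> L T f c \<and> d \<le> p \<and> t + p \<le> T \<and>
        is_terminal_opt A B f c t p x \<zeta> xbar y v \<and>
        is_terminal_opt A B f c t p x' \<zeta>' xbar' y' v' \<longrightarrow>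
        (\<forall>m\<le>p. norm (y m - y' m) \<le>
           \<Omega> * (\<delta> ^ m * norm (x - x') + \<delta> ^ (p - m) * norm (xbar - xbar') +
                (\<Sum>l<p. \<delta> ^ nat \<bar>int m - int l\<bar> * norm (\<zeta> l - \<zeta>' l)))))"

end

theory Submission
  imports Defs
begin

text \<open>
  The optimality (KKT) systems of all problems involved are studied by energy estimates. Testing
  with the state and using stabilizability for the multipliers bounds a solution by its residuals;
  conjugating with exponential weights in space or time (Combes--Thomas) changes the residuals only
  by small commutators, so influences decay at a rate \<open>\<theta> \<le> \<delta> ^ 4\<close>. Hence an agent's input
  is close to the first input of the optimal continuation to time \<open>T\<close>, and the closed loop solves
  the optimality system of the whole horizon up to small residuals. Weights centred at a time
  \<open>t\<close> then give the stability bound, and comparison with the offline optimum gives the regret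
  bound, because the cost is quadratic to leading order around its minimizer.
\<close>

subsection \<open>Matrices and blocks\<close>

text \<open>Two obstacles shape the argument. Stabilizability is assumed for truncated pairs, so the
  bound on multipliers is isolated as the property \<open>dual_bound\<close>, which passes from
  pairs truncated to whole components on to \<open>(A, B)\<close>. And the agents truncate different
  systems and meet the gradient of \<open>F\<close> at different states, so their inputs do not stem
  from one common problem; as \<open>F\<close> is radial, each such gradient is a multiple of the
  state with a factor between \<mu> and L, and the agents are compared through a one-parameter
  family of quadratic terminal costs. The estimates run with constants of their own:
  \<open>K\<close> for the energy estimate, \<open>G = K * L\<close>, and a rate with 1 - \<theta> =
  1/(6 G + 1). They meet the constants of the theorem in \<open>spatial_rate_bounds\<close>:
  \<open>delta_S\<close> is so close to 1 that 81 G^2 (1 - \<delta>) \<le> 1. Hence 1/\<xi> exceeds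
  81 G^2, and the lower bounds on k and \<kappa>, which push \<delta>^k and \<delta>^\<kappa> below
  multiples of (1 - \<delta>)^2, make the error of one step small enough for a small-gain
  argument.\<close>

declare transpose_matrix_vector [simp del]

lemma inner_matrix_transpose:
  fixes M :: "real^'m::finite^'n::finite"
  shows "(transpose M *v y) \<bullet> x = y \<bullet> (M *v x)"
  by (metis dot_lmul_matrix transpose_matrix_vector)

lemma norm_mult_le_opnorm:
  fixes M :: "real^'m::finite^'n::finite"
  assumes "opnorm M \<le> L"
  shows "norm (M *v x) \<le> L * norm x"
proof -
  have "norm (M *v x) \<le> opnorm M * norm x"
    by (rule onorm[OF matrix_vector_mul_bounded_linear])
  also have "\<dots> \<le> L * norm x" by (rule mult_right_mono[OF assms]) simp
  finally show ?thesis .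
qed

lemma norm_transpose_mult_le:
  fixes M :: "real^'m::finite^'n::finite"
  assumes "\<And>x. norm (M *v x) \<le> L * norm x"
  shows "norm (transpose M *v y) \<le> L * norm y"
proof (cases "transpose M *v y = 0")
  case True
  \<comment> \<open>A unit vector turns the bound for all x into \<open>0 \<le> L\<close>.\<close>
  have "0 \<le> norm (M *v axis undefined 1)" by simp
  also have "\<dots> \<le> L" using assms[of "axis undefined 1"] by (simp add: norm_axis_1)
  finally show ?thesis using True by simp
next
  case False
  let ?z = "transpose M *v y"
  have "(norm ?z)\<^sup>2 = y \<bullet> (M *v ?z)"
    by (simp add: power2_norm_eq_inner inner_matrix_transpose)
  also have "\<dots> \<le> norm y * norm (M *v ?z)" by (rule norm_cauchy_schwarz)
  also have "\<dots> \<le> norm y * (L * norm ?z)" by (intro mult_left_mono assms) simp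
  finally have "norm ?z * norm ?z \<le> (L * norm y) * norm ?z"
    by (simp add: power2_eq_square algebra_simps)
  then show ?thesis using False by simp
qed

lemma norm_vec_sq: "(norm (x :: real^'n::finite))\<^sup>2 = (\<Sum>a\<in>UNIV. (x $ a)\<^sup>2)"
  unfolding power2_norm_eq_inner inner_vec_def by (simp add: power2_eq_square)

lemma restrict_vec_nth [simp]: "restrict_vec b S x $ a = (if b a \<in> S then x $ a else 0)"
  by (simp add: restrict_vec_def)

lemma restrict_vec_zero [simp]: "restrict_vec b S 0 = 0"
  by (simp add: vec_eq_iff)

lemma restrict_vec_diff: "restrict_vec b S (x - y) = restrict_vec b S x - restrict_vec b S y"
  by (simp add: vec_eq_iff)

lemma restrict_vec_add: "restrict_vec b S (x + y) = restrict_vec b S x + restrict_vec b S y"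
  by (simp add: vec_eq_iff)

lemma norm_restrict_vec_le: "norm (restrict_vec b S x) \<le> norm (x :: real^'n::finite)"
proof -
  have "(norm (restrict_vec b S x))\<^sup>2 \<le> (norm x)\<^sup>2"
    unfolding norm_vec_sq by (intro sum_mono) simp
  then show ?thesis by (rule power2_le_imp_le) simp
qed

lemma inner_restrict_restrict:
  "restrict_vec b S x \<bullet> restrict_vec b S y = restrict_vec b S x \<bullet> (y :: real^'n::finite)"
  by (auto simp: inner_vec_def intro!: sum.cong)

lemma sum_blocks_inner:
  fixes b :: "'n::finite \<Rightarrow> 'v::finite"
  shows "(\<Sum>i\<in>UNIV. restrict_vec b {i} x \<bullet> restrict_vec b {i} y) = x \<bullet> y"
proof -
  have "(\<Sum>i\<in>UNIV. restrict_vec b {i} x \<bullet> restrict_vec b {i} y)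
    = (\<Sum>i\<in>UNIV. \<Sum>a\<in>UNIV. if b a = i then x $ a * y $ a else 0)"
    by (auto simp: inner_vec_def intro!: sum.cong)
  also have "\<dots> = (\<Sum>a\<in>UNIV. \<Sum>i\<in>UNIV. if b a = i then x $ a * y $ a else 0)"
    by (rule sum.swap)
  also have "\<dots> = x \<bullet> y" by (simp add: inner_vec_def)
  finally show ?thesis .
qed

lemma sum_blocks_norm:
  fixes b :: "'n::finite \<Rightarrow> 'v::finite"
  shows "(\<Sum>i\<in>UNIV. (norm (restrict_vec b {i} x))\<^sup>2) = (norm x)\<^sup>2"
  using sum_blocks_inner[of b x x] by (simp add: power2_norm_eq_inner)

lemma restrict_rows_mult: "restrict_rows b S M *v x = restrict_vec b S (M *v x)"
  by (simp add: vec_eq_iff restrict_rows_def matrix_vector_mult_def)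

lemma transpose_restrict_rows_mult:
  "transpose (restrict_rows b S M) *v x = transpose M *v restrict_vec b S x"
  by (auto simp: vec_eq_iff restrict_rows_def matrix_vector_mult_def transpose_def intro!: sum.cong)

section \<open>Weights on coordinates and their commutators with sparse matrices\<close>

definition scale_vec :: "('n::finite \<Rightarrow> real) \<Rightarrow> real^'n \<Rightarrow> real^'n" where
  "scale_vec w x = (\<chi> a. w a * x $ a)"

lemma scale_vec_nth [simp]: "scale_vec w x $ a = w a * x $ a"
  by (simp add: scale_vec_def)

lemma scale_vec_add: "scale_vec w (x + y) = scale_vec w x + scale_vec w y"
  by (simp add: vec_eq_iff algebra_simps)

lemma scale_vec_const [simp]: "scale_vec (\<lambda>_. c) x = c *\<^sub>R x"
  by (simp add: vec_eq_iff)

text \<open>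
  Entries of \<open>M\<close> linking the weight classes \<open>u\<close> and \<open>c * u\<close> act between pairwise orthogonal
  subspaces, so discarding all others does not increase the operator norm.
\<close>

lemma norm_weight_slice_le:
  fixes M :: "real^'m::finite^'n::finite" and w :: "'m \<Rightarrow> real" and w' :: "'n \<Rightarrow> real"
  assumes M: "\<And>x. norm (M *v x) \<le> L * norm x" and "0 < c" "0 \<le> L"
  shows "norm ((\<chi> i j. if w' i = c * w j then M $ i $ j else 0) *v x) \<le> L * norm x"
proof -
  define S where "S = (\<chi> i j. if w' i = c * w j then M $ i $ j else 0)"
  define xu where "xu u = (\<chi> j. if w j = u then x $ j else 0)" for u
  let ?U = "range w"
  \<comment> \<open>As c is positive, row \<open>i\<close> belongs to at most one class u, so it
    sees exactly one of the vectors \<open>xu u\<close> or none.\<close>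
  have S: "((S *v x) $ i)\<^sup>2 = (\<Sum>u\<in>?U. if w' i = c * u then ((M *v xu u) $ i)\<^sup>2 else 0)" for i
  proof (cases "w' i \<in> (\<lambda>u. c * u) ` ?U")
    case True
    then obtain u where u: "u \<in> ?U" "w' i = c * u" by blast
    have iff: "w' i = c * u' \<longleftrightarrow> u' = u" for u' using u(2) \<open>0 < c\<close> by auto
    have "(S *v x) $ i = (M *v xu u) $ i"
      unfolding S_def xu_def matrix_vector_mult_def using iff by (auto intro!: sum.cong)
    then show ?thesis using u(1) by (simp add: iff)
  next
    case False
    then have ne: "w' i \<noteq> c * w j" for j by auto
    then have "(S *v x) $ i = 0"
      unfolding S_def matrix_vector_mult_def by simp
    moreover have "(\<Sum>u\<in>?U. if w' i = c * u then ((M *v xu u) $ i)\<^sup>2 else 0) = 0"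
      using ne by (auto intro!: sum.neutral)
    ultimately show ?thesis by simp
  qed
  have "(norm (S *v x))\<^sup>2 = (\<Sum>i\<in>UNIV. \<Sum>u\<in>?U. if w' i = c * u then ((M *v xu u) $ i)\<^sup>2 else 0)"
    by (simp only: norm_vec_sq S)
  also have "\<dots> \<le> (\<Sum>i\<in>UNIV. \<Sum>u\<in>?U. ((M *v xu u) $ i)\<^sup>2)"
    by (intro sum_mono) simp
  also have "\<dots> = (\<Sum>u\<in>?U. (norm (M *v xu u))\<^sup>2)"
    unfolding norm_vec_sq by (rule sum.swap)
  also have "\<dots> \<le> (\<Sum>u\<in>?U. (L * norm (xu u))\<^sup>2)"
    by (intro sum_mono power_mono M) simp
  also have "\<dots> = L\<^sup>2 * (\<Sum>u\<in>?U. \<Sum>j\<in>UNIV. if w j = u then (x $ j)\<^sup>2 else 0)"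
    by (auto simp: power_mult_distrib norm_vec_sq xu_def sum_distrib_left intro!: sum.cong)
  also have "(\<Sum>u\<in>?U. \<Sum>j\<in>UNIV. if w j = u then (x $ j)\<^sup>2 else 0)
    = (\<Sum>j\<in>UNIV. \<Sum>u\<in>?U. if w j = u then (x $ j)\<^sup>2 else 0)" by (rule sum.swap)
  also have "\<dots> = (norm x)\<^sup>2" by (simp add: norm_vec_sq)
  finally have "(norm (S *v x))\<^sup>2 \<le> (L * norm x)\<^sup>2" by (simp add: power_mult_distrib)
  then show ?thesis unfolding S_def by (rule power2_le_imp_le) (use \<open>0 \<le> L\<close> in simp)
qed

text \<open>On the support of \<open>M\<close> the difference of weights is 0, (\<beta> - 1) times
  \<open>w j\<close> or (1/\<beta> - 1) times \<open>w j\<close>. So the commutator acts on the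
  weighted vector as a combination of two slices of \<open>M\<close>, each of norm at most
  \<open>L\<close>. The coefficients add up to \<beta> - 1/\<beta>, which tends to 0 with \<beta> -
  1, and no factor for the dimension or the number of nodes appears.\<close>

lemma norm_weight_commutator_le:
  fixes M :: "real^'m::finite^'n::finite" and w :: "'m \<Rightarrow> real" and w' :: "'n \<Rightarrow> real"
  assumes M: "\<And>x. norm (M *v x) \<le> L * norm x" and "0 \<le> L" "1 < \<beta>"
    and pos: "\<And>j. 0 < w j"
    and ratio: "\<And>i j. M $ i $ j \<noteq> 0 \<Longrightarrow> w' i = w j \<or> w' i = \<beta> * w j \<or> \<beta> * w' i = w j"
  shows "norm (scale_vec w' (M *v x) - M *v scale_vec w x) \<le> (\<beta> - 1 / \<beta>) * L * norm (scale_vec w x)"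
proof -
  define S where "S c = (\<chi> i j. if w' i = c * w j then M $ i $ j else 0)" for c
  let ?y = "scale_vec w x"
  have entry: "M $ i $ j * (w' i - w j) * x $ j
      = (\<beta> - 1) * (S \<beta> $ i $ j * ?y $ j) + (1 / \<beta> - 1) * (S (1 / \<beta>) $ i $ j * ?y $ j)" for i j
  proof (cases "M $ i $ j = 0")
    case True
    then show ?thesis by (simp add: S_def)
  next
    case False
    consider "w' i = w j" | "w' i = \<beta> * w j" | "\<beta> * w' i = w j" using ratio[OF False] by blast
    then show ?thesis
    proof cases
      case 1
      have "\<beta> * w j \<noteq> w j" "1 / \<beta> * w j \<noteq> w j" using pos[of j] \<open>1 < \<beta>\<close> by (auto simp: field_simps)
      then show ?thesis using 1 by (auto simp: S_def)
    next
      case 2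
      have "\<beta> * w j > w j" "w j > w j / \<beta>" using pos[of j] \<open>1 < \<beta>\<close>
        by (auto simp: field_simps)
      then have "\<beta> * w j \<noteq> 1 / \<beta> * w j" by simp
      then show ?thesis using 2 by (auto simp: S_def algebra_simps)
    next
      case 3
      have "\<beta> * w j > w j" "w j > w j / \<beta>" using pos[of j] \<open>1 < \<beta>\<close>
        by (auto simp: field_simps)
      then have ne: "w j / \<beta> \<noteq> \<beta> * w j" by simp
      have "w' i = w j / \<beta>" using 3 \<open>1 < \<beta>\<close> by (simp add: field_simps)
      then show ?thesis using ne \<open>1 < \<beta>\<close> by (auto simp: S_def field_simps)
    qed
  qed
  have "scale_vec w' (M *v x) - M *v ?y = (\<beta> - 1) *\<^sub>R (S \<beta> *v ?y) + (1 / \<beta> - 1) *\<^sub>R (S (1 / \<beta>) *v ?y)"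
  proof -
    have "(scale_vec w' (M *v x) - M *v ?y) $ i
      = ((\<beta> - 1) *\<^sub>R (S \<beta> *v ?y) + (1 / \<beta> - 1) *\<^sub>R (S (1 / \<beta>) *v ?y)) $ i" for i
    proof -
      have "(scale_vec w' (M *v x) - M *v ?y) $ i = (\<Sum>j\<in>UNIV. M $ i $ j * (w' i - w j) * x $ j)"
        by (simp add: matrix_vector_mult_def sum_distrib_left flip: sum_subtractf)
           (auto simp: algebra_simps intro!: sum.cong)
      also have "\<dots> = (\<beta> - 1) * (\<Sum>j\<in>UNIV. S \<beta> $ i $ j * ?y $ j)
          + (1 / \<beta> - 1) * (\<Sum>j\<in>UNIV. S (1 / \<beta>) $ i $ j * ?y $ j)"
        unfolding entry by (simp add: sum.distrib sum_distrib_left)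
      finally show ?thesis by (simp add: matrix_vector_mult_def)
    qed
    then show ?thesis by (simp add: vec_eq_iff)
  qed
  also have "norm \<dots> \<le> \<bar>\<beta> - 1\<bar> * norm (S \<beta> *v ?y) + \<bar>1 / \<beta> - 1\<bar> * norm (S (1 / \<beta>) *v ?y)"
    by (rule norm_triangle_le) simp
  also have "\<dots> \<le> \<bar>\<beta> - 1\<bar> * (L * norm ?y) + \<bar>1 / \<beta> - 1\<bar> * (L * norm ?y)"
    unfolding S_def using \<open>1 < \<beta>\<close> \<open>0 \<le> L\<close>
    by (intro add_mono mult_left_mono norm_weight_slice_le M) auto
  also have "\<dots> = (\<beta> - 1 / \<beta>) * L * norm ?y"
    using \<open>1 < \<beta>\<close> by (simp add: algebra_simps)
  finally show ?thesis .
qed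

text \<open>Monotonicity and the Lipschitz bound are demanded block by block, since a weight that
  varies from node to node passes through a gradient only if the cost decouples over the nodes.
  \<open>g\<close> is a single vector, typically a difference of two gradients.\<close>

definition block_bounds ::
  "('n::finite \<Rightarrow> 'v::finite) \<Rightarrow> real \<Rightarrow> real \<Rightarrow> real^'n \<Rightarrow> real^'n \<Rightarrow> bool" where
  "block_bounds b \<mu> L g y \<longleftrightarrow>
     (\<forall>i. \<mu> * (norm (restrict_vec b {i} y))\<^sup>2 \<le> restrict_vec b {i} g \<bullet> restrict_vec b {i} y \<and>
          norm (restrict_vec b {i} g) \<le> L * norm (restrict_vec b {i} y))"

lemma restrict_scale_vec:
  "restrict_vec b {i} (scale_vec (\<lambda>a. w (b a)) x) = w i *\<^sub>R restrict_vec b {i} x"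
  by (simp add: vec_eq_iff)

text \<open>Blocks are orthogonal and the weight is a scalar on each, so the bounds of the blocks,
  multiplied by the squared weights, add up.\<close>

lemma block_bounds_scale_vec:
  assumes "block_bounds b \<mu> L g y" and "0 \<le> L"
  shows "\<mu> * (norm (scale_vec (\<lambda>a. w (b a)) y))\<^sup>2 \<le> scale_vec (\<lambda>a. w (b a)) g \<bullet> scale_vec (\<lambda>a. w (b a)) y"
    and "norm (scale_vec (\<lambda>a. w (b a)) g) \<le> L * norm (scale_vec (\<lambda>a. w (b a)) y)"
proof -
  let ?s = "scale_vec (\<lambda>a. w (b a))"
  let ?P = "\<lambda>i. restrict_vec b {i}"
  have "\<mu> * (norm (?s y))\<^sup>2 = (\<Sum>i\<in>UNIV. (w i)\<^sup>2 * (\<mu> * (norm (?P i y))\<^sup>2))"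
    by (simp add: sum_blocks_norm[of b "?s y", symmetric] restrict_scale_vec
        power_mult_distrib sum_distrib_left mult.left_commute mult.assoc)
  also have "\<dots> \<le> (\<Sum>i\<in>UNIV. (w i)\<^sup>2 * (?P i g \<bullet> ?P i y))"
    using assms(1) by (intro sum_mono mult_left_mono) (auto simp: block_bounds_def)
  also have "\<dots> = ?s g \<bullet> ?s y"
    by (simp add: sum_blocks_inner[of b "?s g" "?s y", symmetric] restrict_scale_vec
        power2_eq_square mult.assoc)
  finally show "\<mu> * (norm (?s y))\<^sup>2 \<le> ?s g \<bullet> ?s y" .
  have "(norm (?s g))\<^sup>2 = (\<Sum>i\<in>UNIV. (w i)\<^sup>2 * (norm (?P i g))\<^sup>2)"
    by (simp add: sum_blocks_norm[of b "?s g", symmetric] restrict_scale_vec power_mult_distrib)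
  also have "\<dots> \<le> (\<Sum>i\<in>UNIV. (w i)\<^sup>2 * (L * norm (?P i y))\<^sup>2)"
    using assms(1) by (intro sum_mono mult_left_mono power_mono) (auto simp: block_bounds_def)
  also have "\<dots> = (L * norm (?s y))\<^sup>2"
    by (simp add: power_mult_distrib sum_blocks_norm[of b "?s y", symmetric] restrict_scale_vec
        sum_distrib_left mult.left_commute)
  finally show "norm (?s g) \<le> L * norm (?s y)"
    by (rule power2_le_imp_le) (use assms(2) in simp)
qed

lemma block_bounds_global:
  assumes "block_bounds b \<mu> L g y" and "0 \<le> L"
  shows "\<mu> * (norm y)\<^sup>2 \<le> g \<bullet> y" and "norm g \<le> L * norm y"
  using block_bounds_scale_vec[OF assms, of "\<lambda>_. 1"] by simp_all

subsection \<open>Energy estimates for perturbed optimality systems\<close>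

definition sq_sum :: "nat \<Rightarrow> (nat \<Rightarrow> 'a::real_normed_vector) \<Rightarrow> real" where
  "sq_sum n y = (\<Sum>t<n. (norm (y t))\<^sup>2)"

lemma sq_sum_nonneg [simp]: "0 \<le> sq_sum n y"
  by (simp add: sq_sum_def sum_nonneg)

lemma norm_sq_le_sq_sum: "t < n \<Longrightarrow> (norm (y t))\<^sup>2 \<le> sq_sum n y"
  unfolding sq_sum_def by (rule member_le_sum) auto

lemma sq_sum_add_le: "sq_sum n (\<lambda>t. x t + y t) \<le> 2 * sq_sum n x + 2 * sq_sum n y"
proof -
  have "(norm (x t + y t))\<^sup>2 \<le> 2 * (norm (x t))\<^sup>2 + 2 * (norm (y t))\<^sup>2" for t
  proof -
    have "(norm (x t + y t))\<^sup>2 \<le> (norm (x t) + norm (y t))\<^sup>2"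
      by (intro power_mono norm_triangle_ineq) simp
    also have "\<dots> \<le> 2 * (norm (x t))\<^sup>2 + 2 * (norm (y t))\<^sup>2"
      using sum_squares_bound[of "norm (x t)" "norm (y t)"] by (simp add: power2_sum)
    finally show ?thesis .
  qed
  then show ?thesis
    unfolding sq_sum_def by (simp add: sum_distrib_left sum_mono flip: sum.distrib)
qed

lemma sq_sum_le_scaled:
  assumes "\<And>t. t < n \<Longrightarrow> norm (x t) \<le> c * norm (y t)"
  shows "sq_sum n x \<le> c\<^sup>2 * sq_sum n y"
  unfolding sq_sum_def sum_distrib_left power_mult_distrib[symmetric]
  by (intro sum_mono power_mono assms) auto

lemma sq_sum_shift_le: "sq_sum n (\<lambda>t. y (Suc t)) \<le> sq_sum (Suc n) y"
  unfolding sq_sum_def by (subst sum.lessThan_Suc_shift) simp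

section \<open>Bounds for multipliers from stabilizability\<close>

lemma sum_sq_geometric_le:
  fixes a c :: "nat \<Rightarrow> real"
  assumes "0 \<le> \<gamma>" "\<gamma> < 1" and rec: "\<And>t. t < p \<Longrightarrow> c t = a t + \<gamma> * c (Suc t)" and "c p = a p"
  shows "(\<Sum>t<Suc p. (c t)\<^sup>2) \<le> (\<Sum>t<Suc p. (a t)\<^sup>2) / (1 - \<gamma>)\<^sup>2"
proof -
  let ?S = "\<Sum>t<Suc p. (c t)\<^sup>2" and ?A = "\<Sum>t<Suc p. (a t)\<^sup>2"
  \<comment> \<open>Convexity of the square: \<open>c t\<close> is the convex combination of
    \<open>a t / (1 - \<gamma>)\<close> and \<open>c (Suc t)\<close> with coefficients 1 - \<gamma>
    and \<gamma>. Summed up, this is Young's inequality for the convolution with a geometric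
    kernel.\<close>
  have step: "(c t)\<^sup>2 \<le> (a t)\<^sup>2 / (1 - \<gamma>) + \<gamma> * (c (Suc t))\<^sup>2" if "t < p" for t
  proof -
    have "(1 - \<gamma>) * (c t)\<^sup>2 + \<gamma> * (a t - (1 - \<gamma>) * c (Suc t))\<^sup>2
        = (a t)\<^sup>2 + (1 - \<gamma>) * \<gamma> * (c (Suc t))\<^sup>2"
      unfolding rec[OF that] by (simp add: power2_eq_square algebra_simps)
    moreover have "0 \<le> \<gamma> * (a t - (1 - \<gamma>) * c (Suc t))\<^sup>2" using assms(1) by simp
    ultimately have "(1 - \<gamma>) * (c t)\<^sup>2 \<le> (a t)\<^sup>2 + (1 - \<gamma>) * \<gamma> * (c (Suc t))\<^sup>2" by linarith
    then show ?thesis using \<open>\<gamma> < 1\<close> by (simp add: field_simps)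
  qed
  have "?S = (\<Sum>t<p. (c t)\<^sup>2) + (a p)\<^sup>2" using assms(4) by simp
  also have "\<dots> \<le> (\<Sum>t<p. (a t)\<^sup>2 / (1 - \<gamma>) + \<gamma> * (c (Suc t))\<^sup>2) + (a p)\<^sup>2 / (1 - \<gamma>)"
    using assms(1,2) by (intro add_mono sum_mono step) (auto simp: field_simps)
  also have "\<dots> = ?A / (1 - \<gamma>) + \<gamma> * (\<Sum>t<p. (c (Suc t))\<^sup>2)"
    by (simp add: sum.distrib sum_distrib_left sum_divide_distrib add_divide_distrib)
  also have "\<dots> \<le> ?A / (1 - \<gamma>) + \<gamma> * ?S"
    using assms(1) by (intro add_mono mult_left_mono) (auto simp only: sum.lessThan_Suc_shift, simp)
  finally have "(1 - \<gamma>) * ?S \<le> ?A / (1 - \<gamma>)" by (simp add: algebra_simps)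
  then have "(1 - \<gamma>)\<^sup>2 * ?S \<le> ?A"
    using \<open>\<gamma> < 1\<close> by (simp add: pos_le_divide_eq power2_eq_square mult_ac)
  then show ?thesis using \<open>\<gamma> < 1\<close> by (simp add: pos_le_divide_eq mult.commute)
qed

text \<open>Detectability of the adjoint recursion, uniform in the horizon: a multiplier is
  controlled by the inhomogeneities \<open>h\<close> and by its output \<open>e\<close>. No feedback
  matrix occurs, so the property can be glued together from subsystems.\<close>

definition dual_bound :: "real \<Rightarrow> real^'n::finite^'n \<Rightarrow> real^'m::finite^'n \<Rightarrow> bool" where
  "dual_bound J A B \<longleftrightarrow>
     (\<forall>p l h e. (\<forall>t<p. l t = transpose A *v l (Suc t) + h t \<and> transpose B *v l (Suc t) = e t) \<and>
        l p = h p \<longrightarrow>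
        sq_sum (Suc p) l \<le> J\<^sup>2 * (sq_sum (Suc p) h + sq_sum p e))"

lemma mat_pow_0: "mat_pow M 0 = mat 1" and mat_pow_Suc: "mat_pow M (Suc t) = M ** mat_pow M t"
  by (simp_all add: mat_pow_def)

lemma mat_pow_Suc_right: "mat_pow M (Suc t) = mat_pow M t ** M"
proof (induction t)
  case 0
  then show ?case by (simp add: mat_pow_0 mat_pow_Suc)
next
  case (Suc t)
  have "mat_pow M (Suc (Suc t)) = M ** (mat_pow M t ** M)"
    using Suc by (simp add: mat_pow_Suc[of M "Suc t"])
  then show ?case by (simp add: mat_pow_Suc[of M t] matrix_mul_assoc)
qed

text \<open>Output injection: subtracting the transposed gain times the output replaces
  \<open>transpose A\<close> by the transpose of \<open>A - B ** K\<close>, whose powers decay, so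
  \<open>l\<close> is a geometric sum of inhomogeneities. In the constant, L comes from the powers,
  the square root from Cauchy-Schwarz for |h| + L |e|, and 1/(1 - \<gamma>) from the geometric
  kernel. Its square is the reciprocal of \<open>mu_J\<close>.\<close>

lemma stabilizable_imp_dual_bound:
  fixes A :: "real^'n::finite^'n" and B :: "real^'m::finite^'n"
  assumes "stabilizable L \<gamma> A B"
  shows "dual_bound (L * sqrt (1 + L\<^sup>2) / (1 - \<gamma>)) A B"
proof -
  from assms obtain K where L: "1 < L" and \<gamma>: "0 < \<gamma>" "\<gamma> < 1"
    and K: "opnorm K \<le> L" and pw: "\<And>t. opnorm (mat_pow (A - B ** K) t) \<le> L * \<gamma> ^ t"
    by (auto simp: stabilizable_def)
  define M where "M = A - B ** K"
  have Kt: "norm (transpose K *v z) \<le> L * norm z" for z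
    by (intro norm_transpose_mult_le norm_mult_le_opnorm K)
  have pwt: "norm (transpose (mat_pow M t) *v z) \<le> L * \<gamma> ^ t * norm z" for t z
    unfolding M_def by (intro norm_transpose_mult_le norm_mult_le_opnorm pw)
  have tM: "transpose M = transpose A - transpose K ** transpose B"
    by (simp add: M_def matrix_transpose_mul[symmetric]) (simp add: transpose_def vec_eq_iff)
  show ?thesis unfolding dual_bound_def
  proof (intro allI impI, elim conjE)
    fix p and l h :: "nat \<Rightarrow> real^'n" and e :: "nat \<Rightarrow> real^'m"
    assume rec: "\<forall>t<p. l t = transpose A *v l (Suc t) + h t \<and> transpose B *v l (Suc t) = e t"
      and lp: "l p = h p"
    define H where "H t = (if t < p then h t + transpose K *v e t else h t)" for t
    have recM: "l t = transpose M *v l (Suc t) + H t" if "t < p" for t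
    proof -
      have "transpose M *v l (Suc t) = transpose A *v l (Suc t) - transpose K *v e t"
        using rec that by (simp add: tM matrix_vector_mult_diff_rdistrib matrix_vector_mul_assoc[symmetric])
      then show ?thesis using rec that by (simp add: H_def)
    qed
    have expl: "l t = (\<Sum>s=t..p. transpose (mat_pow M (s - t)) *v H s)" if "t \<le> p" for t
      using that
    proof (induction rule: inc_induct)
      case base
      then show ?case using lp by (simp add: H_def mat_pow_0 transpose_mat)
    next
      case (step t)
      have "l t = (\<Sum>s=Suc t..p. transpose M *v (transpose (mat_pow M (s - Suc t)) *v H s)) + H t"
        using recM step by (simp add: linear_sum[OF matrix_vector_mul_linear])
      also have "(\<Sum>s=Suc t..p. transpose M *v (transpose (mat_pow M (s - Suc t)) *v H s))
        = (\<Sum>s=Suc t..p. transpose (mat_pow M (s - t)) *v H s)"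
      proof (intro sum.cong refl)
        fix s assume "s \<in> {Suc t..p}"
        then have "s - t = Suc (s - Suc t)" by auto
        then show "transpose M *v (transpose (mat_pow M (s - Suc t)) *v H s)
            = transpose (mat_pow M (s - t)) *v H s"
          by (simp add: mat_pow_Suc_right matrix_transpose_mul matrix_vector_mul_assoc)
      qed
      finally show ?case using step
        by (simp add: sum.atLeast_Suc_atMost[of t p] mat_pow_0 transpose_mat add.commute)
    qed
    define c where "c t = (\<Sum>s=t..p. \<gamma> ^ (s - t) * norm (H s))" for t
    have c_rec: "c t = norm (H t) + \<gamma> * c (Suc t)" if "t < p" for t
    proof -
      have "\<gamma> * c (Suc t) = (\<Sum>s=Suc t..p. \<gamma> ^ (s - t) * norm (H s))"
        unfolding c_def sum_distrib_left
      proof (intro sum.cong refl)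
        fix s assume "s \<in> {Suc t..p}"
        then have "s - t = Suc (s - Suc t)" by auto
        then show "\<gamma> * (\<gamma> ^ (s - Suc t) * norm (H s)) = \<gamma> ^ (s - t) * norm (H s)" by simp
      qed
      then show ?thesis using that by (simp add: c_def sum.atLeast_Suc_atMost[of t p])
    qed
    have "norm (l t) \<le> L * norm (c t)" if "t \<le> p" for t
    proof -
      have "norm (l t) \<le> (\<Sum>s=t..p. L * (\<gamma> ^ (s - t) * norm (H s)))"
        unfolding expl[OF that] using pwt by (intro sum_norm_le) (simp add: mult.assoc)
      also have "\<dots> = L * c t" by (simp add: c_def sum_distrib_left)
      finally show ?thesis using L by (smt (verit) mult_left_mono real_norm_def)
    qed
    then have "sq_sum (Suc p) l \<le> L\<^sup>2 * sq_sum (Suc p) c"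
      by (intro sq_sum_le_scaled) auto
    also have "sq_sum (Suc p) c \<le> sq_sum (Suc p) H / (1 - \<gamma>)\<^sup>2"
      using sum_sq_geometric_le[of \<gamma> p c "\<lambda>t. norm (H t)"] c_rec \<gamma>
      by (simp add: sq_sum_def c_def)
    also have "sq_sum (Suc p) H \<le> (1 + L\<^sup>2) * (sq_sum (Suc p) h + sq_sum p e)"
    proof -
      have *: "(norm (H t))\<^sup>2 \<le> (1 + L\<^sup>2) * ((norm (h t))\<^sup>2 + (norm (e t))\<^sup>2)" if "t < p" for t
      proof -
        have "norm (H t) \<le> norm (h t) + L * norm (e t)"
          using that Kt[of "e t"] norm_triangle_ineq[of "h t" "transpose K *v e t"] by (simp add: H_def)
        then have "(norm (H t))\<^sup>2 \<le> (norm (h t) + L * norm (e t))\<^sup>2" by (intro power_mono) auto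
        also have "\<dots> + (L * norm (h t) - norm (e t))\<^sup>2 = (1 + L\<^sup>2) * ((norm (h t))\<^sup>2 + (norm (e t))\<^sup>2)"
          by (simp add: power2_eq_square algebra_simps)
        finally show ?thesis by (smt (verit) zero_le_power2)
      qed
      have "sq_sum (Suc p) H \<le> (\<Sum>t<p. (1 + L\<^sup>2) * ((norm (h t))\<^sup>2 + (norm (e t))\<^sup>2)) + (1 + L\<^sup>2) * (norm (h p))\<^sup>2"
      proof -
        have "(norm (H p))\<^sup>2 \<le> (1 + L\<^sup>2) * (norm (h p))\<^sup>2"
          by (simp add: H_def algebra_simps)
        moreover have "(\<Sum>t<p. (norm (H t))\<^sup>2) \<le> (\<Sum>t<p. (1 + L\<^sup>2) * ((norm (h t))\<^sup>2 + (norm (e t))\<^sup>2))"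
          by (intro sum_mono *) simp
        ultimately show ?thesis by (simp add: sq_sum_def)
      qed
      also have "\<dots> = (1 + L\<^sup>2) * (sq_sum (Suc p) h + sq_sum p e)"
        by (simp add: sq_sum_def sum.distrib sum_distrib_left algebra_simps)
      finally show ?thesis .
    qed
    finally have "sq_sum (Suc p) l \<le> L\<^sup>2 * ((1 + L\<^sup>2) * (sq_sum (Suc p) h + sq_sum p e) / (1 - \<gamma>)\<^sup>2)"
      by (smt (verit) divide_right_mono mult_left_mono zero_le_power2)
    then show "sq_sum (Suc p) l \<le> (L * sqrt (1 + L\<^sup>2) / (1 - \<gamma>))\<^sup>2 * (sq_sum (Suc p) h + sq_sum p e)"
      by (simp add: power_divide power_mult_distrib)
  qed
qed

text \<open>The optimality system with defects: \<open>q\<close> in the initial state and the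
  dynamics, \<open>r\<close> and \<open>s\<close> in the stationarity conditions for states and
  inputs. The gradients are mere sequences \<open>g\<close> and \<open>h\<close>, so that one form
  covers solutions, differences of solutions and weighted solutions; costs enter through bounds that
  relate \<open>g\<close> to \<open>y\<close> and \<open>h\<close> to \<open>v\<close>.\<close>

definition residual_system ::
  "real^'n::finite^'n \<Rightarrow> real^'m::finite^'n \<Rightarrow> nat \<Rightarrow> (nat \<Rightarrow> real^'n) \<Rightarrow> (nat \<Rightarrow> real^'m) \<Rightarrow>
   (nat \<Rightarrow> real^'n) \<Rightarrow> (nat \<Rightarrow> real^'n) \<Rightarrow> (nat \<Rightarrow> real^'m) \<Rightarrow>
   (nat \<Rightarrow> real^'n) \<Rightarrow> (nat \<Rightarrow> real^'m) \<Rightarrow> (nat \<Rightarrow> real^'n) \<Rightarrow> bool" where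
  "residual_system A B p y v l g h r s q \<longleftrightarrow>
     y 0 = q 0 \<and> (\<forall>t<p. y (Suc t) = A *v y t + B *v v t + q (Suc t)) \<and>
     (\<forall>t<p. g t + l t = transpose A *v l (Suc t) + r t) \<and> g p + l p = r p \<and>
     (\<forall>t<p. h t = transpose B *v l (Suc t) + s t)"

text \<open>Summation by parts: the state recursion with \<open>A\<close>, \<open>B\<close> and the
  multiplier recursion with their transposes cancel up to the telescoping term
  \<open>l n \<bullet> y n\<close>.\<close>

lemma residual_system_duality:
  assumes "residual_system A B p y v l g h r s q"
  shows "(\<Sum>t<Suc p. g t \<bullet> y t) + (\<Sum>t<p. h t \<bullet> v t)
       = (\<Sum>t<Suc p. r t \<bullet> y t) + (\<Sum>t<p. s t \<bullet> v t) - (\<Sum>t<Suc p. l t \<bullet> q t)"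
proof -
  have y0: "y 0 = q 0"
    and y: "\<And>t. t < p \<Longrightarrow> y (Suc t) = A *v y t + B *v v t + q (Suc t)"
    and g: "\<And>t. t < p \<Longrightarrow> g t = transpose A *v l (Suc t) + r t - l t"
    and gp: "g p = r p - l p"
    and h: "\<And>t. t < p \<Longrightarrow> h t = transpose B *v l (Suc t) + s t"
    using assms by (auto simp: residual_system_def algebra_simps eq_diff_eq)
  have "(\<Sum>t<n. g t \<bullet> y t) + (\<Sum>t<n. h t \<bullet> v t)
      = (\<Sum>t<n. r t \<bullet> y t) + (\<Sum>t<n. s t \<bullet> v t) - (\<Sum>t<Suc n. l t \<bullet> q t) + l n \<bullet> y n"
    if "n \<le> p" for n using that
  proof (induction n)
    case 0
    then show ?case by (simp add: y0)
  next
    case (Suc n)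
    then have n: "n < p" by simp
    have "g n \<bullet> y n + h n \<bullet> v n
        = r n \<bullet> y n + s n \<bullet> v n - l (Suc n) \<bullet> q (Suc n) + l (Suc n) \<bullet> y (Suc n) - l n \<bullet> y n"
      unfolding g[OF n] h[OF n] y[OF n]
      by (simp add: inner_add_left inner_add_right inner_diff_left inner_matrix_transpose)
    then show ?case using Suc by simp
  qed
  from this[of p] show ?thesis by (simp add: gp inner_diff_left)
qed

lemma inner_weighted_le:
  fixes x y :: "'a::real_inner"
  assumes "0 < e"
  shows "x \<bullet> y \<le> (norm x)\<^sup>2 / (2 * e) + e / 2 * (norm y)\<^sup>2"
proof -
  have "x \<bullet> y \<le> norm x * norm y" by (rule norm_cauchy_schwarz)
  also have "\<dots> \<le> (norm x)\<^sup>2 / (2 * e) + e / 2 * (norm y)\<^sup>2"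
  proof -
    have "0 \<le> (norm x - e * norm y)\<^sup>2 / (2 * e)" using assms by simp
    also have "\<dots> = (norm x)\<^sup>2 / (2 * e) + e / 2 * (norm y)\<^sup>2 - norm x * norm y"
      using assms by (simp add: power2_eq_square field_simps)
    finally show ?thesis by simp
  qed
  finally show ?thesis .
qed

lemma sum_inner_weighted_le:
  fixes x y :: "nat \<Rightarrow> 'a::real_inner"
  assumes "0 < e"
  shows "(\<Sum>t<n. x t \<bullet> y t) \<le> sq_sum n x / (2 * e) + e / 2 * sq_sum n y"
  unfolding sq_sum_def sum_divide_distrib sum_distrib_left sum.distrib[symmetric]
  by (intro sum_mono inner_weighted_le assms)

text \<open>Measures a solution \<open>(y, v, l)\<close> and equally its residuals
  \<open>(r, s, q)\<close>, which live in the same spaces.\<close>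

definition energy :: "nat \<Rightarrow> (nat \<Rightarrow> 'a::real_normed_vector) \<Rightarrow> (nat \<Rightarrow> 'b::real_normed_vector) \<Rightarrow>
    (nat \<Rightarrow> 'a) \<Rightarrow> real" where
  "energy p y v l = sq_sum (Suc p) y + sq_sum p v + sq_sum (Suc p) l"

lemma energy_nonneg [simp]: "0 \<le> energy p y v l"
  by (simp add: energy_def)

text \<open>Strong monotonicity bounds the squares X of \<open>y\<close> and \<open>v\<close> by the
  residuals paired with \<open>y\<close>, \<open>v\<close> and \<open>l\<close>. The multiplier
  solves a recursion whose inhomogeneities are residuals and gradients, so \<open>dual_bound\<close>
  returns its squares as residuals plus 2 (J L)^2 X. Young's inequality closes this loop.\<close>

lemma base_energy_estimate:
  fixes A :: "real^'n::finite^'n" and B :: "real^'m::finite^'n"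
  assumes sys: "residual_system A B p y v l g h r s q"
    and dual: "dual_bound J A B"
    and \<mu>: "0 < \<mu>" "\<mu> \<le> L" and JL: "1 \<le> J * L" and L: "1 \<le> L"
    and g: "\<And>t. t \<le> p \<Longrightarrow> \<mu> * (norm (y t))\<^sup>2 \<le> g t \<bullet> y t" "\<And>t. t \<le> p \<Longrightarrow> norm (g t) \<le> L * norm (y t)"
    and h: "\<And>t. t < p \<Longrightarrow> \<mu> * (norm (v t))\<^sup>2 \<le> h t \<bullet> v t" "\<And>t. t < p \<Longrightarrow> norm (h t) \<le> L * norm (v t)"
  shows "energy p y v l \<le> (4 * (J * L)\<^sup>2 / \<mu>)\<^sup>2 * energy p r s q"
proof -
  define X R Q \<Lambda> where "X = sq_sum (Suc p) y + sq_sum p v" and "R = sq_sum (Suc p) r + sq_sum p s"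
    and "Q = sq_sum (Suc p) q" and "\<Lambda> = sq_sum (Suc p) l"
  define a where "a = (J * L)\<^sup>2"
  have nn: "0 \<le> X" "0 \<le> R" "0 \<le> Q" "0 \<le> \<Lambda>" by (simp_all add: X_def R_def Q_def \<Lambda>_def)
  have a1: "1 \<le> a" using JL by (simp add: a_def)
  have J2: "J\<^sup>2 * L\<^sup>2 = a" by (simp add: a_def power_mult_distrib)
  have J0: "J \<noteq> 0" using JL by auto
  have "\<Lambda> \<le> J\<^sup>2 * (sq_sum (Suc p) (\<lambda>t. r t + (- g t)) + sq_sum p (\<lambda>t. h t + (- s t)))"
    unfolding \<Lambda>_def
    by (rule dual[unfolded dual_bound_def, rule_format])
       (use sys in \<open>auto simp: residual_system_def algebra_simps\<close>)
  also have "\<dots> \<le> J\<^sup>2 * ((2 * sq_sum (Suc p) r + 2 * sq_sum (Suc p) (\<lambda>t. - g t))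
      + (2 * sq_sum p h + 2 * sq_sum p (\<lambda>t. - s t)))"
    by (intro mult_left_mono add_mono sq_sum_add_le) simp
  also have "\<dots> \<le> J\<^sup>2 * ((2 * sq_sum (Suc p) r + 2 * (L\<^sup>2 * sq_sum (Suc p) y))
      + (2 * (L\<^sup>2 * sq_sum p v) + 2 * sq_sum p s))"
  proof -
    have "sq_sum (Suc p) (\<lambda>t. - g t) \<le> L\<^sup>2 * sq_sum (Suc p) y"
      by (rule sq_sum_le_scaled) (use g in auto)
    moreover have "sq_sum p h \<le> L\<^sup>2 * sq_sum p v"
      by (rule sq_sum_le_scaled) (use h in auto)
    moreover have "sq_sum p (\<lambda>t. - s t) = sq_sum p s" by (simp add: sq_sum_def)
    ultimately show ?thesis by (intro mult_left_mono) auto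
  qed
  also have "\<dots> = 2 * J\<^sup>2 * R + 2 * a * X"
    by (simp add: X_def R_def J2[symmetric] algebra_simps)
  finally have \<Lambda>: "\<Lambda> \<le> 2 * J\<^sup>2 * R + 2 * a * X" .
  have "\<mu> * X \<le> (\<Sum>t<Suc p. g t \<bullet> y t) + (\<Sum>t<p. h t \<bullet> v t)"
    unfolding X_def sq_sum_def distrib_left sum_distrib_left
    by (intro add_mono sum_mono g h) auto
  also have "\<dots> = (\<Sum>t<Suc p. r t \<bullet> y t) + (\<Sum>t<p. s t \<bullet> v t) + (\<Sum>t<Suc p. (- q t) \<bullet> l t)"
    using residual_system_duality[OF sys] by (simp add: sum_negf inner_commute)
  \<comment> \<open>The parameter \<mu>/(4 a) is chosen such that the part 2 a X in the bound of the
    multiplier comes back as \<mu>/4 X. With another \<mu>/4 X from \<open>y\<close> and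
    \<open>v\<close>, half of the left side is absorbed.\<close>
  also have "\<dots> \<le> (sq_sum (Suc p) r / (2 * (\<mu>/2)) + (\<mu>/2) / 2 * sq_sum (Suc p) y)
      + (sq_sum p s / (2 * (\<mu>/2)) + (\<mu>/2) / 2 * sq_sum p v)
      + (sq_sum (Suc p) (\<lambda>t. - q t) / (2 * (\<mu> / (4 * a))) + (\<mu> / (4 * a)) / 2 * sq_sum (Suc p) l)"
    using \<mu> a1 by (intro add_mono sum_inner_weighted_le) auto
  also have "\<dots> = R / \<mu> + \<mu> / 4 * X + 2 * a * Q / \<mu> + \<mu> / (8 * a) * \<Lambda>"
  proof -
    have "sq_sum (Suc p) (\<lambda>t. - q t) = Q" by (simp add: Q_def sq_sum_def)
    moreover have "Q / (2 * (\<mu> / (4 * a))) = 2 * a * Q / \<mu>" by simp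
    moreover have "R / \<mu> = sq_sum (Suc p) r / \<mu> + sq_sum p s / \<mu>"
      by (simp add: R_def add_divide_distrib)
    moreover have "\<mu> / 4 * X = \<mu> / 4 * sq_sum (Suc p) y + \<mu> / 4 * sq_sum p v"
      by (simp add: X_def distrib_left)
    moreover have "2 * (\<mu> / 2) = \<mu>" "\<mu> / 2 / 2 = \<mu> / 4" "\<mu> / (4 * a) / 2 = \<mu> / (8 * a)" by simp_all
    ultimately show ?thesis unfolding \<Lambda>_def by (simp only:)
  qed
  also have "\<mu> / (8 * a) * \<Lambda> \<le> \<mu> / (8 * a) * (2 * J\<^sup>2 * R + 2 * a * X)"
    using \<mu> a1 by (intro mult_left_mono \<Lambda>) auto
  also have "\<dots> = \<mu> / (4 * L\<^sup>2) * R + \<mu> / 4 * X"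
    using a1 J0 L by (simp add: J2[symmetric] field_simps)
  finally have "\<mu> / 2 * X \<le> R / \<mu> + 2 * a * Q / \<mu> + \<mu> / (4 * L\<^sup>2) * R" by linarith
  also have "\<mu> / (4 * L\<^sup>2) \<le> 1 / (4 * \<mu>)"
  proof -
    have "\<mu> * \<mu> \<le> L * L" using \<mu> by (intro mult_mono) auto
    then show ?thesis using \<mu> L by (simp add: field_simps power2_eq_square)
  qed
  finally have "\<mu> / 2 * X \<le> R / \<mu> + 2 * a * Q / \<mu> + 1 / (4 * \<mu>) * R"
    using nn by (smt (verit) mult_right_mono)
  then have "2 * \<mu> * (\<mu> / 2 * X) \<le> 2 * \<mu> * (R / \<mu> + 2 * a * Q / \<mu> + 1 / (4 * \<mu>) * R)"
    using \<mu> by (intro mult_left_mono) auto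
  also have "\<dots> = 5 / 2 * R + 4 * a * Q" using \<mu> by (simp add: field_simps)
  also have "\<dots> \<le> 4 * a * (R + Q)"
    using mult_right_mono[OF a1 nn(2)] nn by (simp add: algebra_simps)
  finally have X: "\<mu>\<^sup>2 * X \<le> 4 * a * (R + Q)" by (simp add: power2_eq_square)
  have RQ: "0 \<le> R + Q" using nn by simp
  have "\<mu>\<^sup>2 * \<Lambda> \<le> \<mu>\<^sup>2 * (2 * J\<^sup>2 * R) + 2 * a * (\<mu>\<^sup>2 * X)"
    using mult_left_mono[OF \<Lambda>, of "\<mu>\<^sup>2"] by (simp add: algebra_simps)
  also have "\<mu>\<^sup>2 * (2 * J\<^sup>2 * R) \<le> L\<^sup>2 * (2 * J\<^sup>2 * R)"
    using \<mu> nn by (intro mult_right_mono power_mono) auto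
  also have "\<dots> = 2 * a * R" by (simp add: J2[symmetric])
  also have "2 * a * R + 2 * a * (\<mu>\<^sup>2 * X) \<le> 2 * a * (R + Q) + 2 * a * (4 * a * (R + Q))"
    using a1 nn by (intro add_mono mult_left_mono X) auto
  finally have "\<mu>\<^sup>2 * (X + \<Lambda>) \<le> (6 * a + 8 * a\<^sup>2) * (R + Q)"
    using X by (simp add: algebra_simps power2_eq_square)
  also have "\<dots> \<le> (16 * a\<^sup>2) * (R + Q)"
    using mult_left_mono[OF a1, of a] a1 by (intro mult_right_mono RQ) (simp add: power2_eq_square)
  finally have "X + \<Lambda> \<le> (4 * a / \<mu>)\<^sup>2 * (R + Q)"
    using \<mu> by (simp add: power_divide power_mult_distrib field_simps)
  then show ?thesis by (simp add: energy_def X_def R_def Q_def \<Lambda>_def a_def algebra_simps)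
qed

section \<open>Combes-Thomas estimates in space and time\<close>

locale network =
  fixes E :: "('v::finite \<times> 'v) set" and bx :: "'n::finite \<Rightarrow> 'v" and bu :: "'m::finite \<Rightarrow> 'v"
    and A :: "real^'n^'n" and B :: "real^'m^'n" and L J \<mu> :: real
  assumes net: "networked_system E bx bu A B"
    and A_le: "opnorm A \<le> L" and B_le: "opnorm B \<le> L"
    and dual: "dual_bound J A B"
    and mu_pos: "0 < \<mu>" and mu_le: "\<mu> \<le> L" and L_ge: "1 \<le> L" and J_ge: "L \<le> J" and JL_ge: "2 \<le> (J * L)\<^sup>2"
begin

text \<open>\<open>K\<close> is the constant of \<open>base_energy_estimate\<close>. The step 1/(6
  G) in \<beta> is such that a commutator of size (\<beta> - 1/\<beta>) L, amplified by
  \<open>K\<close>, is at most 1/3; \<theta> is the resulting decay per unit of distance or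
  time.\<close>

definition "K = 4 * (J * L)\<^sup>2 / \<mu>"
definition "G = K * L"
definition "\<beta> = 1 + 1 / (6 * G)"
definition "\<theta> = 1 / \<beta>"

lemma L_pos: "0 < L" using L_ge by simp

lemma JL_ge_1: "1 \<le> J * L"
  using mult_mono[of 1 J 1 L] J_ge L_ge by simp

lemma K_ge: "4 \<le> K"
proof -
  have "\<mu> * 1 \<le> L * (J * (J * L))"
    using mult_mono[OF mu_le, of 1 "J * (J * L)"] mult_mono[of 1 J 1 "J * L"] JL_ge_1 J_ge L_ge by simp
  then have "4 * \<mu> \<le> 4 * (J * L)\<^sup>2" by (simp add: power2_eq_square mult_ac)
  then show ?thesis using mu_pos by (simp add: K_def pos_le_divide_eq)
qed

lemma K_pos: "0 < K" using K_ge by simp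

lemma G_ge: "8 \<le> G"
proof -
  have "8 * \<mu> \<le> 4 * (J * L)\<^sup>2 * L" using JL_ge mu_pos mu_le by (intro mult_mono) auto
  then show ?thesis using mu_pos by (simp add: G_def K_def field_simps)
qed

lemma K_le_G: "K \<le> G" and L_le_G: "L \<le> G"
  using mult_left_mono[OF L_ge, of K] mult_right_mono[of 1 K L] K_ge L_ge by (simp_all add: G_def)

lemma beta_gt: "1 < \<beta>" using G_ge by (simp add: \<beta>_def)

lemma norm_A: "norm (A *v x) \<le> L * norm x" and norm_B: "norm (B *v z) \<le> L * norm z"
  by (intro norm_mult_le_opnorm A_le B_le)+

text \<open>One application of \<open>A\<close> or \<open>B\<close> links a node at time t with its
  neighbours at time t + 1, so weights are compared along such pairs. Weights in space alone and
  weights in time alone both qualify if they change by at most one factor \<beta> per step.\<close>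

definition admissible_weight :: "nat \<Rightarrow> (nat \<Rightarrow> 'v \<Rightarrow> real) \<Rightarrow> bool" where
  "admissible_weight p w \<longleftrightarrow> (\<forall>t\<le>p. \<forall>i. 0 < w t i) \<and>
     (\<forall>t<p. \<forall>i. \<forall>j\<in>nbhd E i. w (Suc t) i = w t j \<or> w (Suc t) i = \<beta> * w t j \<or> \<beta> * w (Suc t) i = w t j)"

definition xw :: "(nat \<Rightarrow> 'v \<Rightarrow> real) \<Rightarrow> (nat \<Rightarrow> real^'n) \<Rightarrow> nat \<Rightarrow> real^'n" where
  "xw w y t = scale_vec (\<lambda>a. w t (bx a)) (y t)"

definition uw :: "(nat \<Rightarrow> 'v \<Rightarrow> real) \<Rightarrow> (nat \<Rightarrow> real^'m) \<Rightarrow> nat \<Rightarrow> real^'m" where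
  "uw w v t = scale_vec (\<lambda>a. w t (bu a)) (v t)"

text \<open>
  Combes--Thomas conjugation: the weighted variables solve the same system with residuals changed
  by commutators of the weights with \<open>A\<close> and \<open>B\<close>, which are small enough to be absorbed.
\<close>

lemma weighted_energy_estimate:
  assumes sys: "residual_system A B p y v l g h r s q"
    and w: "admissible_weight p w"
    and g: "\<And>t. t \<le> p \<Longrightarrow> block_bounds bx \<mu> L (g t) (y t)"
    and h: "\<And>t. t < p \<Longrightarrow> block_bounds bu \<mu> L (h t) (v t)"
  shows "energy p (xw w y) (uw w v) (xw w l) \<le> 4 * K\<^sup>2 * energy p (xw w r) (uw w s) (xw w q)"
proof -
  define \<eta> where "\<eta> = (\<beta> - 1 / \<beta>) * L"
  \<comment> \<open>The commutators with the transposed matrices disturb the multiplier equations,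
    those with \<open>A\<close> and \<open>B\<close> the dynamics; all of them become extra
    residuals.\<close>
  define dA dB dq where "dA t = xw w (\<lambda>t. transpose A *v l (Suc t)) t - transpose A *v xw w l (Suc t)"
    and "dB t = uw w (\<lambda>t. transpose B *v l (Suc t)) t - transpose B *v xw w l (Suc t)"
    and "dq t = (scale_vec (\<lambda>a. w (Suc t) (bx a)) (A *v y t) - A *v xw w y t)
        + (scale_vec (\<lambda>a. w (Suc t) (bx a)) (B *v v t) - B *v uw w v t)" for t
  define dr where "dr t = (if t < p then dA t else 0)" for t
  define dq' where "dq' t = (case t of 0 \<Rightarrow> 0 | Suc t \<Rightarrow> if t < p then dq t else 0)" for t
  have pos: "0 < w t i" if "t \<le> p" for t i using w that by (auto simp: admissible_weight_def)
  have ratio: "w (Suc t) i = w t j \<or> w (Suc t) i = \<beta> * w t j \<or> \<beta> * w (Suc t) i = w t j"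
    if "t < p" "j \<in> nbhd E i" for t i j using w that by (auto simp: admissible_weight_def)
  have A_nz: "bx c \<in> nbhd E (bx a)" if "A $ a $ c \<noteq> 0" for a c
    using net that by (auto simp: networked_system_def block_sparse_def)
  have B_nz: "bu c \<in> nbhd E (bx a)" if "B $ a $ c \<noteq> 0" for a c
    using net that by (auto simp: networked_system_def block_sparse_def)
  have dA: "norm (dA t) \<le> \<eta> * norm (xw w l (Suc t))" if "t < p" for t
    unfolding dA_def xw_def \<eta>_def
  proof (rule norm_weight_commutator_le)
    show "norm (transpose A *v x) \<le> L * norm x" for x by (intro norm_transpose_mult_le norm_A)
    show "w t (bx i) = w (Suc t) (bx j) \<or> w t (bx i) = \<beta> * w (Suc t) (bx j) \<or> \<beta> * w t (bx i) = w (Suc t) (bx j)"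
      if "transpose A $ i $ j \<noteq> 0" for i j
      using ratio[OF \<open>t < p\<close> A_nz[of j i]] that by (auto simp: transpose_def)
  qed (use L_pos beta_gt pos that in auto)
  have dB: "norm (dB t) \<le> \<eta> * norm (xw w l (Suc t))" if "t < p" for t
    unfolding dB_def xw_def uw_def \<eta>_def
  proof (rule norm_weight_commutator_le)
    show "norm (transpose B *v x) \<le> L * norm x" for x by (intro norm_transpose_mult_le norm_B)
    show "w t (bu i) = w (Suc t) (bx j) \<or> w t (bu i) = \<beta> * w (Suc t) (bx j) \<or> \<beta> * w t (bu i) = w (Suc t) (bx j)"
      if "transpose B $ i $ j \<noteq> 0" for i j
      using ratio[OF \<open>t < p\<close> B_nz[of j i]] that by (auto simp: transpose_def)
  qed (use L_pos beta_gt pos that in auto)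
  have dq_A: "norm (scale_vec (\<lambda>a. w (Suc t) (bx a)) (A *v y t) - A *v xw w y t) \<le> \<eta> * norm (xw w y t)"
    if "t < p" for t unfolding xw_def \<eta>_def
    by (rule norm_weight_commutator_le) (use L_pos beta_gt pos that norm_A ratio A_nz in auto)
  have dq_B: "norm (scale_vec (\<lambda>a. w (Suc t) (bx a)) (B *v v t) - B *v uw w v t) \<le> \<eta> * norm (uw w v t)"
    if "t < p" for t unfolding uw_def \<eta>_def
    by (rule norm_weight_commutator_le) (use L_pos beta_gt pos that norm_B ratio B_nz in auto)
  have sys': "residual_system A B p (xw w y) (uw w v) (xw w l) (xw w g) (uw w h)
      (\<lambda>t. xw w r t + dr t) (\<lambda>t. uw w s t + dB t) (\<lambda>t. xw w q t + dq' t)"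
    unfolding residual_system_def
  proof (intro conjI allI impI)
    show "xw w y 0 = xw w q 0 + dq' 0"
      using sys by (simp add: residual_system_def xw_def dq'_def)
    have "xw w (\<lambda>t. g t + l t) p = xw w r p" using sys by (simp add: residual_system_def xw_def)
    then show "xw w g p + xw w l p = xw w r p + dr p"
      by (simp add: dr_def xw_def scale_vec_add)
    fix t assume t: "t < p"
    show "xw w y (Suc t) = A *v xw w y t + B *v uw w v t + (xw w q (Suc t) + dq' (Suc t))"
      using sys t by (simp add: residual_system_def dq'_def dq_def xw_def scale_vec_add)
    have "xw w (\<lambda>t. g t + l t) t = xw w (\<lambda>t. transpose A *v l (Suc t) + r t) t"
      using sys t by (simp add: residual_system_def xw_def)
    then show "xw w g t + xw w l t = transpose A *v xw w l (Suc t) + (xw w r t + dr t)"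
      using t by (simp add: dr_def dA_def xw_def scale_vec_add)
    have "uw w h t = uw w (\<lambda>t. transpose B *v l (Suc t) + s t) t"
      using sys t by (simp add: residual_system_def uw_def)
    then show "uw w h t = transpose B *v xw w l (Suc t) + (uw w s t + dB t)"
      by (simp add: dB_def uw_def scale_vec_add)
  qed
  define En Re where "En = energy p (xw w y) (uw w v) (xw w l)"
    and "Re = energy p (xw w r) (uw w s) (xw w q)"
  have "En \<le> (4 * (J * L)\<^sup>2 / \<mu>)\<^sup>2
      * energy p (\<lambda>t. xw w r t + dr t) (\<lambda>t. uw w s t + dB t) (\<lambda>t. xw w q t + dq' t)"
    unfolding En_def
  proof (rule base_energy_estimate[OF sys' dual mu_pos mu_le _ L_ge])
    show "1 \<le> J * L" by (rule JL_ge_1)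
  qed (use block_bounds_scale_vec[OF g] block_bounds_scale_vec[OF h] L_ge in \<open>auto simp: xw_def uw_def\<close>)
  moreover have "energy p (\<lambda>t. xw w r t + dr t) (\<lambda>t. uw w s t + dB t) (\<lambda>t. xw w q t + dq' t)
      \<le> 2 * Re + 2 * energy p dr dB dq'"
    using sq_sum_add_le[of "Suc p" "xw w r" dr] sq_sum_add_le[of p "uw w s" dB]
      sq_sum_add_le[of "Suc p" "xw w q" dq'] by (simp add: energy_def Re_def)
  moreover have "energy p dr dB dq' \<le> 2 * \<eta>\<^sup>2 * En"
  proof -
    have 1: "sq_sum p dA \<le> \<eta>\<^sup>2 * sq_sum (Suc p) (xw w l)"
    proof -
      have "sq_sum p dA \<le> \<eta>\<^sup>2 * sq_sum p (\<lambda>t. xw w l (Suc t))"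
        by (rule sq_sum_le_scaled[OF dA])
      also have "\<dots> \<le> \<eta>\<^sup>2 * sq_sum (Suc p) (xw w l)"
        by (intro mult_left_mono sq_sum_shift_le) simp
      finally show ?thesis .
    qed
    have 2: "sq_sum p dB \<le> \<eta>\<^sup>2 * sq_sum (Suc p) (xw w l)"
    proof -
      have "sq_sum p dB \<le> \<eta>\<^sup>2 * sq_sum p (\<lambda>t. xw w l (Suc t))"
        by (rule sq_sum_le_scaled[OF dB])
      also have "\<dots> \<le> \<eta>\<^sup>2 * sq_sum (Suc p) (xw w l)"
        by (intro mult_left_mono sq_sum_shift_le) simp
      finally show ?thesis .
    qed
    have 3: "sq_sum p dq \<le> 2 * (\<eta>\<^sup>2 * sq_sum p (xw w y)) + 2 * (\<eta>\<^sup>2 * sq_sum p (uw w v))"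
    proof -
      have "sq_sum p dq \<le> 2 * sq_sum p (\<lambda>t. scale_vec (\<lambda>a. w (Suc t) (bx a)) (A *v y t) - A *v xw w y t)
        + 2 * sq_sum p (\<lambda>t. scale_vec (\<lambda>a. w (Suc t) (bx a)) (B *v v t) - B *v uw w v t)"
        unfolding dq_def by (rule sq_sum_add_le)
      also have "\<dots> \<le> 2 * (\<eta>\<^sup>2 * sq_sum p (xw w y)) + 2 * (\<eta>\<^sup>2 * sq_sum p (uw w v))"
        by (intro add_mono mult_left_mono sq_sum_le_scaled dq_A dq_B) auto
      finally show ?thesis .
    qed
    have 4: "sq_sum p (xw w y) \<le> sq_sum (Suc p) (xw w y)" by (simp add: sq_sum_def)
    have dr: "sq_sum (Suc p) dr = sq_sum p dA" by (simp add: sq_sum_def dr_def)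
    have dq': "sq_sum (Suc p) dq' = sq_sum p dq"
      unfolding sq_sum_def by (subst sum.lessThan_Suc_shift) (simp add: dq'_def)
    have "energy p dr dB dq' = sq_sum p dA + sq_sum p dB + sq_sum p dq"
      by (simp add: energy_def dr dq')
    also have "\<dots> \<le> 2 * (\<eta>\<^sup>2 * sq_sum (Suc p) (xw w l))
        + (2 * (\<eta>\<^sup>2 * sq_sum (Suc p) (xw w y)) + 2 * (\<eta>\<^sup>2 * sq_sum p (uw w v)))"
      using 1 2 3 mult_left_mono[OF 4, of "\<eta>\<^sup>2"] by simp
    also have "\<dots> = 2 * \<eta>\<^sup>2 * En"
      by (simp add: En_def energy_def distrib_left)
    finally show ?thesis .
  qed
  ultimately have "En \<le> K\<^sup>2 * (2 * Re + 2 * (2 * \<eta>\<^sup>2 * En))"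
    unfolding K_def[symmetric] by (smt (verit) mult_left_mono zero_le_power2)
  moreover have "K\<^sup>2 * \<eta>\<^sup>2 = (G * (\<beta> - 1 / \<beta>))\<^sup>2"
    by (simp only: G_def \<eta>_def power_mult_distrib mult_ac)
  then have "K\<^sup>2 * (2 * Re + 2 * (2 * \<eta>\<^sup>2 * En)) = 2 * K\<^sup>2 * Re + 4 * (G * (\<beta> - 1 / \<beta>))\<^sup>2 * En"
    by algebra
  moreover have "(G * (\<beta> - 1 / \<beta>))\<^sup>2 \<le> (1 / 3)\<^sup>2"
  proof (rule power_mono)
    have "\<beta> - 1 / \<beta> \<le> 2 * (\<beta> - 1)"
    proof -
      have "0 \<le> (\<beta> - 1)\<^sup>2 / \<beta>" using beta_gt by simp
      also have "\<dots> = \<beta> - 2 + 1 / \<beta>" using beta_gt by (simp add: power2_eq_square field_simps)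
      finally show ?thesis by simp
    qed
    also have "\<dots> = 1 / (3 * G)" by (simp add: \<beta>_def)
    finally have "G * (\<beta> - 1 / \<beta>) \<le> G * (1 / (3 * G))" using G_ge by (intro mult_left_mono) auto
    then show "G * (\<beta> - 1 / \<beta>) \<le> 1 / 3" using G_ge by simp
    have "1 / \<beta> \<le> 1" using beta_gt by simp
    then have "1 / \<beta> \<le> \<beta>" using beta_gt by linarith
    then show "0 \<le> G * (\<beta> - 1 / \<beta>)" using G_ge by simp
  qed
  then have "4 * (G * (\<beta> - 1 / \<beta>))\<^sup>2 * En \<le> 4 * (1 / 3)\<^sup>2 * En"
    by (intro mult_right_mono mult_left_mono) (simp_all add: En_def)
  \<comment> \<open>Absorbing 4/9 of \<open>En\<close> leaves the factor 18/5, rounded up to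
    4.\<close>
  ultimately have "En \<le> 2 * K\<^sup>2 * Re + 4 * (1/3)\<^sup>2 * En" by linarith
  moreover have "0 \<le> En" by (simp add: En_def)
  moreover have "0 \<le> K\<^sup>2 * Re" by (simp add: Re_def)
  ultimately have "En \<le> 4 * K\<^sup>2 * Re" by (simp add: power2_eq_square)
  then show ?thesis by (simp only: En_def Re_def)
qed

end

subsection \<open>Neighbourhoods\<close>

lemma gdist_le_iff: "gdist E i j \<le> enat k \<longleftrightarrow> (\<exists>n\<le>k. (i, j) \<in> E ^^ n)"
proof
  assume *: "gdist E i j \<le> enat k"
  show "\<exists>n\<le>k. (i, j) \<in> E ^^ n"
  proof (rule ccontr)
    assume "\<not> ?thesis"
    then have "enat (Suc k) \<le> gdist E i j"
      unfolding gdist_def by (intro INF_greatest) (auto simp: not_less_eq_eq[symmetric])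
    then have "enat (Suc k) \<le> enat k" using * by (rule order_trans)
    then show False by simp
  qed
next
  assume "\<exists>n\<le>k. (i, j) \<in> E ^^ n"
  then obtain n where n: "n \<le> k" "(i, j) \<in> E ^^ n" by blast
  then have "gdist E i j \<le> enat n" unfolding gdist_def by (intro INF_lower) auto
  then show "gdist E i j \<le> enat k" using n(1) by (meson enat_ord_simps(1) order_trans)
qed

lemma mem_nbhd_upto_iff: "j \<in> nbhd_upto E \<kappa> i \<longleftrightarrow> (\<exists>n\<le>\<kappa>. (i, j) \<in> E ^^ n)"
  by (simp add: nbhd_upto_def gdist_le_iff)

lemma nbhd_upto_step:
  assumes "sym E" "j \<in> nbhd E l" "l \<in> nbhd_upto E \<kappa> i"
  shows "j \<in> nbhd_upto E (Suc \<kappa>) i"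
proof -
  from assms(3) obtain n where n: "n \<le> \<kappa>" "(i, l) \<in> E ^^ n" by (auto simp: mem_nbhd_upto_iff)
  show ?thesis
  proof (cases "j = l")
    case True
    then show ?thesis using n by (auto simp: mem_nbhd_upto_iff intro: le_SucI)
  next
    case False
    then have "(l, j) \<in> E" using assms(2) by (auto simp: nbhd_def)
    then have "(i, j) \<in> E ^^ Suc n" using n(2) by auto
    then show ?thesis using n(1) by (auto simp: mem_nbhd_upto_iff simp del: relpow.simps)
  qed
qed

lemma nbhd_sym: "sym E \<Longrightarrow> j \<in> nbhd E l \<longleftrightarrow> l \<in> nbhd E j"
  by (auto simp: nbhd_def dest: symD)

text \<open>There are finitely many pairs of nodes, so one radius exhausts every component.
  Truncation at this radius cuts no edge, and it is still within the range where stabilizability is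
  assumed.\<close>

lemma nbhd_upto_eq_component:
  fixes E :: "('v::finite \<times> 'v) set" and \<kappa>\<^sub>0 :: nat
  shows "\<exists>\<kappa>\<ge>\<kappa>\<^sub>0. \<forall>i. nbhd_upto E \<kappa> i = E\<^sup>* `` {i}"
proof -
  have "\<forall>ij\<in>E\<^sup>*. \<exists>n. ij \<in> E ^^ n" by (auto simp: rtrancl_power)
  then obtain f where f: "\<And>ij. ij \<in> E\<^sup>* \<Longrightarrow> ij \<in> E ^^ f ij" by metis
  define \<kappa> where "\<kappa> = max \<kappa>\<^sub>0 (Max (range f))"
  have "f ij \<le> \<kappa>" for ij unfolding \<kappa>_def by (intro max.coboundedI2 Max_ge) auto
  then have "nbhd_upto E \<kappa> i = E\<^sup>* `` {i}" for i
    using f by (fastforce simp: mem_nbhd_upto_iff rtrancl_power)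
  moreover have "\<kappa>\<^sub>0 \<le> \<kappa>" by (simp add: \<kappa>_def)
  ultimately show ?thesis by blast
qed

lemma transpose_mult_restrict_vec:
  assumes "\<And>a c. M $ a $ c \<noteq> 0 \<Longrightarrow> b a \<in> S \<longleftrightarrow> b' c \<in> S"
  shows "transpose M *v restrict_vec b S x = restrict_vec b' S (transpose M *v (x :: real^'n::finite))"
proof -
  have *: "b' c \<in> S \<longleftrightarrow> b a \<in> S" if "M $ a $ c \<noteq> 0" for a c using assms[OF that] by simp
  have "M $ a $ c * (if b a \<in> S then x $ a else 0) = (if b' c \<in> S then M $ a $ c * x $ a else 0)" for a c
    using *[of a c] by (cases "M $ a $ c = 0") auto
  then show ?thesis by (simp add: vec_eq_iff matrix_vector_mult_def transpose_def)
qed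

text \<open>At a radius that fills the components, restriction to a component commutes with the
  transposes of \<open>A\<close> and \<open>B\<close>, so every restricted multiplier obeys a
  truncated system. Orthogonality of components adds the bounds up with the same \<open>J\<close>,
  and no gain for \<open>(A, B)\<close> itself has to be assembled.\<close>

lemma dual_bound_components:
  fixes E :: "('v::finite \<times> 'v) set" and A :: "real^'n::finite^'n" and B :: "real^'m::finite^'n"
  assumes net: "networked_system E bx bu A B"
    and dual: "\<And>i \<kappa>. \<kappa>\<^sub>0 \<le> \<kappa> \<Longrightarrow>
      dual_bound J (restrict_rows bx (nbhd_upto E \<kappa> i) A) (restrict_rows bx (nbhd_upto E \<kappa> i) B)"
  shows "dual_bound J A B"
proof -
  obtain \<kappa> where \<kappa>: "\<kappa>\<^sub>0 \<le> \<kappa>" "\<And>i. nbhd_upto E \<kappa> i = E\<^sup>* `` {i}"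
    using nbhd_upto_eq_component[of \<kappa>\<^sub>0 E] by auto
  define S where "S i = E\<^sup>* `` {i}" for i
  have dualS: "dual_bound J (restrict_rows bx (S i) A) (restrict_rows bx (S i) B)" for i
    using dual[OF \<kappa>(1), of i] by (simp add: \<kappa>(2) S_def)
  have "sym (E\<^sup>*)" using net by (intro sym_rtrancl) (simp add: networked_system_def)
  then have S_sym: "j \<in> S i \<longleftrightarrow> i \<in> S j" for i j by (auto simp: S_def dest: symD)
  have S_eq: "S i = S j" if "j \<in> S i" for i j
    using that S_sym by (auto simp: S_def intro: rtrancl_trans)
  have S_nbhd: "i \<in> S k \<longleftrightarrow> j \<in> S k" if "j \<in> nbhd E i" for i j k
  proof -
    have "j \<in> S i" using that by (auto simp: S_def nbhd_def)
    then show ?thesis using S_eq S_sym by blast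
  qed
  have A_nz: "bx a \<in> S k \<longleftrightarrow> bx c \<in> S k" if "A $ a $ c \<noteq> 0" for a c k
    using net that by (intro S_nbhd) (auto simp: networked_system_def block_sparse_def)
  have B_nz: "bx a \<in> S k \<longleftrightarrow> bu c \<in> S k" if "B $ a $ c \<noteq> 0" for a c k
    using net that by (intro S_nbhd) (auto simp: networked_system_def block_sparse_def)
  \<comment> \<open>The sum runs over nodes, so a component occurs once per member; dividing by
    \<open>card (S i)\<close> restores a single count.\<close>
  have part: "(\<Sum>i\<in>UNIV. (norm (restrict_vec b (S i) z))\<^sup>2 / card (S i)) = (norm z)\<^sup>2"
    for b :: "'k::finite \<Rightarrow> 'v" and z
  proof -
    have "(\<Sum>i\<in>UNIV. (norm (restrict_vec b (S i) z))\<^sup>2 / card (S i))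
      = (\<Sum>i\<in>UNIV. \<Sum>a\<in>UNIV. if b a \<in> S i then (z $ a)\<^sup>2 / card (S i) else 0)"
      by (auto simp: norm_vec_sq sum_divide_distrib intro!: sum.cong)
    also have "\<dots> = (\<Sum>a\<in>UNIV. \<Sum>i\<in>UNIV. if b a \<in> S i then (z $ a)\<^sup>2 / card (S i) else 0)"
      by (rule sum.swap)
    also have "\<dots> = (\<Sum>a\<in>UNIV. \<Sum>i\<in>S (b a). (z $ a)\<^sup>2 / card (S (b a)))"
    proof (rule sum.cong[OF refl])
      fix a
      have "(\<Sum>i\<in>UNIV. if b a \<in> S i then (z $ a)\<^sup>2 / card (S i) else 0)
        = (\<Sum>i\<in>UNIV. if i \<in> S (b a) then (z $ a)\<^sup>2 / card (S (b a)) else 0)"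
        using S_sym S_eq by (intro sum.cong refl) (metis (full_types))
      then show "(\<Sum>i\<in>UNIV. if b a \<in> S i then (z $ a)\<^sup>2 / card (S i) else 0)
        = (\<Sum>i\<in>S (b a). (z $ a)\<^sup>2 / card (S (b a)))"
        by (simp add: sum.If_cases)
    qed
    also have "\<dots> = (norm z)\<^sup>2"
    proof -
      have "card (S i) \<noteq> 0" for i by (auto simp: S_def)
      then show ?thesis by (simp add: norm_vec_sq)
    qed
    finally show ?thesis .
  qed
  have part_sum: "(\<Sum>i\<in>UNIV. sq_sum n (\<lambda>t. restrict_vec b (S i) (z t)) / card (S i)) = sq_sum n z"
    for b :: "'k::finite \<Rightarrow> 'v" and z n
    unfolding sq_sum_def sum_divide_distrib by (subst sum.swap) (simp add: part)
  show ?thesis unfolding dual_bound_def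
  proof (intro allI impI, elim conjE)
    fix p and l h :: "nat \<Rightarrow> real^'n" and e :: "nat \<Rightarrow> real^'m"
    assume rec: "\<forall>t<p. l t = transpose A *v l (Suc t) + h t \<and> transpose B *v l (Suc t) = e t"
      and lp: "l p = h p"
    have "sq_sum (Suc p) (\<lambda>t. restrict_vec bx (S i) (l t))
      \<le> J\<^sup>2 * (sq_sum (Suc p) (\<lambda>t. restrict_vec bx (S i) (h t)) + sq_sum p (\<lambda>t. restrict_vec bu (S i) (e t)))" for i
    proof (rule dualS[of i, unfolded dual_bound_def, rule_format], intro conjI allI impI)
      show "restrict_vec bx (S i) (l p) = restrict_vec bx (S i) (h p)" by (simp add: lp)
      fix t assume t: "t < p"
      have rr: "restrict_vec bx (S i) (restrict_vec bx (S i) z) = restrict_vec bx (S i) z" for z :: "real^'n"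
        by (simp add: vec_eq_iff)
      have "restrict_vec bx (S i) (transpose A *v l (Suc t)) = transpose A *v restrict_vec bx (S i) (l (Suc t))"
        using A_nz by (rule transpose_mult_restrict_vec[symmetric])
      moreover have "l t = transpose A *v l (Suc t) + h t" using rec t by blast
      ultimately show "restrict_vec bx (S i) (l t)
        = transpose (restrict_rows bx (S i) A) *v restrict_vec bx (S i) (l (Suc t)) + restrict_vec bx (S i) (h t)"
        by (metis restrict_vec_add rr transpose_restrict_rows_mult)
      have "restrict_vec bu (S i) (transpose B *v l (Suc t)) = transpose B *v restrict_vec bx (S i) (l (Suc t))"
        using B_nz by (rule transpose_mult_restrict_vec[symmetric])
      then show "transpose (restrict_rows bx (S i) B) *v restrict_vec bx (S i) (l (Suc t)) = restrict_vec bu (S i) (e t)"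
        using rec t by (simp add: transpose_restrict_rows_mult rr)
    qed
    then have "(\<Sum>i\<in>UNIV. sq_sum (Suc p) (\<lambda>t. restrict_vec bx (S i) (l t)) / card (S i))
      \<le> (\<Sum>i\<in>UNIV. J\<^sup>2 * (sq_sum (Suc p) (\<lambda>t. restrict_vec bx (S i) (h t))
          + sq_sum p (\<lambda>t. restrict_vec bu (S i) (e t))) / card (S i))"
      by (intro sum_mono divide_right_mono) auto
    also have "\<dots> = J\<^sup>2 * ((\<Sum>i\<in>UNIV. sq_sum (Suc p) (\<lambda>t. restrict_vec bx (S i) (h t)) / card (S i))
          + (\<Sum>i\<in>UNIV. sq_sum p (\<lambda>t. restrict_vec bu (S i) (e t)) / card (S i)))"
      by (simp add: sum_distrib_left distrib_left add_divide_distrib flip: sum.distrib)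
    finally show "sq_sum (Suc p) l \<le> J\<^sup>2 * (sq_sum (Suc p) h + sq_sum p e)"
      unfolding part_sum .
  qed
qed

subsection \<open>Stability of optimality systems\<close>

text \<open>\<open>gT\<close> matters through its value at \<open>y p\<close> alone. It may
  therefore be exchanged for any map with that value, such as a multiple of the state or a constant
  map.\<close>

definition kkt ::
  "real^'n::finite^'n \<Rightarrow> real^'m::finite^'n \<Rightarrow> nat \<Rightarrow> (nat \<Rightarrow> real^'n \<Rightarrow> real^'n) \<Rightarrow>
   (nat \<Rightarrow> real^'m \<Rightarrow> real^'m) \<Rightarrow> (real^'n \<Rightarrow> real^'n) \<Rightarrow> real^'n \<Rightarrow> (nat \<Rightarrow> real^'n) \<Rightarrow>
   (nat \<Rightarrow> real^'n) \<Rightarrow> (nat \<Rightarrow> real^'m) \<Rightarrow> (nat \<Rightarrow> real^'n) \<Rightarrow> bool" where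
  "kkt A B p gf gc gT x \<zeta> y v l \<longleftrightarrow>
     trajectory A B p \<zeta> x y v \<and>
     (\<forall>t<p. gf t (y t) + l t = transpose A *v l (Suc t)) \<and> gT (y p) + l p = 0 \<and>
     (\<forall>t<p. gc t (v t) = transpose B *v l (Suc t))"

definition block_gradient ::
  "('n::finite \<Rightarrow> 'v::finite) \<Rightarrow> real \<Rightarrow> real \<Rightarrow> (real^'n \<Rightarrow> real^'n) \<Rightarrow> bool" where
  "block_gradient b \<mu> L g \<longleftrightarrow> g 0 = 0 \<and> (\<forall>x x'. block_bounds b \<mu> L (g x - g x') (x - x'))"

lemma block_gradient_at: "block_gradient b \<mu> L g \<Longrightarrow> block_bounds b \<mu> L (g x) x"
  unfolding block_gradient_def by (metis diff_zero)

lemma block_gradient_lipschitz: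
  "block_gradient b \<mu> L g \<Longrightarrow> 0 \<le> L \<Longrightarrow> norm (g x - g x') \<le> L * norm (x - x')"
  unfolding block_gradient_def by (blast intro: block_bounds_global(2))

lemma block_gradient_scaleR:
  assumes "\<mu> \<le> \<phi>" "\<phi> \<le> L" "0 \<le> \<mu>"
  shows "block_gradient b \<mu> L (\<lambda>y. \<phi> *\<^sub>R y)"
proof -
  have "block_bounds b \<mu> L (\<phi> *\<^sub>R z) z" for z
    unfolding block_bounds_def
  proof (intro allI conjI)
    fix i
    have *: "restrict_vec b {i} (\<phi> *\<^sub>R z) = \<phi> *\<^sub>R restrict_vec b {i} z" by (simp add: vec_eq_iff)
    show "\<mu> * (norm (restrict_vec b {i} z))\<^sup>2 \<le> restrict_vec b {i} (\<phi> *\<^sub>R z) \<bullet> restrict_vec b {i} z"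
      unfolding * using assms by (simp add: power2_norm_eq_inner mult_right_mono)
    show "norm (restrict_vec b {i} (\<phi> *\<^sub>R z)) \<le> L * norm (restrict_vec b {i} z)"
      unfolding * using assms by (simp add: mult_right_mono)
  qed
  then show ?thesis by (simp add: block_gradient_def flip: scaleR_diff_right)
qed

text \<open>Initial state and disturbances as one sequence of defects: the disturbance acting at
  time t is a defect of the state at time t + 1.\<close>

definition state_defect :: "'a \<Rightarrow> (nat \<Rightarrow> 'a) \<Rightarrow> nat \<Rightarrow> 'a" where
  "state_defect x \<zeta> t = (case t of 0 \<Rightarrow> x | Suc s \<Rightarrow> \<zeta> s)"

lemma state_defect_simps [simp]: "state_defect x \<zeta> 0 = x" "state_defect x \<zeta> (Suc t) = \<zeta> t"
  by (simp_all add: state_defect_def)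

lemma sq_sum_state_defect: "sq_sum (Suc p) (state_defect x \<zeta>) = (norm x)\<^sup>2 + sq_sum p \<zeta>"
  unfolding sq_sum_def by (subst sum.lessThan_Suc_shift) simp

lemma sq_sum_zero [simp]: "sq_sum n (\<lambda>_. 0) = 0"
  by (simp add: sq_sum_def)

lemma kkt_residual_system:
  assumes "kkt A B p gf gc gT x \<zeta> y v l"
  shows "residual_system A B p y v l (\<lambda>t. if t < p then gf t (y t) else gT (y t)) (\<lambda>t. gc t (v t))
           (\<lambda>_. 0) (\<lambda>_. 0) (state_defect x \<zeta>)"
  using assms by (simp add: kkt_def residual_system_def trajectory_def)

text \<open>With equal stage gradients and disturbances, defects remain at the two ends only. The
  mismatch of the terminal gradients is evaluated at the end of the second solution, so that
  monotonicity is asked of \<open>gT\<close> and not of \<open>gT'\<close>.\<close>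

lemma kkt_diff_residual_system:
  assumes "kkt A B p gf gc gT x \<zeta> y v l" and "kkt A B p gf gc gT' x' \<zeta> y' v' l'"
  shows "residual_system A B p (\<lambda>t. y t - y' t) (\<lambda>t. v t - v' t) (\<lambda>t. l t - l' t)
           (\<lambda>t. if t < p then gf t (y t) - gf t (y' t) else gT (y t) - gT (y' t))
           (\<lambda>t. gc t (v t) - gc t (v' t))
           (\<lambda>t. if t < p then 0 else gT' (y' p) - gT (y' p)) (\<lambda>_. 0) (state_defect (x - x') (\<lambda>_. 0))"
proof -
  have "gT (y p) = - l p" "gT' (y' p) = - l' p"
    using assms by (auto simp: kkt_def eq_neg_iff_add_eq_0)
  then have "gT (y p) - gT (y' p) + (l p - l' p) = gT' (y' p) - gT (y' p)" by simp
  moreover have "gf t (y t) - gf t (y' t) + (l t - l' t) = transpose A *v (l (Suc t) - l' (Suc t))" if "t < p" for t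
  proof -
    have "gf t (y t) + l t - (gf t (y' t) + l' t) = transpose A *v l (Suc t) - transpose A *v l' (Suc t)"
      using assms that by (simp add: kkt_def)
    then show ?thesis by (simp add: matrix_vector_mult_diff_distrib algebra_simps)
  qed
  moreover have "y (Suc t) - y' (Suc t) = A *v (y t - y' t) + B *v (v t - v' t)" if "t < p" for t
    using assms that by (simp add: kkt_def trajectory_def matrix_vector_mult_diff_distrib)
  ultimately show ?thesis using assms
    by (simp add: kkt_def residual_system_def trajectory_def matrix_vector_mult_diff_distrib)
qed

lemma sum_two_sided_geometric_le:
  fixes \<theta> :: real
  assumes "0 < \<theta>" "\<theta> < 1"
  shows "(\<Sum>t<n. \<theta> ^ ((s - t) + (t - s))) \<le> 2 / (1 - \<theta>)"
proof -
  let ?S = "\<lambda>n. \<Sum>t<n. \<theta> ^ ((s - t) + (t - s))"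
  have pw: "0 \<le> \<theta> ^ j" "\<theta> ^ j \<le> 1" for j using assms by (auto simp: power_le_one)
  \<comment> \<open>Invariant for the induction: up to the peak at \<open>s\<close> the partial sum
    is bounded by its next term, as in a geometric series; beyond the peak the missing tail is kept
    as a negative term.\<close>
  have "(1 - \<theta>) * ?S n \<le> (if n \<le> s then \<theta> ^ (s - n) else 2 - \<theta> ^ (n - s))"
  proof (induction n)
    case 0
    then show ?case using pw by simp
  next
    case (Suc n)
    consider "Suc n \<le> s" | "n = s" | "s < n" by linarith
    then show ?case
    proof cases
      case 1
      then have e: "s - n = Suc (s - Suc n)" by simp
      have "(1 - \<theta>) * ?S (Suc n) \<le> \<theta> ^ (s - n) + (1 - \<theta>) * \<theta> ^ (s - n)"
        using Suc 1 by (simp add: distrib_left)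
      also have "\<dots> = \<theta> ^ (s - Suc n) - (1 - \<theta>)\<^sup>2 * \<theta> ^ (s - Suc n)"
        unfolding e by (simp add: power2_eq_square algebra_simps)
      also have "\<dots> \<le> \<theta> ^ (s - Suc n)" using pw by simp
      finally show ?thesis using 1 by simp
    next
      case 2
      then show ?thesis using Suc by (simp add: distrib_left Suc_diff_le)
    next
      case 3
      then have e: "Suc n - s = Suc (n - s)" by simp
      show ?thesis using Suc 3 unfolding e by (simp add: algebra_simps)
    qed
  qed
  also have "\<dots> \<le> 2" using pw by (simp add: power_le_one order_trans[of _ 1 2])
  finally show ?thesis using assms by (simp add: field_simps)
qed

context network
begin

lemma theta_pos: "0 < \<theta>" and theta_lt: "\<theta> < 1"
  using beta_gt by (simp_all add: \<theta>_def)

lemma time_weighted_estimate: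
  assumes sys: "residual_system A B p y v l g h r s q"
    and \<omega>: "\<And>t. t \<le> p \<Longrightarrow> 0 < \<omega> t"
      "\<And>t. t < p \<Longrightarrow> \<omega> (Suc t) = \<omega> t \<or> \<omega> (Suc t) = \<beta> * \<omega> t \<or> \<beta> * \<omega> (Suc t) = \<omega> t"
    and g: "\<And>t. t \<le> p \<Longrightarrow> block_bounds bx \<mu> L (g t) (y t)"
    and h: "\<And>t. t < p \<Longrightarrow> block_bounds bu \<mu> L (h t) (v t)"
  shows "energy p (\<lambda>t. \<omega> t *\<^sub>R y t) (\<lambda>t. \<omega> t *\<^sub>R v t) (\<lambda>t. \<omega> t *\<^sub>R l t)
    \<le> 4 * K\<^sup>2 * energy p (\<lambda>t. \<omega> t *\<^sub>R r t) (\<lambda>t. \<omega> t *\<^sub>R s t) (\<lambda>t. \<omega> t *\<^sub>R q t)"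
proof -
  have "xw (\<lambda>t _. \<omega> t) z = (\<lambda>t. \<omega> t *\<^sub>R z t)" for z by (simp add: xw_def fun_eq_iff)
  moreover have "uw (\<lambda>t _. \<omega> t) z = (\<lambda>t. \<omega> t *\<^sub>R z t)" for z by (simp add: uw_def fun_eq_iff)
  moreover have "admissible_weight p (\<lambda>t _. \<omega> t)" using \<omega> by (simp add: admissible_weight_def)
  ultimately show ?thesis using weighted_energy_estimate[OF sys _ g h, of "\<lambda>t _. \<omega> t"] by simp
qed

lemma unweighted_estimate:
  assumes sys: "residual_system A B p y v l g h r s q"
    and g: "\<And>t. t \<le> p \<Longrightarrow> block_bounds bx \<mu> L (g t) (y t)"
    and h: "\<And>t. t < p \<Longrightarrow> block_bounds bu \<mu> L (h t) (v t)"
  shows "energy p y v l \<le> 4 * K\<^sup>2 * energy p r s q"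
  using time_weighted_estimate[OF sys _ _ g h, of "\<lambda>_. 1"] by simp

text \<open>One of the two truncated differences is 0, so the exponent is the distance of
  \<open>s\<close> and \<open>t\<close>.\<close>

definition decay :: "nat \<Rightarrow> nat \<Rightarrow> real" where
  "decay s t = \<theta> ^ ((s - t) + (t - s))"

lemma decay_pos: "0 < decay s t" and decay_le_1: "decay s t \<le> 1" and decay_self [simp]: "decay s s = 1"
  using theta_pos theta_lt by (auto simp: decay_def power_le_one)

lemma decay_step: "decay s (Suc t) = \<beta> * decay s t \<or> \<beta> * decay s (Suc t) = decay s t"
proof (cases "t < s")
  case True
  then have "s - t = Suc (s - Suc t)" by simp
  then show ?thesis using True beta_gt by (simp add: decay_def \<theta>_def)
next
  case False
  then have "Suc t - s = Suc (t - s)" by simp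
  then show ?thesis using False beta_gt by (simp add: decay_def \<theta>_def)
qed

lemma sum_decay_sq_le: "(\<Sum>t<n. (decay s t)\<^sup>2) \<le> 2 / (1 - \<theta>)"
proof -
  have "(decay s t)\<^sup>2 \<le> decay s t" for t
    using decay_pos[of s t] decay_le_1[of s t] by (simp add: power2_eq_square mult_left_le)
  then have "(\<Sum>t<n. (decay s t)\<^sup>2) \<le> (\<Sum>t<n. decay s t)" by (intro sum_mono)
  also have "\<dots> \<le> 2 / (1 - \<theta>)"
    unfolding decay_def by (rule sum_two_sided_geometric_le[OF theta_pos theta_lt])
  finally show ?thesis .
qed

lemma kkt_block_bounds:
  assumes "kkt A B p gf gc gT x \<zeta> y v l" and "kkt A B p gf gc gT' x' \<zeta> y' v' l'"
    and "\<And>t. t < p \<Longrightarrow> block_gradient bx \<mu> L (gf t)" "\<And>t. t < p \<Longrightarrow> block_gradient bu \<mu> L (gc t)"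
      "block_gradient bx \<mu> L gT"
  shows "t \<le> p \<Longrightarrow> block_bounds bx \<mu> L (if t < p then gf t (y t) - gf t (y' t) else gT (y t) - gT (y' t)) (y t - y' t)"
    and "t < p \<Longrightarrow> block_bounds bu \<mu> L (gc t (v t) - gc t (v' t)) (v t - v' t)"
  using assms by (auto simp: block_gradient_def)

lemma kkt_bound:
  assumes kkt: "kkt A B p gf gc gT x \<zeta> y v l"
    and gr: "\<And>t. t < p \<Longrightarrow> block_gradient bx \<mu> L (gf t)" "\<And>t. t < p \<Longrightarrow> block_gradient bu \<mu> L (gc t)"
      "block_gradient bx \<mu> L gT"
  shows "energy p y v l \<le> 4 * K\<^sup>2 * ((norm x)\<^sup>2 + sq_sum p \<zeta>)"
proof -
  have "energy p y v l \<le> 4 * K\<^sup>2 * energy p (\<lambda>_. 0 :: real^'n) (\<lambda>_. 0 :: real^'m) (state_defect x \<zeta>)"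
    by (rule unweighted_estimate[OF kkt_residual_system[OF kkt]]) (use gr in \<open>auto intro!: block_gradient_at\<close>)
  then show ?thesis by (simp add: energy_def sq_sum_state_defect)
qed

text \<open>The weight peaks at \<open>s\<close>, so the values there count fully, while
  disturbances are damped by squared weights with sum at most 2/(1 - \<theta>). Unlike in
  \<open>kkt_bound\<close>, the result does not grow with \<open>p\<close> when the disturbances are
  merely bounded.\<close>

lemma kkt_bound_at:
  assumes kkt: "kkt A B p gf gc gT x \<zeta> y v l"
    and gr: "\<And>t. t < p \<Longrightarrow> block_gradient bx \<mu> L (gf t)" "\<And>t. t < p \<Longrightarrow> block_gradient bu \<mu> L (gc t)"
      "block_gradient bx \<mu> L gT"
    and s: "s \<le> p" and D: "\<And>t. t < p \<Longrightarrow> norm (\<zeta> t) \<le> D"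
  shows "(norm (y s))\<^sup>2 + (norm (l s))\<^sup>2 \<le> 4 * K\<^sup>2 * ((norm x)\<^sup>2 + D\<^sup>2 * (2 / (1 - \<theta>)))"
proof -
  let ?w = "decay s"
  have "energy p (\<lambda>t. ?w t *\<^sub>R y t) (\<lambda>t. ?w t *\<^sub>R v t) (\<lambda>t. ?w t *\<^sub>R l t)
    \<le> 4 * K\<^sup>2 * energy p (\<lambda>t. ?w t *\<^sub>R (0::real^'n)) (\<lambda>t. ?w t *\<^sub>R (0::real^'m)) (\<lambda>t. ?w t *\<^sub>R state_defect x \<zeta> t)"
    by (rule time_weighted_estimate[OF kkt_residual_system[OF kkt]])
       (use gr decay_pos decay_step in \<open>auto intro!: block_gradient_at\<close>)
  moreover have "(norm (y s))\<^sup>2 + (norm (l s))\<^sup>2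
      \<le> energy p (\<lambda>t. ?w t *\<^sub>R y t) (\<lambda>t. ?w t *\<^sub>R v t) (\<lambda>t. ?w t *\<^sub>R l t)"
    using norm_sq_le_sq_sum[of s "Suc p" "\<lambda>t. ?w t *\<^sub>R y t"] norm_sq_le_sq_sum[of s "Suc p" "\<lambda>t. ?w t *\<^sub>R l t"]
      sq_sum_nonneg[of p "\<lambda>t. ?w t *\<^sub>R v t"] s unfolding energy_def by (simp del: sq_sum_nonneg)
  moreover have "energy p (\<lambda>t. ?w t *\<^sub>R (0::real^'n)) (\<lambda>t. ?w t *\<^sub>R (0::real^'m)) (\<lambda>t. ?w t *\<^sub>R state_defect x \<zeta> t)
      \<le> (norm x)\<^sup>2 + D\<^sup>2 * (2 / (1 - \<theta>))"
  proof -
    have "sq_sum (Suc p) (\<lambda>t. ?w t *\<^sub>R state_defect x \<zeta> t)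
        = (?w 0 * norm x)\<^sup>2 + (\<Sum>t<p. (?w (Suc t) * norm (\<zeta> t))\<^sup>2)"
      unfolding sq_sum_def by (subst sum.lessThan_Suc_shift) (simp add: power_mult_distrib)
    also have "\<dots> \<le> (1 * norm x)\<^sup>2 + (\<Sum>t<p. (?w (Suc t) * D)\<^sup>2)"
      using decay_pos decay_le_1 D
      by (intro add_mono power_mono sum_mono mult_mono) (auto simp: less_imp_le)
    also have "(\<Sum>t<p. (?w (Suc t) * D)\<^sup>2) = D\<^sup>2 * (\<Sum>t<p. (?w (Suc t))\<^sup>2)"
      by (simp add: power_mult_distrib sum_distrib_left mult.commute)
    also have "(\<Sum>t<p. (?w (Suc t))\<^sup>2) \<le> (\<Sum>t<Suc p. (?w t)\<^sup>2)"
      by (subst sum.lessThan_Suc_shift) simp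
    also have "\<dots> \<le> 2 / (1 - \<theta>)" by (rule sum_decay_sq_le)
    finally show ?thesis by (simp add: energy_def mult_left_mono)
  qed
  ultimately show ?thesis using mult_left_mono[of _ _ "4 * K\<^sup>2"] by (smt (verit) zero_le_power2)
qed

text \<open>The initial multiplier plays the role of minus the gradient of the optimal value with
  respect to the initial state; this is its Lipschitz bound, uniform in the horizon.\<close>

lemma kkt_initial_perturbation:
  assumes kkt: "kkt A B p gf gc gT x \<zeta> y v l" "kkt A B p gf gc gT x' \<zeta> y' v' l'"
    and gr: "\<And>t. t < p \<Longrightarrow> block_gradient bx \<mu> L (gf t)" "\<And>t. t < p \<Longrightarrow> block_gradient bu \<mu> L (gc t)"
      "block_gradient bx \<mu> L gT"
  shows "norm (l 0 - l' 0) \<le> 2 * K * norm (x - x')"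
proof -
  let ?r = "\<lambda>t. if t < p then 0 else gT (y' p) - gT (y' p)"
  have "(norm (l 0 - l' 0))\<^sup>2 \<le> energy p (\<lambda>t. y t - y' t) (\<lambda>t. v t - v' t) (\<lambda>t. l t - l' t)"
    using norm_sq_le_sq_sum[of 0 "Suc p" "\<lambda>t. l t - l' t"] by (simp add: energy_def add_increasing)
  also have "\<dots> \<le> 4 * K\<^sup>2 * energy p ?r (\<lambda>_. 0 :: real^'m) (state_defect (x - x') (\<lambda>_. 0))"
    by (rule unweighted_estimate[OF kkt_diff_residual_system[OF kkt]]; rule kkt_block_bounds[OF kkt gr])
  also have "energy p ?r (\<lambda>_. 0 :: real^'m) (state_defect (x - x') (\<lambda>_. 0)) = (norm (x - x'))\<^sup>2"
  proof -
    have "?r = (\<lambda>_. 0)" by auto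
    then show ?thesis by (simp add: energy_def sq_sum_state_defect)
  qed
  finally have "(norm (l 0 - l' 0))\<^sup>2 \<le> (2 * K * norm (x - x'))\<^sup>2" by (simp add: power_mult_distrib)
  then show ?thesis by (rule power2_le_imp_le) (use K_pos in simp)
qed

text \<open>The weight \<beta>^(p - t) is 1 at the end, where the only residual sits, and \<beta>^p
  at time 0, where the inputs are compared.\<close>

lemma kkt_terminal_perturbation:
  assumes kkt: "kkt A B p gf gc gT x \<zeta> y v l" "kkt A B p gf gc gT' x \<zeta> y' v' l'"
    and gr: "\<And>t. t < p \<Longrightarrow> block_gradient bx \<mu> L (gf t)" "\<And>t. t < p \<Longrightarrow> block_gradient bu \<mu> L (gc t)"
      "block_gradient bx \<mu> L gT"
    and "0 < p"
  shows "norm (v 0 - v' 0) \<le> 2 * K * \<theta> ^ p * norm (gT' (y' p) - gT (y' p))"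
proof -
  let ?w = "\<lambda>t. \<beta> ^ (p - t)"
  let ?d = "gT' (y' p) - gT (y' p)"
  let ?r = "\<lambda>t. if t < p then 0 else ?d"
  have "(\<beta> ^ p * norm (v 0 - v' 0))\<^sup>2
      \<le> energy p (\<lambda>t. ?w t *\<^sub>R (y t - y' t)) (\<lambda>t. ?w t *\<^sub>R (v t - v' t)) (\<lambda>t. ?w t *\<^sub>R (l t - l' t))"
    using norm_sq_le_sq_sum[of 0 p "\<lambda>t. ?w t *\<^sub>R (v t - v' t)"] \<open>0 < p\<close> beta_gt
    by (simp add: energy_def add_increasing add_increasing2)
  also have "\<dots> \<le> 4 * K\<^sup>2 * energy p (\<lambda>t. ?w t *\<^sub>R ?r t) (\<lambda>t. ?w t *\<^sub>R (0 :: real^'m))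
      (\<lambda>t. ?w t *\<^sub>R state_defect (x - x) (\<lambda>_. 0) t)"
  proof (rule time_weighted_estimate[OF kkt_diff_residual_system[OF kkt] _ _ kkt_block_bounds[OF kkt gr]])
    show "0 < ?w t" for t using beta_gt by simp
    show "?w (Suc t) = ?w t \<or> ?w (Suc t) = \<beta> * ?w t \<or> \<beta> * ?w (Suc t) = ?w t" if "t < p" for t
      using Suc_diff_Suc[OF that] by (metis power_Suc)
  qed
  also have "\<dots> = 4 * K\<^sup>2 * (norm ?d)\<^sup>2"
  proof -
    have "state_defect (x - x) (\<lambda>_. 0) = (\<lambda>_. 0)"
      by (auto simp: state_defect_def fun_eq_iff split: nat.split)
    moreover have "sq_sum (Suc p) (\<lambda>t. ?w t *\<^sub>R ?r t) = (norm ?d)\<^sup>2" by (simp add: sq_sum_def)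
    ultimately show ?thesis by (simp add: energy_def)
  qed
  finally have "(\<beta> ^ p * norm (v 0 - v' 0))\<^sup>2 \<le> (2 * K * norm ?d)\<^sup>2" by (simp add: power_mult_distrib)
  then have "\<beta> ^ p * norm (v 0 - v' 0) \<le> 2 * K * norm ?d"
    by (rule power2_le_imp_le) (use K_pos in simp)
  then have *: "\<theta> ^ p * (\<beta> ^ p * norm (v 0 - v' 0)) \<le> \<theta> ^ p * (2 * K * norm ?d)"
    using theta_pos by (intro mult_left_mono) auto
  have "norm (v 0 - v' 0) = \<theta> ^ p * (\<beta> ^ p * norm (v 0 - v' 0))"
    using beta_gt by (simp add: \<theta>_def power_divide)
  also note *
  finally show ?thesis by (simp add: mult_ac)
qed

text \<open>The weight is 1 outside \<open>S\<close>, where the truncation leaves its residuals, and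
  grows to \<beta>^(\<kappa> + 1) at node \<open>i\<close>, which therefore feels them with the
  factor \<theta>^(\<kappa> + 1).\<close>

lemma kkt_truncation:
  fixes i :: 'v and \<kappa> :: nat
  defines "S \<equiv> nbhd_upto E \<kappa> i"
  assumes kkt: "kkt A B p gf gc gT x \<zeta> y v l"
    and kktS: "kkt (restrict_rows bx S A) (restrict_rows bx S B) p gf gc gT
        (restrict_vec bx S x) (\<lambda>t. restrict_vec bx S (\<zeta> t)) y' v' l'"
    and dualS: "dual_bound J (restrict_rows bx S A) (restrict_rows bx S B)"
    and gr: "\<And>t. t < p \<Longrightarrow> block_gradient bx \<mu> L (gf t)" "\<And>t. t < p \<Longrightarrow> block_gradient bu \<mu> L (gc t)"
      "block_gradient bx \<mu> L gT"
    and "0 < p"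
  shows "(norm (restrict_vec bu {i} (v' 0 - v 0)))\<^sup>2
      \<le> 16 * K\<^sup>2 * G\<^sup>2 * (\<theta> ^ (\<kappa> + 1))\<^sup>2 * ((norm x)\<^sup>2 + sq_sum p \<zeta>)"
proof -
  let ?P = "restrict_vec bx S"
  have symE: "sym E" using net by (simp add: networked_system_def)
  \<comment> \<open>\<open>z\<close> is one step of the full dynamics from the truncated solution;
    its part outside \<open>S\<close> is what the truncation discards. Likewise \<open>l'\<close>
    need not vanish outside \<open>S\<close>: removing rows of \<open>A\<close> does not remove rows
    of its transpose.\<close>
  define z where "z t = A *v y' t + B *v v' t + \<zeta> t" for t
  define r where "r t = ?P (l' t) - l' t" for t
  define q where "q = state_defect (?P x - x) (\<lambda>t. ?P (z t) - z t)"
  have kktS': "trajectory (restrict_rows bx S A) (restrict_rows bx S B) p (\<lambda>t. ?P (\<zeta> t)) (?P x) y' v'"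
    "\<And>t. t < p \<Longrightarrow> gf t (y' t) + l' t = transpose A *v ?P (l' (Suc t))" "gT (y' p) + l' p = 0"
    "\<And>t. t < p \<Longrightarrow> gc t (v' t) = transpose B *v ?P (l' (Suc t))"
    using kktS by (auto simp: kkt_def transpose_restrict_rows_mult)
  text \<open>Extending the truncated multipliers by zero, all residuals are supported outside \<open>S\<close>.\<close>
  have sys: "residual_system A B p (\<lambda>t. y' t - y t) (\<lambda>t. v' t - v t) (\<lambda>t. ?P (l' t) - l t)
      (\<lambda>t. if t < p then gf t (y' t) - gf t (y t) else gT (y' t) - gT (y t))
      (\<lambda>t. gc t (v' t) - gc t (v t)) r (\<lambda>_. 0) q"
    unfolding residual_system_def
  proof (intro conjI allI impI)
    show "y' 0 - y 0 = q 0" using kkt kktS' by (simp add: kkt_def trajectory_def q_def)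
    have "gT (y p) = - l p" "gT (y' p) = - l' p"
      using kkt kktS' by (auto simp: kkt_def eq_neg_iff_add_eq_0)
    then show "(if p < p then gf p (y' p) - gf p (y p) else gT (y' p) - gT (y p)) + (?P (l' p) - l p) = r p"
      by (simp add: r_def)
    fix t assume t: "t < p"
    have y: "y (Suc t) = A *v y t + B *v v t + \<zeta> t" using kkt t by (simp add: kkt_def trajectory_def)
    have "y' (Suc t) = ?P (z t)"
      using kktS'(1) t by (simp add: trajectory_def z_def restrict_rows_mult restrict_vec_add)
    then show "y' (Suc t) - y (Suc t) = A *v (y' t - y t) + B *v (v' t - v t) + q (Suc t)"
      by (simp add: y q_def z_def matrix_vector_mult_diff_distrib)
    have "gf t (y t) = transpose A *v l (Suc t) - l t" using kkt t by (simp add: kkt_def eq_diff_eq)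
    moreover have "gf t (y' t) = transpose A *v ?P (l' (Suc t)) - l' t"
      using kktS'(2)[OF t] by (simp add: eq_diff_eq)
    ultimately show "(if t < p then gf t (y' t) - gf t (y t) else gT (y' t) - gT (y t)) + (?P (l' t) - l t)
        = transpose A *v (?P (l' (Suc t)) - l (Suc t)) + r t"
      using t by (simp add: r_def matrix_vector_mult_diff_distrib)
    show "gc t (v' t) - gc t (v t) = transpose B *v (?P (l' (Suc t)) - l (Suc t)) + 0"
      using kkt kktS'(4)[OF t] t by (simp add: kkt_def matrix_vector_mult_diff_distrib)
  qed
  \<comment> \<open>Nodes at distance \<kappa> get level 1, next to level 0 outside
    \<open>S\<close>, so the level changes by at most one along every edge.\<close>
  define lev where "lev j = (if j \<in> S then \<kappa> + 1 - the_enat (gdist E i j) else 0)" for j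
  define w :: "nat \<Rightarrow> 'v \<Rightarrow> real" where "w t j = \<beta> ^ lev j" for t j
  have lev_le: "lev j \<le> lev j' + 1" if "j' \<in> nbhd E j" for j j'
  proof (cases "j \<in> S")
    case True
    then have "gdist E i j \<le> enat \<kappa>" by (simp add: S_def nbhd_upto_def)
    then obtain n where n: "gdist E i j = enat n" "n \<le> \<kappa>" by (cases "gdist E i j") auto
    have "j \<in> nbhd_upto E n i" by (simp add: nbhd_upto_def n)
    then have "j' \<in> nbhd_upto E (Suc n) i" by (rule nbhd_upto_step[OF symE that])
    then have "gdist E i j' \<le> enat (Suc n)" by (simp add: nbhd_upto_def)
    then obtain n' where n': "gdist E i j' = enat n'" "n' \<le> Suc n" by (cases "gdist E i j'") auto
    have "lev j' \<ge> \<kappa> + 1 - n'" using n' by (auto simp: lev_def S_def nbhd_upto_def)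
    moreover have "lev j = \<kappa> + 1 - n" using True n by (simp add: lev_def)
    ultimately show ?thesis using n'(2) by linarith
  qed (simp add: lev_def)
  have adm: "admissible_weight p w"
    unfolding admissible_weight_def
  proof (intro conjI allI impI ballI)
    show "0 < w t j" for t j using beta_gt by (simp add: w_def)
    fix t j j' assume "j' \<in> nbhd E j"
    then have "lev j \<le> lev j' + 1" "lev j' \<le> lev j + 1"
      using lev_le nbhd_sym[OF symE] by auto
    then consider "lev j = lev j'" | "lev j = Suc (lev j')" | "lev j' = Suc (lev j)" by linarith
    then show "w (Suc t) j = w t j' \<or> w (Suc t) j = \<beta> * w t j' \<or> \<beta> * w (Suc t) j = w t j'"
      by cases (simp_all add: w_def)
  qed
  have out: "norm (scale_vec (\<lambda>a. w t (bx a)) (?P u - u)) \<le> norm u" for t u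
  proof -
    have "scale_vec (\<lambda>a. w t (bx a)) (?P u - u) = ?P u - u"
      by (auto simp: vec_eq_iff w_def lev_def)
    moreover have "norm (?P u - u) \<le> norm u"
    proof -
      have "?P u - u = restrict_vec bx (- S) (- u)" by (auto simp: vec_eq_iff)
      then show ?thesis using norm_restrict_vec_le[of bx "- S" "- u"] by simp
    qed
    ultimately show ?thesis by simp
  qed
  have bx_at: "block_bounds bx \<mu> L (if t < p then gf t (y' t) else gT (y' t)) (y' t)" if "t \<le> p" for t
    using gr that by (auto intro!: block_gradient_at)
  have bu_at: "block_bounds bu \<mu> L (gc t (v' t)) (v' t)" if "t < p" for t
    using gr that by (auto intro!: block_gradient_at)
  define X where "X = (norm x)\<^sup>2 + sq_sum p \<zeta>"
  \<comment> \<open>The residuals are built from the truncated solution, which needs an a priori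
    bound of its own. It is the unweighted estimate for the truncated pair, with the same
    \<open>J\<close>.\<close>
  have EnS: "energy p y' v' l' \<le> K\<^sup>2 * X"
  proof -
    have "energy p y' v' l' \<le> (4 * (J * L)\<^sup>2 / \<mu>)\<^sup>2 * energy p (\<lambda>_. 0 :: real^'n) (\<lambda>_. 0 :: real^'m)
       (state_defect (?P x) (\<lambda>t. ?P (\<zeta> t)))"
    proof (rule base_energy_estimate[OF kkt_residual_system[OF kktS] dualS mu_pos mu_le _ L_ge])
      show "1 \<le> J * L" by (rule JL_ge_1)
      show "\<mu> * (norm (y' t))\<^sup>2 \<le> (if t < p then gf t (y' t) else gT (y' t)) \<bullet> y' t" if "t \<le> p" for t
        by (rule block_bounds_global(1)[OF bx_at[OF that]]) (use L_pos in simp)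
      show "norm (if t < p then gf t (y' t) else gT (y' t)) \<le> L * norm (y' t)" if "t \<le> p" for t
        by (rule block_bounds_global(2)[OF bx_at[OF that]]) (use L_pos in simp)
      show "\<mu> * (norm (v' t))\<^sup>2 \<le> gc t (v' t) \<bullet> v' t" if "t < p" for t
        by (rule block_bounds_global(1)[OF bu_at[OF that]]) (use L_pos in simp)
      show "norm (gc t (v' t)) \<le> L * norm (v' t)" if "t < p" for t
        by (rule block_bounds_global(2)[OF bu_at[OF that]]) (use L_pos in simp)
    qed
    also have "\<dots> = K\<^sup>2 * ((norm (?P x))\<^sup>2 + sq_sum p (\<lambda>t. ?P (\<zeta> t)))"
      by (simp add: K_def energy_def sq_sum_state_defect)
    also have "\<dots> \<le> K\<^sup>2 * X"
      unfolding X_def sq_sum_def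
      by (intro mult_left_mono add_mono sum_mono power_mono norm_restrict_vec_le) auto
    finally show ?thesis .
  qed
  have z_sum: "sq_sum p z \<le> 3 * L\<^sup>2 * (sq_sum (Suc p) y' + sq_sum p v') + 3 * sq_sum p \<zeta>"
  proof -
    have "(norm (z t))\<^sup>2 \<le> 3 * L\<^sup>2 * ((norm (y' t))\<^sup>2 + (norm (v' t))\<^sup>2) + 3 * (norm (\<zeta> t))\<^sup>2" for t
    proof -
      let ?a = "L * norm (y' t)" and ?b = "L * norm (v' t)" and ?c = "norm (\<zeta> t)"
      have "norm (z t) \<le> ?a + ?b + ?c"
        unfolding z_def using norm_A[of "y' t"] norm_B[of "v' t"]
        by (intro norm_triangle_le add_mono) auto
      then have "(norm (z t))\<^sup>2 \<le> (?a + ?b + ?c)\<^sup>2" by (intro power_mono) auto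
      also have "\<dots> \<le> 3 * (?a\<^sup>2 + ?b\<^sup>2 + ?c\<^sup>2)"
      proof -
        have "0 \<le> (?a - ?b)\<^sup>2 + (?b - ?c)\<^sup>2 + (?a - ?c)\<^sup>2" by simp
        also have "\<dots> = 3 * (?a\<^sup>2 + ?b\<^sup>2 + ?c\<^sup>2) - (?a + ?b + ?c)\<^sup>2"
          by (simp add: power2_eq_square algebra_simps)
        finally show ?thesis by simp
      qed
      finally show ?thesis by (simp add: power_mult_distrib algebra_simps)
    qed
    then have "sq_sum p z \<le> (\<Sum>t<p. 3 * L\<^sup>2 * ((norm (y' t))\<^sup>2 + (norm (v' t))\<^sup>2) + 3 * (norm (\<zeta> t))\<^sup>2)"
      unfolding sq_sum_def by (intro sum_mono)
    also have "\<dots> = 3 * L\<^sup>2 * (sq_sum p y' + sq_sum p v') + 3 * sq_sum p \<zeta>"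
      by (simp add: sq_sum_def sum.distrib flip: sum_distrib_left)
    also have "\<dots> \<le> 3 * L\<^sup>2 * (sq_sum (Suc p) y' + sq_sum p v') + 3 * sq_sum p \<zeta>"
      by (intro add_mono mult_left_mono order_refl) (simp_all add: sq_sum_def)
    finally show ?thesis .
  qed
  have res: "energy p (xw w r) (uw w (\<lambda>_. 0)) (xw w q) \<le> 4 * G\<^sup>2 * X"
  proof -
    have "sq_sum (Suc p) (xw w r) \<le> 1\<^sup>2 * sq_sum (Suc p) l'"
      by (rule sq_sum_le_scaled) (use out in \<open>simp add: xw_def r_def\<close>)
    moreover have "sq_sum p (uw w (\<lambda>_. 0)) = 0" by (simp add: sq_sum_def uw_def scale_vec_def zero_vec_def)
    moreover have "sq_sum (Suc p) (xw w q) \<le> (norm x)\<^sup>2 + sq_sum p z"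
    proof -
      have "sq_sum (Suc p) (xw w q) \<le> 1\<^sup>2 * sq_sum (Suc p) (state_defect x z)"
        by (rule sq_sum_le_scaled)
           (use out in \<open>auto simp: xw_def q_def state_defect_def split: nat.split\<close>)
      then show ?thesis by (simp add: sq_sum_state_defect)
    qed
    ultimately have "energy p (xw w r) (uw w (\<lambda>_. 0)) (xw w q)
      \<le> sq_sum (Suc p) l' + (norm x)\<^sup>2 + 3 * L\<^sup>2 * (sq_sum (Suc p) y' + sq_sum p v') + 3 * sq_sum p \<zeta>"
      using z_sum by (simp add: energy_def)
    also have "\<dots> \<le> 3 * L\<^sup>2 * energy p y' v' l' + 3 * X"
    proof -
      have "1 \<le> L\<^sup>2" using L_ge by simp
      then have "1 * sq_sum (Suc p) l' \<le> (3 * L\<^sup>2) * sq_sum (Suc p) l'" by (intro mult_right_mono) auto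
      then show ?thesis using zero_le_power2[of "norm x"]
        unfolding energy_def X_def distrib_left by linarith
    qed
    also have "\<dots> \<le> 3 * L\<^sup>2 * (K\<^sup>2 * X) + 3 * X"
      using EnS by (intro add_mono mult_left_mono) auto
    also have "\<dots> = (3 * G\<^sup>2 + 3) * X" by (simp add: G_def power_mult_distrib algebra_simps)
    also have "\<dots> \<le> (4 * G\<^sup>2) * X"
    proof -
      have "8\<^sup>2 \<le> G\<^sup>2" using G_ge by (intro power_mono) auto
      then show ?thesis by (intro mult_right_mono) (auto simp: X_def)
    qed
    finally show ?thesis .
  qed
  have "energy p (xw w (\<lambda>t. y' t - y t)) (uw w (\<lambda>t. v' t - v t)) (xw w (\<lambda>t. ?P (l' t) - l t))
      \<le> 4 * K\<^sup>2 * (4 * G\<^sup>2 * X)"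
  proof -
    have "energy p (xw w (\<lambda>t. y' t - y t)) (uw w (\<lambda>t. v' t - v t)) (xw w (\<lambda>t. ?P (l' t) - l t))
      \<le> 4 * K\<^sup>2 * energy p (xw w r) (uw w (\<lambda>_. 0)) (xw w q)"
      by (rule weighted_energy_estimate[OF sys adm]) (use gr in \<open>auto simp: block_gradient_def\<close>)
    also have "\<dots> \<le> 4 * K\<^sup>2 * (4 * G\<^sup>2 * X)" by (intro mult_left_mono res) simp
    finally show ?thesis .
  qed
  moreover have "(\<beta> ^ (\<kappa> + 1))\<^sup>2 * (norm (restrict_vec bu {i} (v' 0 - v 0)))\<^sup>2
      \<le> energy p (xw w (\<lambda>t. y' t - y t)) (uw w (\<lambda>t. v' t - v t)) (xw w (\<lambda>t. ?P (l' t) - l t))"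
  proof -
    have "gdist E i i \<le> enat 0" unfolding gdist_le_iff by auto
    then have "gdist E i i = enat 0" by (cases "gdist E i i") auto
    then have "w 0 i = \<beta> ^ (\<kappa> + 1)"
      by (simp add: w_def lev_def S_def nbhd_upto_def)
    then have "(\<beta> ^ (\<kappa> + 1)) *\<^sub>R restrict_vec bu {i} (v' 0 - v 0)
      = restrict_vec bu {i} (uw w (\<lambda>t. v' t - v t) 0)"
      unfolding uw_def by (subst restrict_scale_vec) simp
    then have "norm ((\<beta> ^ (\<kappa> + 1)) *\<^sub>R restrict_vec bu {i} (v' 0 - v 0)) \<le> norm (uw w (\<lambda>t. v' t - v t) 0)"
      by (metis norm_restrict_vec_le)
    then have "(norm ((\<beta> ^ (\<kappa> + 1)) *\<^sub>R restrict_vec bu {i} (v' 0 - v 0)))\<^sup>2 \<le> (norm (uw w (\<lambda>t. v' t - v t) 0))\<^sup>2"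
      by (intro power_mono) auto
    also have "\<dots> \<le> sq_sum p (uw w (\<lambda>t. v' t - v t))" by (rule norm_sq_le_sq_sum[OF \<open>0 < p\<close>])
    finally show ?thesis by (simp add: energy_def power_mult_distrib add_increasing add_increasing2)
  qed
  ultimately have "(\<beta> ^ (\<kappa> + 1))\<^sup>2 * (norm (restrict_vec bu {i} (v' 0 - v 0)))\<^sup>2 \<le> 16 * K\<^sup>2 * G\<^sup>2 * X"
    by simp
  then have *: "(\<theta> ^ (\<kappa> + 1))\<^sup>2 * ((\<beta> ^ (\<kappa> + 1))\<^sup>2 * (norm (restrict_vec bu {i} (v' 0 - v 0)))\<^sup>2)
      \<le> (\<theta> ^ (\<kappa> + 1))\<^sup>2 * (16 * K\<^sup>2 * G\<^sup>2 * X)"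
    by (intro mult_left_mono) auto
  have "(norm (restrict_vec bu {i} (v' 0 - v 0)))\<^sup>2
      = (\<theta> ^ (\<kappa> + 1))\<^sup>2 * ((\<beta> ^ (\<kappa> + 1))\<^sup>2 * (norm (restrict_vec bu {i} (v' 0 - v 0)))\<^sup>2)"
    using beta_gt by (simp add: \<theta>_def power_divide)
  also note *
  finally show ?thesis unfolding X_def by (simp add: mult_ac)
qed

end

subsection \<open>Convexity and gradients\<close>

lemma GDERIV_along_line:
  assumes "GDERIV f (x + e *\<^sub>R z) :> g"
  shows "((\<lambda>e. f (x + e *\<^sub>R z)) has_real_derivative (g \<bullet> z)) (at e)"
proof -
  have "((\<lambda>e. x + e *\<^sub>R z) has_derivative (\<lambda>e. e *\<^sub>R z)) (at e)"
    by (auto intro!: derivative_eq_intros)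
  moreover have "(f has_derivative (\<lambda>h. h \<bullet> g)) (at (x + e *\<^sub>R z))"
    using assms by (simp add: gderiv_def)
  ultimately have "((\<lambda>e. f (x + e *\<^sub>R z)) has_derivative (\<lambda>e. (e *\<^sub>R z) \<bullet> g)) (at e)"
    by (rule has_derivative_compose)
  then show ?thesis
    by (simp add: has_field_derivative_def inner_commute mult.commute[of _ "g \<bullet> z"])
qed

lemma convex_gradient_le:
  fixes f :: "'a::real_inner \<Rightarrow> real"
  assumes cvx: "convex_on UNIV f" and g: "GDERIV f x :> g"
  shows "f x + g \<bullet> (y - x) \<le> f y"
proof -
  let ?\<phi> = "\<lambda>e::real. f (x + e *\<^sub>R (y - x))"
  have "convex_on UNIV ?\<phi>"
  proof (rule convex_onI)
    fix t a b :: real assume t: "0 < t" "t < 1"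
    have "x + ((1 - t) *\<^sub>R a + t *\<^sub>R b) *\<^sub>R (y - x)
        = (1 - t) *\<^sub>R (x + a *\<^sub>R (y - x)) + t *\<^sub>R (x + b *\<^sub>R (y - x))"
      by (simp add: algebra_simps)
    then show "?\<phi> ((1 - t) *\<^sub>R a + t *\<^sub>R b) \<le> (1 - t) * ?\<phi> a + t * ?\<phi> b"
      using convex_onD[OF cvx] t by simp
  qed simp
  moreover have "(?\<phi> has_real_derivative (g \<bullet> (y - x))) (at 0)"
    by (rule GDERIV_along_line) (simp add: g)
  ultimately have "?\<phi> 1 - ?\<phi> 0 \<ge> (g \<bullet> (y - x)) * (1 - 0)"
    by (intro convex_on_imp_above_tangent[where A = UNIV]) auto
  then show ?thesis by simp
qed

lemma GDERIV_half_norm_sq: "GDERIV (\<lambda>x. m / 2 * (norm x)\<^sup>2) x :> m *\<^sub>R (x :: 'a::real_inner)"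
  unfolding gderiv_def power2_norm_eq_inner
  by (auto intro!: derivative_eq_intros simp: inner_commute algebra_simps)

lemma convex_on_half_norm_sq:
  assumes "0 \<le> m"
  shows "convex_on UNIV (\<lambda>x :: 'a::real_inner. m / 2 * (norm x)\<^sup>2)"
proof (rule convex_onI)
  fix t :: real and x y :: 'a assume t: "0 < t" "t < 1"
  have "(norm ((1 - t) *\<^sub>R x + t *\<^sub>R y))\<^sup>2 + (1 - t) * t * (norm (x - y))\<^sup>2
      = (1 - t) * (norm x)\<^sup>2 + t * (norm y)\<^sup>2"
    by (simp add: power2_norm_eq_inner inner_add_left inner_add_right inner_diff_left inner_diff_right
        inner_commute algebra_simps)
  moreover have "0 \<le> (1 - t) * t * (norm (x - y))\<^sup>2" using t by simp
  ultimately have "(norm ((1 - t) *\<^sub>R x + t *\<^sub>R y))\<^sup>2 \<le> (1 - t) * (norm x)\<^sup>2 + t * (norm y)\<^sup>2" by linarith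
  then have "m / 2 * (norm ((1 - t) *\<^sub>R x + t *\<^sub>R y))\<^sup>2
      \<le> m / 2 * ((1 - t) * (norm x)\<^sup>2 + t * (norm y)\<^sup>2)"
    using assms by (intro mult_left_mono) auto
  also have "\<dots> = (1 - t) * (m / 2 * (norm x)\<^sup>2) + t * (m / 2 * (norm y)\<^sup>2)" by algebra
  finally show "m / 2 * (norm ((1 - t) *\<^sub>R x + t *\<^sub>R y))\<^sup>2 \<le> (1 - t) * (m / 2 * (norm x)\<^sup>2) + t * (m / 2 * (norm y)\<^sup>2)" .
qed simp

lemma strongly_convex_imp_convex: "strongly_convex \<mu> f \<Longrightarrow> convex_on UNIV f"
  using convex_on_add[OF _ convex_on_half_norm_sq[of \<mu>], of "\<lambda>x. f x - \<mu> / 2 * (norm x)\<^sup>2"]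
  by (simp add: strongly_convex_def)

lemma strongly_convex_gradient_mono:
  assumes sc: "strongly_convex \<mu> f" and g: "\<And>x. GDERIV f x :> g x"
  shows "\<mu> * (norm (x - y))\<^sup>2 \<le> (g x - g y) \<bullet> (x - y)"
proof -
  let ?f = "\<lambda>x. f x - \<mu> / 2 * (norm x)\<^sup>2"
  have "convex_on UNIV ?f" using sc by (simp add: strongly_convex_def)
  moreover have "GDERIV ?f x :> g x - \<mu> *\<^sub>R x" for x
    by (intro GDERIV_diff g GDERIV_half_norm_sq)
  ultimately have le: "?f x + (g x - \<mu> *\<^sub>R x) \<bullet> (y - x) \<le> ?f y" for x y
    by (rule convex_gradient_le)
  have "(g x - \<mu> *\<^sub>R x) \<bullet> (y - x) + (g y - \<mu> *\<^sub>R y) \<bullet> (x - y) \<le> 0"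
    using le[of x y] le[of y x] by linarith
  then show ?thesis
    by (simp add: power2_norm_eq_inner inner_diff_left inner_diff_right inner_commute algebra_simps)
qed

lemma gradient_zero_at_minimum:
  assumes g: "GDERIV f x :> g" and min: "\<And>y. f x \<le> f y"
  shows "g = 0"
proof -
  have "((\<lambda>e. f (x + e *\<^sub>R g)) has_real_derivative (g \<bullet> g)) (at 0)"
    by (rule GDERIV_along_line) (simp add: g)
  then have "g \<bullet> g = 0" by (rule DERIV_local_min[of _ _ _ 1]) (use min in auto)
  then show ?thesis by simp
qed

lemma regular_cost_gradient:
  assumes "regular_cost \<mu> L f"
  obtains g where "\<And>x. GDERIV f x :> g x" "\<And>x y. \<mu> * (norm (x - y))\<^sup>2 \<le> (g x - g y) \<bullet> (x - y)"
    "\<And>x y. norm (g x - g y) \<le> L * norm (x - y)"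
proof -
  from assms obtain g where g: "\<And>x. GDERIV f x :> g x" and lip: "L-lipschitz_on UNIV g"
    by (auto simp: regular_cost_def smooth_def)
  show thesis
  proof (rule that[of g])
    show "\<mu> * (norm (x - y))\<^sup>2 \<le> (g x - g y) \<bullet> (x - y)" for x y
      using assms g by (intro strongly_convex_gradient_mono) (auto simp: regular_cost_def)
    show "norm (g x - g y) \<le> L * norm (x - y)" for x y
      using lipschitz_onD[OF lip, of x y] by (simp add: dist_norm)
  qed (rule g)
qed

text \<open>Along directions in block \<open>i\<close> the terms of the other blocks are constant,
  so \<open>f\<close> has the same derivatives at \<open>x\<close> and at its restriction. The whole
  of \<open>f\<close> is differentiated along lines, because the local terms come without any
  regularity.\<close>

lemma separable_gradient_block:
  assumes sep: "separable b f" and g: "\<And>x. GDERIV f x :> g x"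
  shows "restrict_vec b {i} (g x) = restrict_vec b {i} (g (restrict_vec b {i} x))"
proof -
  let ?P = "\<lambda>j. restrict_vec b {j}"
  obtain fl where fl: "\<And>x. f x = (\<Sum>j\<in>UNIV. fl j (?P j x))" using sep by (auto simp: separable_def)
  have eq: "g x \<bullet> ?P i h = g (?P i x) \<bullet> ?P i h" for h
  proof -
    let ?c = "(\<Sum>j\<in>UNIV - {i}. fl j (?P j x)) - (\<Sum>j\<in>UNIV - {i}. fl j 0)"
    have *: "f (x + e *\<^sub>R ?P i h) = f (?P i x + e *\<^sub>R ?P i h) + ?c" for e
    proof -
      have 1: "?P i (x + e *\<^sub>R ?P i h) = ?P i (?P i x + e *\<^sub>R ?P i h)" by (simp add: vec_eq_iff)
      have 2: "?P j (x + e *\<^sub>R ?P i h) = ?P j x" "?P j (?P i x + e *\<^sub>R ?P i h) = 0" if "j \<noteq> i" for j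
        using that by (auto simp: vec_eq_iff)
      show ?thesis
        unfolding fl sum.remove[of UNIV i, simplified] 1 using 2 by simp
    qed
    have "((\<lambda>e. f (x + e *\<^sub>R ?P i h)) has_real_derivative (g x \<bullet> ?P i h)) (at 0)"
      by (rule GDERIV_along_line) (simp add: g)
    moreover have "((\<lambda>e. f (?P i x + e *\<^sub>R ?P i h) + ?c) has_real_derivative (g (?P i x) \<bullet> ?P i h) + 0) (at 0)"
      by (intro DERIV_add DERIV_const GDERIV_along_line) (simp add: g)
    ultimately show ?thesis unfolding * by (simp add: DERIV_unique)
  qed
  show ?thesis
  proof -
    let ?d = "g x - g (?P i x)"
    have "?d \<bullet> ?P i ?d = 0" using eq[of ?d] by (simp add: inner_diff_left)
    then have "?P i ?d \<bullet> ?P i ?d = 0" by (metis inner_commute inner_restrict_restrict)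
    then show ?thesis by (simp add: restrict_vec_diff)
  qed
qed

text \<open>By \<open>separable_gradient_block\<close> the global bounds may be applied to vectors
  supported on a single block.\<close>

lemma separable_block_bounds:
  assumes sep: "separable b f" and g: "\<And>x. GDERIV f x :> g x"
    and mono: "\<And>x y. \<mu> * (norm (x - y))\<^sup>2 \<le> (g x - g y) \<bullet> (x - y)"
    and lip: "\<And>x y. norm (g x - g y) \<le> L * norm (x - y)"
  shows "block_bounds b \<mu> L (g x - g y) (x - y)"
  unfolding block_bounds_def
proof (intro allI conjI)
  fix i
  let ?P = "restrict_vec b {i}"
  have eq: "?P (g x - g y) = ?P (g (?P x) - g (?P y))"
    using separable_gradient_block[OF sep g, of i x] separable_gradient_block[OF sep g, of i y]
    by (simp add: restrict_vec_diff)
  show "\<mu> * (norm (?P (x - y)))\<^sup>2 \<le> ?P (g x - g y) \<bullet> ?P (x - y)"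
    unfolding eq using mono[of "?P x" "?P y"]
    by (simp add: inner_restrict_restrict inner_commute flip: restrict_vec_diff)
  have "norm (?P (g x - g y)) \<le> norm (g (?P x) - g (?P y))" unfolding eq by (rule norm_restrict_vec_le)
  also have "\<dots> \<le> L * norm (?P x - ?P y)" by (rule lip)
  finally show "norm (?P (g x - g y)) \<le> L * norm (?P (x - y))" by (simp add: restrict_vec_diff)
qed

text \<open>For \<open>h\<close> orthogonal to \<open>x\<close> the norm of x + e h is even in e, so
  \<open>F\<close> has derivative 0 in direction \<open>h\<close>; the gradient thus has no
  component orthogonal to \<open>x\<close>.\<close>

lemma K_function_radial_gradient:
  fixes F :: "'a::real_inner \<Rightarrow> real"
  assumes K: "K_function F" and g: "\<And>x. GDERIV F x :> g x"
  shows "\<exists>\<phi>. g x = \<phi> *\<^sub>R x"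
proof -
  obtain \<beta> where \<beta>: "\<And>x. F x = \<beta> (norm x)" using K by (auto simp: K_function_def)
  have orth: "g x \<bullet> h = 0" if "x \<bullet> h = 0" for x h
  proof -
    have "norm (x + e *\<^sub>R h) = norm (x + (- e) *\<^sub>R h)" for e
      using that by (simp add: norm_eq_sqrt_inner inner_add_left inner_add_right inner_diff_left
          inner_diff_right inner_commute)
    then have even: "(\<lambda>e. F (x + e *\<^sub>R h)) = (\<lambda>e. F (x + e *\<^sub>R (- h)))" by (simp add: \<beta>)
    have "((\<lambda>e. F (x + e *\<^sub>R h)) has_real_derivative (g x \<bullet> h)) (at 0)"
      by (rule GDERIV_along_line) (simp add: g)
    moreover have "((\<lambda>e. F (x + e *\<^sub>R (- h))) has_real_derivative (g x \<bullet> (- h))) (at 0)"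
      by (rule GDERIV_along_line) (simp add: g)
    ultimately have "g x \<bullet> h = g x \<bullet> (- h)" unfolding even by (rule DERIV_unique)
    then show ?thesis by simp
  qed
  define \<phi> where "\<phi> = (g x \<bullet> x) / (x \<bullet> x)"
  let ?h = "g x - \<phi> *\<^sub>R x"
  have xh: "x \<bullet> ?h = 0"
    by (cases "x = 0") (simp_all add: \<phi>_def inner_diff_right inner_commute)
  then have "g x \<bullet> ?h = 0" by (rule orth)
  then have "?h \<bullet> ?h = 0" using xh by (simp add: inner_diff_left)
  then have "?h = 0" by (simp only: inner_eq_zero_iff)
  then show ?thesis by auto
qed

subsection \<open>Finite-horizon optimal control\<close>

definition ocp_cost ::
  "(nat \<Rightarrow> 'x \<Rightarrow> real) \<Rightarrow> (nat \<Rightarrow> 'u \<Rightarrow> real) \<Rightarrow> ('x \<Rightarrow> real) \<Rightarrow> nat \<Rightarrow> (nat \<Rightarrow> 'x) \<Rightarrow> (nat \<Rightarrow> 'u) \<Rightarrow> real" where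
  "ocp_cost f c g p y v = (\<Sum>t<p. f t (y t)) + (\<Sum>t<p. c t (v t)) + g (y p)"

definition ocp_opt ::
  "real^'n::finite^'n \<Rightarrow> real^'m::finite^'n \<Rightarrow> nat \<Rightarrow> (nat \<Rightarrow> real^'n \<Rightarrow> real) \<Rightarrow>
   (nat \<Rightarrow> real^'m \<Rightarrow> real) \<Rightarrow> (real^'n \<Rightarrow> real) \<Rightarrow> real^'n \<Rightarrow> (nat \<Rightarrow> real^'n) \<Rightarrow>
   (nat \<Rightarrow> real^'n) \<Rightarrow> (nat \<Rightarrow> real^'m) \<Rightarrow> bool" where
  "ocp_opt A B p f c g x \<zeta> y v \<longleftrightarrow> trajectory A B p \<zeta> x y v \<and>
     (\<forall>y' v'. trajectory A B p \<zeta> x y' v' \<longrightarrow> ocp_cost f c g p y v \<le> ocp_cost f c g p y' v')"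

lemma ocp_cost_Suc:
  "ocp_cost f c g (Suc p) y v
   = f 0 (y 0) + c 0 (v 0) + ocp_cost (\<lambda>t. f (Suc t)) (\<lambda>t. c (Suc t)) g p (\<lambda>t. y (Suc t)) (\<lambda>t. v (Suc t))"
  by (simp add: ocp_cost_def sum.lessThan_Suc_shift del: sum.lessThan_Suc)

lemma trajectory_Suc:
  "trajectory A B (Suc p) \<zeta> x y v \<longleftrightarrow> y 0 = x \<and>
     trajectory A B p (\<lambda>t. \<zeta> (Suc t)) (A *v x + B *v v 0 + \<zeta> 0) (\<lambda>t. y (Suc t)) (\<lambda>t. v (Suc t))"
  by (auto simp: trajectory_def less_Suc_eq_0_disj)

lemma ex_minimum_of_coercive:
  fixes h :: "'a::euclidean_space \<Rightarrow> real"
  assumes cont: "continuous_on UNIV h" and "0 < m" and low: "\<And>v. m / 2 * (norm v)\<^sup>2 \<le> h v"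
  shows "\<exists>v. \<forall>v'. h v \<le> h v'"
proof -
  define R where "R = sqrt (2 * h 0 / m)"
  have h0: "0 \<le> h 0" using low[of 0] by simp
  then have "0 \<le> 2 * h 0 / m" using \<open>0 < m\<close> by simp
  then have R0: "0 \<le> R" by (simp only: R_def real_sqrt_ge_zero)
  then have "compact (cball (0::'a) R)" "cball (0::'a) R \<noteq> {}" by auto
  then obtain v where v: "v \<in> cball 0 R" "\<And>v'. v' \<in> cball 0 R \<Longrightarrow> h v \<le> h v'"
    using continuous_attains_inf[of "cball 0 R" h] continuous_on_subset[OF cont subset_UNIV] by blast
  have "h v \<le> h v'" for v'
  proof (cases "v' \<in> cball 0 R")
    case False
    have "h v \<le> h 0" using R0 by (intro v) auto
    also have "\<dots> = m / 2 * R\<^sup>2" using h0 \<open>0 < m\<close> by (simp add: R_def)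
    also have "\<dots> \<le> m / 2 * (norm v')\<^sup>2"
      using False R0 \<open>0 < m\<close> by (intro mult_left_mono power_mono) auto
    also have "\<dots> \<le> h v'" by (rule low)
    finally show ?thesis .
  qed (rule v)
  then show ?thesis by blast
qed

text \<open>Dynamic programming: the optimal value \<open>W\<close> of the remaining problem is
  convex, hence continuous in finite dimension, and the first input minimizes a continuous coercive
  function. The theorem supplies minimizers of the agents' problems, whereas the optimal
  continuations used for comparison have to be constructed.\<close>

lemma ocp_opt_exists:
  fixes A :: "real^'n::finite^'n" and B :: "real^'m::finite^'n"
  assumes "\<And>t. t < p \<Longrightarrow> convex_on UNIV (f t)" "\<And>t x. t < p \<Longrightarrow> 0 \<le> f t x"
    and "\<And>t. t < p \<Longrightarrow> convex_on UNIV (c t)" and "0 < m" "\<And>t v. t < p \<Longrightarrow> m / 2 * (norm v)\<^sup>2 \<le> c t v"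
    and "convex_on UNIV g" "\<And>x. 0 \<le> g x"
  shows "\<exists>y v. ocp_opt A B p f c g x \<zeta> y v"
  using assms
proof (induction p arbitrary: f c \<zeta> x)
  case 0
  have "ocp_opt A B 0 f c g x \<zeta> (\<lambda>_. x) (\<lambda>_. 0)" by (simp add: ocp_opt_def ocp_cost_def trajectory_def)
  then show ?case by blast
next
  case (Suc p)
  let ?f = "\<lambda>t. f (Suc t)" and ?c = "\<lambda>t. c (Suc t)" and ?\<zeta> = "\<lambda>t. \<zeta> (Suc t)"
  have "\<exists>y v. ocp_opt A B p ?f ?c g x ?\<zeta> y v" for x
    by (rule Suc.IH) (use Suc.prems in auto)
  then obtain Y V where YV: "\<And>x. ocp_opt A B p ?f ?c g x ?\<zeta> (Y x) (V x)" by metis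
  define W where "W x = ocp_cost ?f ?c g p (Y x) (V x)" for x
  have W_le: "W x \<le> ocp_cost ?f ?c g p y v" if "trajectory A B p ?\<zeta> x y v" for x y v
    using YV[of x] that by (simp add: ocp_opt_def W_def)
  have c_nonneg: "0 \<le> c t v" if "t < Suc p" for t v
    using Suc.prems(5)[OF that, of v] \<open>0 < m\<close> by (smt (verit) divide_nonneg_pos mult_nonneg_nonneg zero_le_power2)
  have W_nonneg: "0 \<le> W x" for x
    unfolding W_def ocp_cost_def using Suc.prems c_nonneg by (intro add_nonneg_nonneg sum_nonneg) auto
  have W_convex: "convex_on UNIV W"
  proof (rule convex_onI)
    fix s :: real and x1 x2 :: "real^'n" assume s: "0 < s" "s < 1"
    let ?y = "\<lambda>t. (1 - s) *\<^sub>R Y x1 t + s *\<^sub>R Y x2 t" and ?v = "\<lambda>t. (1 - s) *\<^sub>R V x1 t + s *\<^sub>R V x2 t"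
    have tr: "trajectory A B p ?\<zeta> ((1 - s) *\<^sub>R x1 + s *\<^sub>R x2) ?y ?v"
      using YV[of x1] YV[of x2]
      by (auto simp: ocp_opt_def trajectory_def matrix_vector_right_distrib matrix_vector_mult_scaleR algebra_simps)
    have cvn: "h ((1 - s) *\<^sub>R a + s *\<^sub>R b) \<le> (1 - s) * h a + s * h b"
      if "convex_on UNIV h" for h :: "real^'n \<Rightarrow> real" and a b
      using convex_onD[OF that, of s a b] s by simp
    have cvm: "h ((1 - s) *\<^sub>R a + s *\<^sub>R b) \<le> (1 - s) * h a + s * h b"
      if "convex_on UNIV h" for h :: "real^'m \<Rightarrow> real" and a b
      using convex_onD[OF that, of s a b] s by simp
    have "W ((1 - s) *\<^sub>R x1 + s *\<^sub>R x2) \<le> ocp_cost ?f ?c g p ?y ?v" by (rule W_le[OF tr])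
    also have "\<dots> \<le> (\<Sum>t<p. (1 - s) * ?f t (Y x1 t) + s * ?f t (Y x2 t))
        + (\<Sum>t<p. (1 - s) * ?c t (V x1 t) + s * ?c t (V x2 t)) + ((1 - s) * g (Y x1 p) + s * g (Y x2 p))"
      unfolding ocp_cost_def using Suc.prems
      by (intro add_mono sum_mono cvn cvm) auto
    also have "\<dots> = (1 - s) * W x1 + s * W x2"
      by (simp add: W_def ocp_cost_def sum.distrib sum_distrib_left distrib_left)
    finally show "W ((1 - s) *\<^sub>R x1 + s *\<^sub>R x2) \<le> (1 - s) * W x1 + s * W x2" .
  qed simp
  define h where "h v = c 0 v + W (A *v x + B *v v + \<zeta> 0)" for v
  have "continuous_on UNIV W" using W_convex by (intro convex_on_continuous) auto
  moreover have "continuous_on UNIV (c 0)" using Suc.prems(3)[of 0] by (intro convex_on_continuous) auto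
  moreover have "continuous_on UNIV (\<lambda>v. A *v x + B *v v + \<zeta> 0)"
    by (intro continuous_intros linear_continuous_on matrix_vector_mul_bounded_linear)
  ultimately have "continuous_on UNIV h" unfolding h_def
    by (intro continuous_on_add) (auto intro: continuous_on_compose2[of UNIV W])
  moreover have "m / 2 * (norm v)\<^sup>2 \<le> h v" for v
    using Suc.prems(5)[of 0 v] W_nonneg[of "A *v x + B *v v + \<zeta> 0"] by (simp add: h_def)
  ultimately obtain v0 where v0: "\<And>v. h v0 \<le> h v" using ex_minimum_of_coercive[of h m] \<open>0 < m\<close> by blast
  define x1 where "x1 = A *v x + B *v v0 + \<zeta> 0"
  let ?y = "\<lambda>t. case t of 0 \<Rightarrow> x | Suc t \<Rightarrow> Y x1 t" and ?v = "\<lambda>t. case t of 0 \<Rightarrow> v0 | Suc t \<Rightarrow> V x1 t"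
  have "ocp_opt A B (Suc p) f c g x \<zeta> ?y ?v"
    unfolding ocp_opt_def
  proof (intro conjI allI impI)
    show "trajectory A B (Suc p) \<zeta> x ?y ?v"
      using YV[of x1] by (simp add: trajectory_Suc ocp_opt_def x1_def)
    fix y v assume tr: "trajectory A B (Suc p) \<zeta> x y v"
    have "ocp_cost f c g (Suc p) ?y ?v = f 0 x + h v0"
      by (simp add: ocp_cost_Suc h_def W_def x1_def)
    also have "\<dots> \<le> f 0 x + h (v 0)" using v0 by simp
    also have "\<dots> \<le> ocp_cost f c g (Suc p) y v"
      using tr W_le by (simp add: trajectory_Suc ocp_cost_Suc h_def)
    finally show "ocp_cost f c g (Suc p) ?y ?v \<le> ocp_cost f c g (Suc p) y v" .
  qed
  then show ?case by blast
qed

lemma ex_backward_recursion: "\<exists>l :: nat \<Rightarrow> 'a. l p = a \<and> (\<forall>t<p. l t = F t (l (Suc t)))"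
proof -
  define l where "l t = rec_nat a (\<lambda>j. F (p - Suc j)) (p - t)" for t
  have "l t = F t (l (Suc t))" if "t < p" for t
  proof -
    have "p - t = Suc (p - Suc t)" "p - Suc (p - Suc t) = t" using that by auto
    then show ?thesis by (simp add: l_def)
  qed
  moreover have "l p = a" by (simp add: l_def)
  ultimately show ?thesis by blast
qed

text \<open>The multiplier is defined by its backward recursion, which leaves a defect
  \<open>s\<close> in the input equation only. Varying the inputs in the direction \<open>s\<close>
  itself is feasible, and by duality the derivative of the cost along it is the sum of squares of
  \<open>s\<close>; minimality makes it vanish.\<close>

lemma ocp_opt_kkt:
  assumes opt: "ocp_opt A B p f c g x \<zeta> y v"
    and gf: "\<And>t z. t < p \<Longrightarrow> GDERIV (f t) z :> gf t z"
    and gc: "\<And>t z. t < p \<Longrightarrow> GDERIV (c t) z :> gc t z"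
    and gT: "\<And>z. GDERIV g z :> gT z"
  shows "\<exists>l. kkt A B p gf gc gT x \<zeta> y v l"
proof -
  obtain l where lp: "l p = - gT (y p)"
    and l: "\<And>t. t < p \<Longrightarrow> l t = transpose A *v l (Suc t) - gf t (y t)"
    using ex_backward_recursion[of p "- gT (y p)" "\<lambda>t u. transpose A *v u - gf t (y t)"] by blast
  define s where "s t = gc t (v t) - transpose B *v l (Suc t)" for t
  define z where "z = rec_nat 0 (\<lambda>t z. A *v z + B *v s t)"
  have z: "z 0 = 0" "\<And>t. z (Suc t) = A *v z t + B *v s t" by (simp_all add: z_def)
  define \<phi> where "\<phi> e = ocp_cost f c g p (\<lambda>t. y t + e *\<^sub>R z t) (\<lambda>t. v t + e *\<^sub>R s t)" for e
  have tr: "trajectory A B p \<zeta> x y v" using opt by (simp add: ocp_opt_def)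
  have "trajectory A B p \<zeta> x (\<lambda>t. y t + e *\<^sub>R z t) (\<lambda>t. v t + e *\<^sub>R s t)" for e
    using tr z by (simp add: trajectory_def matrix_vector_right_distrib matrix_vector_mult_scaleR
        scaleR_add_right)
  then have min: "\<phi> 0 \<le> \<phi> e" for e using opt by (simp add: ocp_opt_def \<phi>_def)
  have "(\<phi> has_real_derivative
      ((\<Sum>t<p. gf t (y t) \<bullet> z t) + (\<Sum>t<p. gc t (v t) \<bullet> s t) + gT (y p) \<bullet> z p)) (at 0)"
    unfolding \<phi>_def ocp_cost_def
    by (intro DERIV_add DERIV_sum GDERIV_along_line) (simp_all add: gf gc gT)
  then have zero: "(\<Sum>t<p. gf t (y t) \<bullet> z t) + (\<Sum>t<p. gc t (v t) \<bullet> s t) + gT (y p) \<bullet> z p = 0"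
    by (rule DERIV_local_min[of _ _ _ 1]) (use min in auto)
  have "residual_system A B p z s l (\<lambda>t. if t < p then gf t (y t) else gT (y p)) (\<lambda>t. gc t (v t))
      (\<lambda>_. 0) s (\<lambda>_. 0)"
    by (simp add: residual_system_def z l lp s_def)
  from residual_system_duality[OF this] zero have "(\<Sum>t<p. s t \<bullet> s t) = 0" by simp
  then have "s t = 0" if "t < p" for t
    using that sum_nonneg_eq_0_iff[of "{..<p}" "\<lambda>t. s t \<bullet> s t"] by auto
  then have "gc t (v t) = transpose B *v l (Suc t)" if "t < p" for t using that by (simp add: s_def)
  then have "kkt A B p gf gc gT x \<zeta> y v l" using tr l lp by (simp add: kkt_def)
  then show ?thesis by blast
qed

subsection \<open>One step of the distributed controller\<close>

lemma norm_le_blocks: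
  fixes b :: "'n::finite \<Rightarrow> 'v::finite"
  assumes "\<And>i. norm (restrict_vec b {i} d) \<le> c" and "0 \<le> c"
  shows "norm d \<le> sqrt (real CARD('v)) * c"
proof -
  have "(norm d)\<^sup>2 = (\<Sum>i\<in>UNIV. (norm (restrict_vec b {i} d))\<^sup>2)" by (simp add: sum_blocks_norm)
  also have "\<dots> \<le> (\<Sum>i\<in>(UNIV :: 'v set). c\<^sup>2)" by (intro sum_mono power_mono assms) simp
  also have "\<dots> = (sqrt (real CARD('v)) * c)\<^sup>2" by (simp add: power_mult_distrib)
  finally show ?thesis by (rule power2_le_imp_le) (use assms(2) in simp)
qed

text \<open>
  Raising a common parameter from \<open>a\<close> to \<open>b\<close> and freezing each coordinate once its own parameter
  is reached avoids a factor depending on the dimension.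
\<close>

lemma norm_coordinatewise_parameter_le:
  fixes Z :: "real \<Rightarrow> real^'m::finite" and \<phi> :: "'m \<Rightarrow> real"
  assumes lip: "\<And>s t. a \<le> s \<Longrightarrow> s \<le> t \<Longrightarrow> t \<le> b \<Longrightarrow> norm (Z t - Z s) \<le> C * (t - s)"
    and \<phi>: "\<And>c. a \<le> \<phi> c" "\<And>c. \<phi> c \<le> b"
  shows "norm (\<chi> c. Z (\<phi> c) $ c - Z a $ c) \<le> C * (b - a)"
proof -
  define X where "X t = (\<chi> c. Z (min (\<phi> c) t) $ c)" for t
  have ab: "a \<le> b" using \<phi> order_trans by blast
  \<comment> \<open>Induction on the number of coordinates that freeze strictly between
    \<open>s\<close> and \<open>t\<close>. If there are none, each coordinate either follows
    \<open>Z\<close> or stands still; otherwise the interval is split at a freezing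
    parameter.\<close>
  have "norm (X t - X s) \<le> C * (t - s)" if "a \<le> s" "s \<le> t" "t \<le> b" for s t
    using that
  proof (induction "card {c. s < \<phi> c \<and> \<phi> c < t}" arbitrary: s t rule: less_induct)
    case less
    show ?case
    proof (cases "\<exists>c. s < \<phi> c \<and> \<phi> c < t")
      case False
      have "norm (X t - X s) \<le> norm (Z t - Z s)"
      proof (rule norm_le_componentwise_cart)
        fix c
        consider "\<phi> c \<le> s" | "t \<le> \<phi> c" using False by (meson not_le)
        then show "norm ((X t - X s) $ c) \<le> norm ((Z t - Z s) $ c)"
          using less.prems by cases (auto simp: X_def min_def)
      qed
      then show ?thesis using lip[OF less.prems] by simp
    next
      case True
      then obtain c where c: "s < \<phi> c" "\<phi> c < t" by blast
      have "norm (X t - X (\<phi> c)) \<le> C * (t - \<phi> c)"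
        using less.prems c \<phi> by (intro less.hyps psubset_card_mono) (auto intro!: psubsetI)
      moreover have "norm (X (\<phi> c) - X s) \<le> C * (\<phi> c - s)"
        using less.prems c \<phi> by (intro less.hyps psubset_card_mono) (auto intro!: psubsetI)
      moreover have "norm (X t - X s) \<le> norm (X t - X (\<phi> c)) + norm (X (\<phi> c) - X s)"
        by (metis diff_add_cancel add_diff_eq norm_triangle_ineq)
      ultimately show ?thesis by (simp add: algebra_simps)
    qed
  qed
  from this[of a b] have "norm (X b - X a) \<le> C * (b - a)" using ab by simp
  moreover have "X b - X a = (\<chi> c. Z (\<phi> c) $ c - Z a $ c)"
    using \<phi> by (auto simp: X_def vec_eq_iff min_def dest: order_antisym)
  ultimately show ?thesis by simp
qed

lemma sq_sum_le_sum_sq: "sq_sum n \<zeta> \<le> (\<Sum>t<n. norm (\<zeta> t))\<^sup>2"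
proof -
  have "sq_sum n \<zeta> = (L2_set (\<lambda>t. norm (\<zeta> t)) {..<n})\<^sup>2"
    by (simp add: sq_sum_def L2_set_def sum_nonneg)
  also have "\<dots> \<le> (\<Sum>t<n. norm (\<zeta> t))\<^sup>2"
    by (intro power_mono L2_set_le_sum) (auto simp: L2_set_nonneg)
  finally show ?thesis .
qed

text \<open>Gradients replace costs, and solutions of \<open>kkt\<close> replace minimizers. The
  terminal cost \<open>F\<close> survives as the factor \<open>\<phi>\<close> in
  \<open>agent_early\<close>, which may depend on agent and time. \<open>ex_kkt\<close> and
  \<open>ex_kkt_quadratic\<close> supply the solutions to compare with.\<close>

locale closed_loop = network E bx bu A B L J \<mu>
  for E :: "('v::finite \<times> 'v) set" and bx :: "'n::finite \<Rightarrow> 'v" and bu :: "'m::finite \<Rightarrow> 'v"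
    and A :: "real^'n^'n" and B :: "real^'m^'n" and L J \<mu> :: real +
  fixes T k \<kappa> :: nat and gf :: "nat \<Rightarrow> real^'n \<Rightarrow> real^'n" and gc :: "nat \<Rightarrow> real^'m \<Rightarrow> real^'m"
    and w x :: "nat \<Rightarrow> real^'n" and u :: "nat \<Rightarrow> real^'m" and D :: real
  assumes gf: "\<And>t. t \<le> T \<Longrightarrow> block_gradient bx \<mu> L (gf t)"
    and gc: "\<And>t. 1 \<le> t \<Longrightarrow> t \<le> T \<Longrightarrow> block_gradient bu \<mu> L (gc t)"
    and ex_kkt: "\<And>t p z \<zeta>. t + p \<le> T \<Longrightarrow>
      \<exists>y v l. kkt A B p (\<lambda>\<tau>. gf (t + \<tau>)) (\<lambda>\<tau>. gc (Suc (t + \<tau>))) (gf (t + p)) z \<zeta> y v l"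
    and ex_kkt_quadratic: "\<And>t p z \<zeta> \<phi>. t + p \<le> T \<Longrightarrow> \<mu> \<le> \<phi> \<Longrightarrow> \<phi> \<le> L \<Longrightarrow>
      \<exists>y v l. kkt A B p (\<lambda>\<tau>. gf (t + \<tau>)) (\<lambda>\<tau>. gc (Suc (t + \<tau>))) (\<lambda>y. \<phi> *\<^sub>R y) z \<zeta> y v l"
    and dual_trunc: "\<And>i. dual_bound J (restrict_rows bx (nbhd_upto E \<kappa> i) A) (restrict_rows bx (nbhd_upto E \<kappa> i) B)"
    and traj: "\<And>t. t < T \<Longrightarrow> x (Suc t) = A *v x t + B *v u t + w t"
    and k_pos: "0 < k" and k_le: "k \<le> T"
    and window: "\<And>t. t \<le> T - k \<Longrightarrow> (\<Sum>\<tau><k. norm (w (t + \<tau>))) \<le> D"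
    and agent_early: "\<And>t i. t + k < T \<Longrightarrow> \<exists>\<phi> y v l. \<mu> \<le> \<phi> \<and> \<phi> \<le> L \<and>
      kkt (restrict_rows bx (nbhd_upto E \<kappa> i) A) (restrict_rows bx (nbhd_upto E \<kappa> i) B) k
        (\<lambda>\<tau>. gf (t + \<tau>)) (\<lambda>\<tau>. gc (Suc (t + \<tau>))) (\<lambda>y. \<phi> *\<^sub>R y) (restrict_vec bx (nbhd_upto E \<kappa> i) (x t))
        (\<lambda>\<tau>. restrict_vec bx (nbhd_upto E \<kappa> i) (w (t + \<tau>))) y v l \<and>
      restrict_vec bu {i} (u t) = restrict_vec bu {i} (v 0)"
    and agent_late: "\<And>t i. t < T \<Longrightarrow> T \<le> t + k \<Longrightarrow> \<exists>y v l.
      kkt (restrict_rows bx (nbhd_upto E \<kappa> i) A) (restrict_rows bx (nbhd_upto E \<kappa> i) B) (T - t)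
        (\<lambda>\<tau>. gf (t + \<tau>)) (\<lambda>\<tau>. gc (Suc (t + \<tau>))) (gf T) (restrict_vec bx (nbhd_upto E \<kappa> i) (x t))
        (\<lambda>\<tau>. restrict_vec bx (nbhd_upto E \<kappa> i) (w (t + \<tau>))) y v l \<and>
      restrict_vec bu {i} (u t) = restrict_vec bu {i} (v 0)"
begin

text \<open>Relative error of the input in one step. The square root of the number of nodes arises
  from adding the agents' errors over blocks, and 108 = 4 + 104 collects the constants in
  \<open>step_error_early\<close>.\<close>

definition "\<epsilon> = 108 * K * G\<^sup>2 * (sqrt (real CARD('v)) * \<theta> ^ \<kappa> + \<theta> ^ k)"

lemma D_nonneg: "0 \<le> D"
proof -
  have "0 \<le> (\<Sum>\<tau><k. norm (w (0 + \<tau>)))" by (intro sum_nonneg) auto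
  also have "\<dots> \<le> D" by (rule window) simp
  finally show ?thesis .
qed

lemma window_le:
  assumes "t + p \<le> T" "p \<le> k"
  shows "(\<Sum>\<tau><p. norm (w (t + \<tau>))) \<le> D"
proof -
  \<comment> \<open>Bounds are given for full windows starting no later than \<open>T - k\<close>; a
    shorter window near the end lies inside the last of them.\<close>
  define t' where "t' = min t (T - k)"
  have "(\<Sum>\<tau><p. norm (w (t + \<tau>))) = (\<Sum>\<tau>\<in>{t - t'..<t - t' + p}. norm (w (t' + \<tau>)))"
    by (rule sum.reindex_bij_witness[of _ "\<lambda>\<tau>. \<tau> - (t - t')" "\<lambda>\<tau>. \<tau> + (t - t')"]) (auto simp: t'_def add.commute)
  also have "\<dots> \<le> (\<Sum>\<tau><k. norm (w (t' + \<tau>)))"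
    using assms k_le by (intro sum_mono2) (auto simp: t'_def)
  also have "\<dots> \<le> D" by (rule window) (simp add: t'_def)
  finally show ?thesis .
qed

lemma norm_w_le: "t < T \<Longrightarrow> norm (w t) \<le> D"
  using window_le[of t 1] k_pos by simp

lemma window_sq_le: "t + p \<le> T \<Longrightarrow> p \<le> k \<Longrightarrow> sq_sum p (\<lambda>\<tau>. w (t + \<tau>)) \<le> D\<^sup>2"
  by (rule order_trans[OF sq_sum_le_sum_sq]) (intro power_mono window_le, auto intro: sum_nonneg)

lemma theta_eq: "\<theta> = 6 * G / (6 * G + 1)"
  using G_ge by (simp add: \<theta>_def \<beta>_def field_simps)

lemma decay_constant_le: "2 / (1 - \<theta>) \<le> 13 * G"
proof -
  have "1 - \<theta> = 1 / (6 * G + 1)" unfolding theta_eq using G_ge by (simp add: field_simps)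
  then show ?thesis using G_ge by simp
qed

abbreviation "full_solution t \<equiv>
  kkt A B (T - t) (\<lambda>\<tau>. gf (t + \<tau>)) (\<lambda>\<tau>. gc (Suc (t + \<tau>))) (gf T) (x t) (\<lambda>\<tau>. w (t + \<tau>))"

lemma truncation_error:
  fixes i :: 'v
  defines "S \<equiv> nbhd_upto E \<kappa> i"
  assumes "0 < p" "p \<le> k" "t + p \<le> T"
    and "kkt A B p (\<lambda>\<tau>. gf (t + \<tau>)) (\<lambda>\<tau>. gc (Suc (t + \<tau>))) gT (x t) (\<lambda>\<tau>. w (t + \<tau>)) y v l"
    and "kkt (restrict_rows bx S A) (restrict_rows bx S B) p (\<lambda>\<tau>. gf (t + \<tau>)) (\<lambda>\<tau>. gc (Suc (t + \<tau>))) gT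
        (restrict_vec bx S (x t)) (\<lambda>\<tau>. restrict_vec bx S (w (t + \<tau>))) y' v' l'"
    and "block_gradient bx \<mu> L gT"
  shows "norm (restrict_vec bu {i} (v' 0 - v 0)) \<le> 4 * K * G * \<theta> ^ \<kappa> * (norm (x t) + D)"
proof -
  have "(norm (restrict_vec bu {i} (v' 0 - v 0)))\<^sup>2
      \<le> 16 * K\<^sup>2 * G\<^sup>2 * (\<theta> ^ (\<kappa> + 1))\<^sup>2 * ((norm (x t))\<^sup>2 + sq_sum p (\<lambda>\<tau>. w (t + \<tau>)))"
    unfolding S_def by (rule kkt_truncation[OF assms(5,6)[unfolded S_def] dual_trunc _ _ assms(7,2)])
      (use assms gf gc in auto)
  also have "\<dots> \<le> 16 * K\<^sup>2 * G\<^sup>2 * (\<theta> ^ \<kappa>)\<^sup>2 * (norm (x t) + D)\<^sup>2"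
  proof (intro mult_mono power_mono)
    show "\<theta> ^ (\<kappa> + 1) \<le> \<theta> ^ \<kappa>" using theta_pos theta_lt by (simp add: mult_left_le_one_le)
    have "(norm (x t))\<^sup>2 + sq_sum p (\<lambda>\<tau>. w (t + \<tau>)) \<le> (norm (x t))\<^sup>2 + D\<^sup>2"
      using window_sq_le assms by simp
    also have "\<dots> \<le> (norm (x t) + D)\<^sup>2" using D_nonneg by (simp add: power2_sum)
    finally show "(norm (x t))\<^sup>2 + sq_sum p (\<lambda>\<tau>. w (t + \<tau>)) \<le> (norm (x t) + D)\<^sup>2" .
  qed (use theta_pos K_pos G_ge in auto)
  also have "\<dots> = (4 * K * G * \<theta> ^ \<kappa> * (norm (x t) + D))\<^sup>2" by (simp add: power_mult_distrib)
  finally show ?thesis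
    by (rule power2_le_imp_le) (use K_pos G_ge theta_pos D_nonneg in simp)
qed

text \<open>
  Since \<open>F\<close> is radial, agent \<open>i\<close> in effect uses the terminal gradient \<open>\<phi>\<^sub>i *\<^sub>R y\<close>. Its input is
  compared with the centralized solution for that quadratic terminal cost (spatial decay), the
  latter with the one for \<open>\<phi> = \<mu>\<close>, and finally with the solution up to time \<open>T\<close> (temporal decay).
\<close>

lemma step_error_early:
  assumes early: "t + k < T" and full: "full_solution t Y V \<Lambda>"
  shows "norm (u t - V 0) \<le> \<epsilon> * (norm (x t) + D)"
proof -
  define X where "X = norm (x t) + D"
  have X0: "0 \<le> X" using D_nonneg by (simp add: X_def)
  have tk: "t + k \<le> T" using early by simp
  have grf: "block_gradient bx \<mu> L (gf (t + \<tau>))" if "\<tau> < k" for \<tau> using gf that early by simp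
  have grc: "block_gradient bu \<mu> L (gc (Suc (t + \<tau>)))" if "\<tau> < k" for \<tau> using gc that early by simp
  have grq: "block_gradient bx \<mu> L (\<lambda>y. \<phi> *\<^sub>R y)" if "\<mu> \<le> \<phi>" "\<phi> \<le> L" for \<phi>
    using that mu_pos by (intro block_gradient_scaleR) auto
  let ?kkt = "\<lambda>gT. kkt A B k (\<lambda>\<tau>. gf (t + \<tau>)) (\<lambda>\<tau>. gc (Suc (t + \<tau>))) gT (x t) (\<lambda>\<tau>. w (t + \<tau>))"
  have "\<forall>\<phi>. \<exists>y v l. \<mu> \<le> \<phi> \<longrightarrow> \<phi> \<le> L \<longrightarrow> ?kkt (\<lambda>y. \<phi> *\<^sub>R y) y v l"
    using ex_kkt_quadratic[OF tk] by blast
  then obtain ys vs ls where q: "\<And>\<phi>. \<mu> \<le> \<phi> \<Longrightarrow> \<phi> \<le> L \<Longrightarrow> ?kkt (\<lambda>y. \<phi> *\<^sub>R y) (ys \<phi>) (vs \<phi>) (ls \<phi>)"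
    by metis
  obtain \<Phi> y' v' l' where ag: "\<And>i. \<mu> \<le> \<Phi> i" "\<And>i. \<Phi> i \<le> L"
    "\<And>i. kkt (restrict_rows bx (nbhd_upto E \<kappa> i) A) (restrict_rows bx (nbhd_upto E \<kappa> i) B) k
        (\<lambda>\<tau>. gf (t + \<tau>)) (\<lambda>\<tau>. gc (Suc (t + \<tau>))) (\<lambda>y. \<Phi> i *\<^sub>R y) (restrict_vec bx (nbhd_upto E \<kappa> i) (x t))
        (\<lambda>\<tau>. restrict_vec bx (nbhd_upto E \<kappa> i) (w (t + \<tau>))) (y' i) (v' i) (l' i)"
    "\<And>i. restrict_vec bu {i} (u t) = restrict_vec bu {i} (v' i 0)"
    using agent_early[OF early] by metis
  define Z where "Z \<phi> = vs \<phi> 0" for \<phi>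
  \<comment> \<open>Each coordinate is compared with the centralized input for the factor of its own
    agent: \<open>d1\<close> is the error of the spatial truncation, \<open>d2\<close> the error
    from agents having different factors.\<close>
  define d1 where "d1 = (\<chi> c. u t $ c - Z (\<Phi> (bu c)) $ c)"
  define d2 where "d2 = (\<chi> c. Z (\<Phi> (bu c)) $ c - Z \<mu> $ c)"
  have "norm d1 \<le> sqrt (real CARD('v)) * (4 * K * G * \<theta> ^ \<kappa> * X)"
  proof (rule norm_le_blocks)
    fix i
    have "restrict_vec bu {i} d1 = restrict_vec bu {i} (u t) - restrict_vec bu {i} (Z (\<Phi> i))"
      by (auto simp: d1_def vec_eq_iff)
    also have "\<dots> = restrict_vec bu {i} (v' i 0 - vs (\<Phi> i) 0)"
      by (simp add: ag(4) Z_def restrict_vec_diff)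
    also have "norm \<dots> \<le> 4 * K * G * \<theta> ^ \<kappa> * X"
      unfolding X_def
      by (rule truncation_error[OF k_pos order_refl tk q[OF ag(1,2)] ag(3) grq[OF ag(1,2)]])
    finally show "norm (restrict_vec bu {i} d1) \<le> 4 * K * G * \<theta> ^ \<kappa> * X" .
  qed (use K_pos G_ge theta_pos X0 in simp)
  moreover have "norm d2 \<le> 4 * K * G * \<theta> ^ k * X"
  proof -
    have "norm d2 \<le> (4 * K\<^sup>2 * \<theta> ^ k * X) * (L - \<mu>)"
      unfolding d2_def
    proof (rule norm_coordinatewise_parameter_le)
      fix r s assume rs: "\<mu> \<le> r" "r \<le> s" "s \<le> L"
      have r: "\<mu> \<le> r" "r \<le> L" and s: "\<mu> \<le> s" "s \<le> L" using rs by auto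
      have "(norm (ys r k))\<^sup>2 \<le> energy k (ys r) (vs r) (ls r)"
        using norm_sq_le_sq_sum[of k "Suc k" "ys r"] by (simp add: energy_def add_increasing2)
      also have "\<dots> \<le> 4 * K\<^sup>2 * ((norm (x t))\<^sup>2 + sq_sum k (\<lambda>\<tau>. w (t + \<tau>)))"
        by (rule kkt_bound[OF q[OF r] grf grc grq[OF r]])
      also have "\<dots> \<le> 4 * K\<^sup>2 * ((norm (x t))\<^sup>2 + D\<^sup>2)"
        using window_sq_le[OF tk] by (intro mult_left_mono add_mono) auto
      also have "\<dots> \<le> (2 * K * X)\<^sup>2"
        using D_nonneg by (simp add: X_def power_mult_distrib power2_sum mult_left_mono)
      finally have yr: "norm (ys r k) \<le> 2 * K * X"
        by (rule power2_le_imp_le) (use K_pos X0 in simp)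
      have "norm (Z s - Z r) \<le> 2 * K * \<theta> ^ k * norm (r *\<^sub>R ys r k - s *\<^sub>R ys r k)"
        unfolding Z_def by (rule kkt_terminal_perturbation[OF q[OF s] q[OF r] grf grc grq[OF s] k_pos])
      also have "\<dots> = 2 * K * \<theta> ^ k * ((s - r) * norm (ys r k))"
        using rs by (simp flip: scaleR_diff_left)
      also have "\<dots> \<le> 2 * K * \<theta> ^ k * ((s - r) * (2 * K * X))"
        using K_pos theta_pos rs yr by (intro mult_left_mono) auto
      finally show "norm (Z s - Z r) \<le> 4 * K\<^sup>2 * \<theta> ^ k * X * (s - r)"
        by (simp add: power2_eq_square mult_ac)
    qed (use ag in auto)
    also have "\<dots> \<le> (4 * K\<^sup>2 * \<theta> ^ k * X) * L"
      using K_pos theta_pos X0 mu_pos by (intro mult_left_mono) auto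
    also have "\<dots> = 4 * K * G * \<theta> ^ k * X" by (simp add: G_def power2_eq_square)
    finally show ?thesis .
  qed
  moreover have "norm (Z \<mu> - V 0) \<le> 104 * K * G\<^sup>2 * \<theta> ^ k * X"
  proof -
    \<comment> \<open>Stopped at time \<open>k\<close>, the solution up to \<open>T\<close> solves
      the problem of horizon \<open>k\<close> with the constant terminal gradient
      \<open>- \<Lambda> k\<close>.\<close>
    have kkt': "?kkt (\<lambda>_. - \<Lambda> k) Y V \<Lambda>"
      using full early by (auto simp: kkt_def trajectory_def)
    have "norm (Z \<mu> - V 0) \<le> 2 * K * \<theta> ^ k * norm (- \<Lambda> k - \<mu> *\<^sub>R Y k)"
      unfolding Z_def
      by (rule kkt_terminal_perturbation[OF q[OF order_refl mu_le] kkt' grf grc grq[OF order_refl mu_le] k_pos])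
    also have "norm (- \<Lambda> k - \<mu> *\<^sub>R Y k) \<le> 52 * G\<^sup>2 * X"
    proof -
      \<comment> \<open>The horizon of \<open>Y\<close> is T - t, so a bound on its total energy
        would grow with \<open>T\<close>; the bound at the single time \<open>k\<close> does
        not.\<close>
      have "(norm (Y k))\<^sup>2 + (norm (\<Lambda> k))\<^sup>2 \<le> 4 * K\<^sup>2 * ((norm (x t))\<^sup>2 + D\<^sup>2 * (2 / (1 - \<theta>)))"
        by (rule kkt_bound_at[OF full]) (use gf gc early norm_w_le in auto)
      also have "\<dots> \<le> 4 * K\<^sup>2 * ((13 * G)\<^sup>2 * X\<^sup>2)"
      proof (intro mult_left_mono)
        have "1 \<le> 13 * G" using G_ge by simp
        then have g: "13 * G \<le> (13 * G)\<^sup>2" "1 \<le> (13 * G)\<^sup>2"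
          using self_le_power[of "13 * G" 2] one_le_power[of "13 * G" 2] by simp_all
        have "(norm (x t))\<^sup>2 + D\<^sup>2 * (2 / (1 - \<theta>)) \<le> (13 * G)\<^sup>2 * (norm (x t))\<^sup>2 + D\<^sup>2 * (13 * G)\<^sup>2"
        proof (intro add_mono mult_left_mono)
          show "(norm (x t))\<^sup>2 \<le> (13 * G)\<^sup>2 * (norm (x t))\<^sup>2"
            using mult_right_mono[OF g(2), of "(norm (x t))\<^sup>2"] by simp
          show "2 / (1 - \<theta>) \<le> (13 * G)\<^sup>2" using decay_constant_le g(1) by (rule order_trans)
        qed simp
        also have "\<dots> = (13 * G)\<^sup>2 * ((norm (x t))\<^sup>2 + D\<^sup>2)" by (simp add: algebra_simps)
        also have "\<dots> \<le> (13 * G)\<^sup>2 * X\<^sup>2"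
          using D_nonneg by (intro mult_left_mono) (simp_all add: X_def power2_sum)
        finally show "(norm (x t))\<^sup>2 + D\<^sup>2 * (2 / (1 - \<theta>)) \<le> (13 * G)\<^sup>2 * X\<^sup>2" .
      qed simp
      also have "\<dots> = (26 * K * G * X)\<^sup>2" by (simp add: power_mult_distrib)
      finally have le: "(norm (Y k))\<^sup>2 + (norm (\<Lambda> k))\<^sup>2 \<le> (26 * K * G * X)\<^sup>2" .
      have nn: "0 \<le> 26 * K * G * X" using K_pos G_ge X0 by simp
      have 1: "norm (Y k) \<le> 26 * K * G * X"
        by (rule power2_le_imp_le[OF _ nn]) (use le zero_le_power2[of "norm (\<Lambda> k)"] in linarith)
      have 2: "norm (\<Lambda> k) \<le> 26 * K * G * X"
        by (rule power2_le_imp_le[OF _ nn]) (use le zero_le_power2[of "norm (Y k)"] in linarith)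
      have "norm (- \<Lambda> k - \<mu> *\<^sub>R Y k) \<le> norm (\<Lambda> k) + \<mu> * norm (Y k)"
        using norm_triangle_ineq4[of "- \<Lambda> k" "\<mu> *\<^sub>R Y k"] mu_pos by simp
      also have "\<dots> \<le> L * (26 * K * G * X) + L * (26 * K * G * X)"
      proof (intro add_mono)
        have "1 * (26 * K * G * X) \<le> L * (26 * K * G * X)" using L_ge nn by (rule mult_right_mono)
        then show "norm (\<Lambda> k) \<le> L * (26 * K * G * X)" using 2 by simp
        show "\<mu> * norm (Y k) \<le> L * (26 * K * G * X)"
          using mu_le 1 L_pos by (intro mult_mono) auto
      qed
      also have "\<dots> = 52 * G\<^sup>2 * X" by (simp add: G_def power2_eq_square)
      finally show ?thesis .
    qed
    finally show ?thesis using K_pos theta_pos by (simp add: mult_left_mono mult_ac)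
  qed
  moreover have "norm (u t - V 0) \<le> norm d1 + norm d2 + norm (Z \<mu> - V 0)"
  proof -
    have "u t - V 0 = d1 + d2 + (Z \<mu> - V 0)" by (simp add: d1_def d2_def vec_eq_iff)
    then show ?thesis by (metis norm_triangle_ineq norm_triangle_le add_right_mono order_trans)
  qed
  ultimately have "norm (u t - V 0)
      \<le> sqrt (real CARD('v)) * (4 * K * G * \<theta> ^ \<kappa> * X) + 4 * K * G * \<theta> ^ k * X + 104 * K * G\<^sup>2 * \<theta> ^ k * X" by linarith
  also have "\<dots> = (4 * (K * G)) * (sqrt (real CARD('v)) * \<theta> ^ \<kappa> * X) + (4 * (K * G) + 104 * (K * G\<^sup>2)) * (\<theta> ^ k * X)"
    by (simp add: algebra_simps)
  also have "\<dots> \<le> (108 * (K * G\<^sup>2)) * (sqrt (real CARD('v)) * \<theta> ^ \<kappa> * X) + (108 * (K * G\<^sup>2)) * (\<theta> ^ k * X)"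
  proof -
    have "K * G \<le> K * G\<^sup>2" using G_ge K_pos by (simp add: power2_eq_square)
    moreover have "0 \<le> K * G\<^sup>2" using K_pos by simp
    ultimately have "4 * (K * G) \<le> 108 * (K * G\<^sup>2)" "4 * (K * G) + 104 * (K * G\<^sup>2) \<le> 108 * (K * G\<^sup>2)"
      by linarith+
    then show ?thesis using theta_pos X0 by (intro add_mono mult_right_mono) auto
  qed
  finally show ?thesis by (simp add: \<epsilon>_def X_def algebra_simps)
qed

text \<open>Near the end, horizon and terminal cost of the agents agree with those of the
  continuation to \<open>T\<close>, so spatial truncation is the only source of error.\<close>

lemma step_error_late:
  assumes late: "t < T" "T \<le> t + k" and full: "full_solution t Y V \<Lambda>"
  shows "norm (u t - V 0) \<le> \<epsilon> * (norm (x t) + D)"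
proof -
  define X where "X = norm (x t) + D"
  have X0: "0 \<le> X" using D_nonneg by (simp add: X_def)
  have p: "0 < T - t" "T - t \<le> k" "t + (T - t) \<le> T" using late by auto
  have "norm (u t - V 0) \<le> sqrt (real CARD('v)) * (4 * K * G * \<theta> ^ \<kappa> * X)"
  proof (rule norm_le_blocks)
    fix i
    obtain y v l where ag: "kkt (restrict_rows bx (nbhd_upto E \<kappa> i) A) (restrict_rows bx (nbhd_upto E \<kappa> i) B) (T - t)
        (\<lambda>\<tau>. gf (t + \<tau>)) (\<lambda>\<tau>. gc (Suc (t + \<tau>))) (gf T) (restrict_vec bx (nbhd_upto E \<kappa> i) (x t))
        (\<lambda>\<tau>. restrict_vec bx (nbhd_upto E \<kappa> i) (w (t + \<tau>))) y v l"
      "restrict_vec bu {i} (u t) = restrict_vec bu {i} (v 0)"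
      using agent_late[OF late] by blast
    have "restrict_vec bu {i} (u t - V 0) = restrict_vec bu {i} (v 0 - V 0)"
      by (simp add: ag(2) restrict_vec_diff)
    also have "norm \<dots> \<le> 4 * K * G * \<theta> ^ \<kappa> * X"
      unfolding X_def by (rule truncation_error[OF p full ag(1) gf[OF order_refl]])
    finally show "norm (restrict_vec bu {i} (u t - V 0)) \<le> 4 * K * G * \<theta> ^ \<kappa> * X" .
  qed (use K_pos G_ge theta_pos X0 in simp)
  also have "\<dots> = 4 * (K * G) * (sqrt (real CARD('v)) * \<theta> ^ \<kappa> * X)" by (simp add: algebra_simps)
  also have "\<dots> \<le> 108 * (K * G\<^sup>2) * ((sqrt (real CARD('v)) * \<theta> ^ \<kappa> + \<theta> ^ k) * X)"
  proof -
    have "K * G \<le> K * G\<^sup>2" using G_ge K_pos by (simp add: power2_eq_square)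
    moreover have "0 \<le> K * G\<^sup>2" using K_pos by simp
    ultimately have "4 * (K * G) \<le> 108 * (K * G\<^sup>2)" by linarith
    moreover have "sqrt (real CARD('v)) * \<theta> ^ \<kappa> * X \<le> (sqrt (real CARD('v)) * \<theta> ^ \<kappa> + \<theta> ^ k) * X"
      using theta_pos X0 by (intro mult_right_mono) auto
    ultimately show ?thesis using theta_pos X0 K_pos by (intro mult_mono[of "4 * (K * G)"]) auto
  qed
  finally show ?thesis by (simp add: \<epsilon>_def X_def algebra_simps)
qed

lemma step_error:
  assumes "t < T" and "full_solution t Y V \<Lambda>"
  shows "norm (u t - V 0) \<le> \<epsilon> * (norm (x t) + D)"
  using assms step_error_early step_error_late by (metis not_le)

end

section \<open>The closed loop as a perturbed optimality system\<close>

lemma residual_system_diff: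
  assumes "residual_system A B p y v l g h r s q" and "residual_system A B p y' v' l' g' h' r' s' q'"
  shows "residual_system A B p (\<lambda>t. y t - y' t) (\<lambda>t. v t - v' t) (\<lambda>t. l t - l' t) (\<lambda>t. g t - g' t)
    (\<lambda>t. h t - h' t) (\<lambda>t. r t - r' t) (\<lambda>t. s t - s' t) (\<lambda>t. q t - q' t)"
proof -
  have "g t - g' t + (l t - l' t) = transpose A *v (l (Suc t) - l' (Suc t)) + (r t - r' t)" if "t < p" for t
  proof -
    have "(g t + l t) - (g' t + l' t)
        = (transpose A *v l (Suc t) + r t) - (transpose A *v l' (Suc t) + r' t)"
      using assms that by (simp add: residual_system_def)
    then show ?thesis by (simp add: matrix_vector_mult_diff_distrib algebra_simps)
  qed
  moreover have "g p - g' p + (l p - l' p) = r p - r' p"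
  proof -
    have "(g p + l p) - (g' p + l' p) = r p - r' p" using assms by (simp add: residual_system_def)
    then show ?thesis by (simp add: algebra_simps)
  qed
  ultimately show ?thesis
    using assms by (simp add: residual_system_def matrix_vector_mult_diff_distrib)
qed

context closed_loop
begin

text \<open>Bellman's principle for multipliers. It allows consecutive continuations to be compared,
  one starting in the predicted state \<open>Y 1\<close>, the other in the state actually
  reached.\<close>

lemma full_solution_tail:
  assumes "t < T" and full: "full_solution t Y V \<Lambda>"
  shows "kkt A B (T - Suc t) (\<lambda>\<tau>. gf (Suc t + \<tau>)) (\<lambda>\<tau>. gc (Suc (Suc t + \<tau>))) (gf T) (Y 1)
    (\<lambda>\<tau>. w (Suc t + \<tau>)) (\<lambda>\<tau>. Y (Suc \<tau>)) (\<lambda>\<tau>. V (Suc \<tau>)) (\<lambda>\<tau>. \<Lambda> (Suc \<tau>))"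
proof -
  have T: "T - t = Suc (T - Suc t)" using assms by simp
  show ?thesis using full unfolding kkt_def trajectory_def T by auto
qed

text \<open>
  The closed loop solves the optimality system of the whole horizon up to small residuals, with
  the multiplier at time \<open>t + 1\<close> taken from the optimal continuation starting in \<open>x t\<close>.
\<close>

lemma closed_loop_residuals:
  "\<exists>l r s. residual_system A B T x u l (\<lambda>t. gf t (x t)) (\<lambda>t. gc (Suc t) (u t)) r s (state_defect (x 0) w) \<and>
     r 0 = 0 \<and> (\<forall>t<T. norm (r (Suc t)) \<le> 2 * G * \<epsilon> * (norm (x t) + D)) \<and>
     (\<forall>t<T. norm (s t) \<le> G * \<epsilon> * (norm (x t) + D))"
proof -
  have "\<forall>t. \<exists>Y V \<Lambda>. t \<le> T \<longrightarrow> full_solution t Y V \<Lambda>"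
  proof
    fix t
    show "\<exists>Y V \<Lambda>. t \<le> T \<longrightarrow> full_solution t Y V \<Lambda>"
      using ex_kkt[of t "T - t" "x t" "\<lambda>\<tau>. w (t + \<tau>)"] by (cases "t \<le> T") auto
  qed
  then obtain Y V \<Lambda> where full: "\<And>t. t \<le> T \<Longrightarrow> full_solution t (Y t) (V t) (\<Lambda> t)" by metis
  \<comment> \<open>At time 0 there is no earlier continuation; the choice
    \<open>\<Lambda> 0 0\<close> makes \<open>r 0\<close> vanish.\<close>
  define l where "l t = (case t of 0 \<Rightarrow> \<Lambda> 0 0 | Suc s \<Rightarrow> \<Lambda> s 1)" for t
  define r where "r t = l t - \<Lambda> t 0" for t
  define s where "s t = gc (Suc t) (u t) - gc (Suc t) (V t 0)" for t
  have Y0: "Y t 0 = x t" if "t \<le> T" for t using full[OF that] by (simp add: kkt_def trajectory_def)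
  have at0: "gf t (x t) + \<Lambda> t 0 = transpose A *v \<Lambda> t 1" "gc (Suc t) (V t 0) = transpose B *v \<Lambda> t 1"
    if "t < T" for t
  proof -
    have "0 < T - t" using that by simp
    moreover have "\<forall>\<tau><T - t. gf (t + \<tau>) (Y t \<tau>) + \<Lambda> t \<tau> = transpose A *v \<Lambda> t (Suc \<tau>)"
      "\<forall>\<tau><T - t. gc (Suc (t + \<tau>)) (V t \<tau>) = transpose B *v \<Lambda> t (Suc \<tau>)"
      using full[OF less_imp_le[OF that]] by (simp_all add: kkt_def)
    ultimately have "gf (t + 0) (Y t 0) + \<Lambda> t 0 = transpose A *v \<Lambda> t (Suc 0)"
      "gc (Suc (t + 0)) (V t 0) = transpose B *v \<Lambda> t (Suc 0)"
      by blast+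
    then show "gf t (x t) + \<Lambda> t 0 = transpose A *v \<Lambda> t 1" "gc (Suc t) (V t 0) = transpose B *v \<Lambda> t 1"
      using Y0[of t] that by simp_all
  qed
  have atT: "gf T (x T) + \<Lambda> T 0 = 0" using full[of T] Y0[of T] by (simp add: kkt_def)
  have sys: "residual_system A B T x u l (\<lambda>t. gf t (x t)) (\<lambda>t. gc (Suc t) (u t)) r s (state_defect (x 0) w)"
    unfolding residual_system_def
  proof (intro conjI allI impI)
    show "gf T (x T) + l T = r T" using atT by (simp add: r_def eq_neg_iff_add_eq_0 algebra_simps)
    fix t assume t: "t < T"
    show "x (Suc t) = A *v x t + B *v u t + state_defect (x 0) w (Suc t)" using traj[OF t] by simp
    show "gf t (x t) + l t = transpose A *v l (Suc t) + r t"
      using at0(1)[OF t] by (simp add: l_def r_def) (metis add.commute add_diff_cancel_right' diff_add_eq)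
    show "gc (Suc t) (u t) = transpose B *v l (Suc t) + s t"
      using at0(2)[OF t] by (simp add: l_def s_def)
  qed simp
  have err: "norm (u t - V t 0) \<le> \<epsilon> * (norm (x t) + D)" if "t < T" for t
    using step_error[OF that full] that by simp
  have "norm (r (Suc t)) \<le> 2 * G * \<epsilon> * (norm (x t) + D)" if t: "t < T" for t
  proof -
    \<comment> \<open>The residual is the difference of two multipliers for time t + 1, from the
      continuation of \<open>x t\<close> and from the one restarted in \<open>x (Suc t)\<close>. The
      states they start from differ by \<open>B\<close> times the input error.\<close>
    have "norm (r (Suc t)) = norm (\<Lambda> t (Suc 0) - \<Lambda> (Suc t) 0)" by (simp add: r_def l_def)
    also have "\<dots> \<le> 2 * K * norm (Y t 1 - x (Suc t))"
      using kkt_initial_perturbation[OF full_solution_tail[OF t full] full] t gf gc by simp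
    also have "Y t 1 - x (Suc t) = B *v (V t 0 - u t)"
    proof -
      have "0 < T - t" using t by simp
      then have "Y t (Suc 0) = A *v Y t 0 + B *v V t 0 + w (t + 0)"
        using full[of t] t unfolding kkt_def trajectory_def by (metis less_imp_le)
      then show ?thesis using Y0[of t] t traj[OF t] by (simp add: matrix_vector_mult_diff_distrib)
    qed
    also have "2 * K * norm (B *v (V t 0 - u t)) \<le> 2 * K * (L * (\<epsilon> * (norm (x t) + D)))"
    proof (intro mult_left_mono)
      have "norm (B *v (V t 0 - u t)) \<le> L * norm (u t - V t 0)"
        using norm_B[of "V t 0 - u t"] by (simp add: norm_minus_commute)
      also have "\<dots> \<le> L * (\<epsilon> * (norm (x t) + D))" using err[OF t] L_pos by (intro mult_left_mono) auto
      finally show "norm (B *v (V t 0 - u t)) \<le> L * (\<epsilon> * (norm (x t) + D))" .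
    qed (use K_pos in simp)
    finally show ?thesis by (simp add: G_def mult_ac)
  qed
  moreover have "norm (s t) \<le> G * \<epsilon> * (norm (x t) + D)" if t: "t < T" for t
  proof -
    have "norm (s t) \<le> L * norm (u t - V t 0)"
      unfolding s_def by (rule block_gradient_lipschitz[OF gc]) (use t L_pos in auto)
    also have "\<dots> \<le> G * (\<epsilon> * (norm (x t) + D))"
      using err[OF t] L_le_G L_pos by (intro mult_mono) auto
    finally show ?thesis by (simp add: mult.assoc)
  qed
  moreover have "r 0 = 0" by (simp add: r_def l_def)
  ultimately show ?thesis using sys by blast
qed

lemma epsilon_nonneg: "0 \<le> \<epsilon>"
  using K_pos theta_pos by (simp add: \<epsilon>_def)

lemma residual_energy_le:
  assumes r0: "r 0 = 0" and r: "\<And>t. t < T \<Longrightarrow> norm (r (Suc t)) \<le> 2 * G * \<epsilon> * (norm (x t) + D)"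
    and s: "\<And>t. t < T \<Longrightarrow> norm (s t) \<le> G * \<epsilon> * (norm (x t) + D)"
    and \<omega>: "\<And>t. 0 < \<omega> t" "\<And>t. t < T \<Longrightarrow> \<omega> (Suc t) = \<omega> t \<or> \<omega> (Suc t) = \<beta> * \<omega> t \<or> \<beta> * \<omega> (Suc t) = \<omega> t"
  shows "sq_sum (Suc T) (\<lambda>t. \<omega> t *\<^sub>R (r t :: real^'n)) + sq_sum T (\<lambda>t. \<omega> t *\<^sub>R (s t :: real^'m))
    \<le> 34 * (G * \<epsilon>)\<^sup>2 * (sq_sum T (\<lambda>t. \<omega> t *\<^sub>R x t) + D\<^sup>2 * (\<Sum>t<T. (\<omega> t)\<^sup>2))"
proof -
  define e where "e t = \<omega> t * (norm (x t) + D)" for t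
  have e_nonneg: "0 \<le> e t" for t using \<omega>(1)[of t] D_nonneg by (simp add: e_def)
  have Ge: "0 \<le> G * \<epsilon>" using G_ge epsilon_nonneg by simp
  have beta2: "\<beta> \<le> 2" using G_ge by (simp add: \<beta>_def)
  have "sq_sum (Suc T) (\<lambda>t. \<omega> t *\<^sub>R r t) = sq_sum T (\<lambda>t. \<omega> (Suc t) *\<^sub>R r (Suc t))"
    unfolding sq_sum_def by (subst sum.lessThan_Suc_shift) (simp add: r0)
  \<comment> \<open>\<open>r\<close> at time t + 1 is bounded by the state at time t; in between the
    weight grows by at most \<beta> \<le> 2, which turns the factor 2 into 4.\<close>
  also have "\<dots> \<le> (4 * (G * \<epsilon>))\<^sup>2 * sq_sum T e"
  proof (rule sq_sum_le_scaled)
    fix t assume t: "t < T"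
    have "\<omega> t \<le> \<beta> * \<omega> t" "\<omega> (Suc t) \<le> \<beta> * \<omega> (Suc t)" using \<omega>(1) beta_gt by simp_all
    then have "\<omega> (Suc t) \<le> \<beta> * \<omega> t" using \<omega>(2)[OF t] by auto
    also have "\<dots> \<le> 2 * \<omega> t" using beta2 \<omega>(1)[of t] by (intro mult_right_mono) auto
    finally have "\<omega> (Suc t) * norm (r (Suc t)) \<le> (2 * \<omega> t) * (2 * G * \<epsilon> * (norm (x t) + D))"
      using r[OF t] \<omega>(1)[of t] by (intro mult_mono) auto
    also have "\<dots> = 4 * (G * \<epsilon>) * e t" by (simp add: e_def mult_ac)
    finally show "norm (\<omega> (Suc t) *\<^sub>R r (Suc t)) \<le> 4 * (G * \<epsilon>) * norm (e t)"
      using \<omega>(1)[of "Suc t"] e_nonneg[of t] by simp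
  qed
  finally have 1: "sq_sum (Suc T) (\<lambda>t. \<omega> t *\<^sub>R r t) \<le> 16 * (G * \<epsilon>)\<^sup>2 * sq_sum T e"
    by (simp add: power_mult_distrib)
  have 2: "sq_sum T (\<lambda>t. \<omega> t *\<^sub>R s t) \<le> (G * \<epsilon>)\<^sup>2 * sq_sum T e"
  proof (rule sq_sum_le_scaled)
    fix t assume t: "t < T"
    have "\<omega> t * norm (s t) \<le> \<omega> t * (G * \<epsilon> * (norm (x t) + D))"
      using s[OF t] \<omega>(1)[of t] by (intro mult_left_mono) auto
    then show "norm (\<omega> t *\<^sub>R s t) \<le> G * \<epsilon> * norm (e t)"
      using \<omega>(1)[of t] e_nonneg[of t] by (simp add: e_def mult_ac)
  qed
  have "sq_sum T e \<le> 2 * (sq_sum T (\<lambda>t. \<omega> t *\<^sub>R x t) + D\<^sup>2 * (\<Sum>t<T. (\<omega> t)\<^sup>2))"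
  proof -
    have "(e t)\<^sup>2 \<le> 2 * (norm (\<omega> t *\<^sub>R x t))\<^sup>2 + 2 * (D\<^sup>2 * (\<omega> t)\<^sup>2)" for t
    proof -
      have "(norm (x t) + D)\<^sup>2 + (norm (x t) - D)\<^sup>2 = 2 * (norm (x t))\<^sup>2 + 2 * D\<^sup>2"
        by (simp add: power2_eq_square algebra_simps)
      then have "(norm (x t) + D)\<^sup>2 \<le> 2 * (norm (x t))\<^sup>2 + 2 * D\<^sup>2" by (smt (verit) zero_le_power2)
      then have "(\<omega> t)\<^sup>2 * (norm (x t) + D)\<^sup>2 \<le> (\<omega> t)\<^sup>2 * (2 * (norm (x t))\<^sup>2 + 2 * D\<^sup>2)"
        by (intro mult_left_mono) auto
      moreover have "(norm (\<omega> t *\<^sub>R x t))\<^sup>2 = (\<omega> t)\<^sup>2 * (norm (x t))\<^sup>2" "(e t)\<^sup>2 = (\<omega> t)\<^sup>2 * (norm (x t) + D)\<^sup>2"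
        by (simp_all add: e_def power_mult_distrib)
      ultimately show ?thesis by (simp only: distrib_left mult_ac)
    qed
    then have "sq_sum T e \<le> (\<Sum>t<T. 2 * (norm (\<omega> t *\<^sub>R x t))\<^sup>2 + 2 * (D\<^sup>2 * (\<omega> t)\<^sup>2))"
      unfolding sq_sum_def by (intro sum_mono) simp
    also have "\<dots> = 2 * (sq_sum T (\<lambda>t. \<omega> t *\<^sub>R x t) + D\<^sup>2 * (\<Sum>t<T. (\<omega> t)\<^sup>2))"
      by (simp add: sq_sum_def sum.distrib flip: sum_distrib_left)
    finally show ?thesis .
  qed
  then have "17 * (G * \<epsilon>)\<^sup>2 * sq_sum T e
      \<le> 17 * (G * \<epsilon>)\<^sup>2 * (2 * (sq_sum T (\<lambda>t. \<omega> t *\<^sub>R x t) + D\<^sup>2 * (\<Sum>t<T. (\<omega> t)\<^sup>2)))"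
    by (intro mult_left_mono) auto
  then show ?thesis using 1 2 by linarith
qed

text \<open>Small gain: the residuals of the closed loop are proportional to its own state, and the
  energy estimate returns less than half of the energy, which is absorbed. The 17 in the hypothesis
  gives the factor 136/17^2 < 1/2.\<close>

lemma weighted_state_bound:
  assumes small: "17 * (K * G * \<epsilon>) \<le> 1"
    and \<omega>: "\<And>t. 0 < \<omega> t" "\<And>t. t < T \<Longrightarrow> \<omega> (Suc t) = \<omega> t \<or> \<omega> (Suc t) = \<beta> * \<omega> t \<or> \<beta> * \<omega> (Suc t) = \<omega> t"
  shows "sq_sum (Suc T) (\<lambda>t. \<omega> t *\<^sub>R x t)
    \<le> 8 * K\<^sup>2 * sq_sum (Suc T) (\<lambda>t. \<omega> t *\<^sub>R state_defect (x 0) w t) + D\<^sup>2 * (\<Sum>t<T. (\<omega> t)\<^sup>2)"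
proof -
  obtain l r s where sys: "residual_system A B T x u l (\<lambda>t. gf t (x t)) (\<lambda>t. gc (Suc t) (u t)) r s (state_defect (x 0) w)"
    and res: "r 0 = 0" "\<And>t. t < T \<Longrightarrow> norm (r (Suc t)) \<le> 2 * G * \<epsilon> * (norm (x t) + D)"
     "\<And>t. t < T \<Longrightarrow> norm (s t) \<le> G * \<epsilon> * (norm (x t) + D)"
    using closed_loop_residuals by blast
  define En where "En = energy T (\<lambda>t. \<omega> t *\<^sub>R x t) (\<lambda>t. \<omega> t *\<^sub>R u t) (\<lambda>t. \<omega> t *\<^sub>R l t)"
  define Q where "Q = sq_sum (Suc T) (\<lambda>t. \<omega> t *\<^sub>R state_defect (x 0) w t)"
  define Om where "Om = (\<Sum>t<T. (\<omega> t)\<^sup>2)"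
  define R where "R = sq_sum (Suc T) (\<lambda>t. \<omega> t *\<^sub>R r t) + sq_sum T (\<lambda>t. \<omega> t *\<^sub>R s t)"
  have nn: "0 \<le> En" "0 \<le> Q" "0 \<le> Om" by (simp_all add: En_def Q_def Om_def sum_nonneg)
  have x_le: "sq_sum (Suc T) (\<lambda>t. \<omega> t *\<^sub>R x t) \<le> En"
    unfolding En_def energy_def by simp
  have P_le: "sq_sum T (\<lambda>t. \<omega> t *\<^sub>R x t) \<le> En"
    by (rule order_trans[OF _ x_le]) (simp add: sq_sum_def)
  have "En \<le> 4 * K\<^sup>2 * (R + Q)"
    using time_weighted_estimate[OF sys, of \<omega>] \<omega> gf gc
    by (simp add: En_def R_def Q_def energy_def block_gradient_at)
  also have "\<dots> \<le> 4 * K\<^sup>2 * (34 * (G * \<epsilon>)\<^sup>2 * (En + D\<^sup>2 * Om) + Q)"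
  proof (intro mult_left_mono add_mono order_refl)
    have "R \<le> 34 * (G * \<epsilon>)\<^sup>2 * (sq_sum T (\<lambda>t. \<omega> t *\<^sub>R x t) + D\<^sup>2 * Om)"
      unfolding R_def Om_def by (intro residual_energy_le res \<omega>)
    also have "\<dots> \<le> 34 * (G * \<epsilon>)\<^sup>2 * (En + D\<^sup>2 * Om)"
      using P_le by (intro mult_left_mono) auto
    finally show "R \<le> 34 * (G * \<epsilon>)\<^sup>2 * (En + D\<^sup>2 * Om)" .
  qed simp
  also have "\<dots> = 136 * (K * G * \<epsilon>)\<^sup>2 * (En + D\<^sup>2 * Om) + 4 * K\<^sup>2 * Q"
    by (simp add: power_mult_distrib distrib_left mult_ac)
  also have "\<dots> \<le> 136 * (1 / 17)\<^sup>2 * (En + D\<^sup>2 * Om) + 4 * K\<^sup>2 * Q"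
    using small K_pos G_ge epsilon_nonneg nn
    by (intro add_mono mult_right_mono mult_left_mono power_mono) auto
  also have "\<dots> \<le> 1 / 2 * (En + D\<^sup>2 * Om) + 4 * K\<^sup>2 * Q"
    using nn by (intro add_mono mult_right_mono) (auto simp: power2_eq_square)
  finally have "En \<le> 8 * K\<^sup>2 * Q + D\<^sup>2 * Om" by (simp add: field_simps)
  then show ?thesis using x_le by (simp add: Q_def Om_def)
qed

lemma closed_loop_state_bound:
  assumes small: "17 * (K * G * \<epsilon>) \<le> 1" and "s \<le> T"
  shows "norm (x s) \<le> 3 * K * \<theta> ^ s * norm (x 0) + 39 * G\<^sup>2 * D"
proof -
  let ?S = "2 / (1 - \<theta>)"
  let ?w = "decay s"
  have S: "0 \<le> ?S" using theta_lt by simp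
  have "(norm (x s))\<^sup>2 \<le> sq_sum (Suc T) (\<lambda>t. ?w t *\<^sub>R x t)"
    using norm_sq_le_sq_sum[of s "Suc T" "\<lambda>t. ?w t *\<^sub>R x t"] \<open>s \<le> T\<close> by simp
  also have "\<dots> \<le> 8 * K\<^sup>2 * sq_sum (Suc T) (\<lambda>t. ?w t *\<^sub>R state_defect (x 0) w t) + D\<^sup>2 * (\<Sum>t<T. (?w t)\<^sup>2)"
    using decay_step by (intro weighted_state_bound small decay_pos) blast
  also have "\<dots> \<le> 8 * K\<^sup>2 * ((\<theta> ^ s * norm (x 0))\<^sup>2 + D\<^sup>2 * ?S) + D\<^sup>2 * ?S"
  proof (intro add_mono mult_left_mono sum_decay_sq_le)
    have "sq_sum (Suc T) (\<lambda>t. ?w t *\<^sub>R state_defect (x 0) w t)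
        = (?w 0 * norm (x 0))\<^sup>2 + (\<Sum>t<T. (?w (Suc t) * norm (w t))\<^sup>2)"
      unfolding sq_sum_def by (subst sum.lessThan_Suc_shift) (simp add: power_mult_distrib)
    also have "?w 0 = \<theta> ^ s" by (simp add: decay_def)
    also have "(\<Sum>t<T. (?w (Suc t) * norm (w t))\<^sup>2) \<le> (\<Sum>t<T. (?w (Suc t) * D)\<^sup>2)"
      using decay_pos norm_w_le by (intro sum_mono power_mono mult_left_mono) (auto simp: less_imp_le)
    also have "\<dots> = D\<^sup>2 * (\<Sum>t<T. (?w (Suc t))\<^sup>2)"
      by (simp add: power_mult_distrib sum_distrib_left mult.commute)
    also have "\<dots> \<le> D\<^sup>2 * (\<Sum>t<Suc T. (?w t)\<^sup>2)"
      by (subst sum.lessThan_Suc_shift) (simp add: mult_left_mono)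
    also have "\<dots> \<le> D\<^sup>2 * ?S" by (intro mult_left_mono sum_decay_sq_le) simp
    finally show "sq_sum (Suc T) (\<lambda>t. ?w t *\<^sub>R state_defect (x 0) w t) \<le> (\<theta> ^ s * norm (x 0))\<^sup>2 + D\<^sup>2 * ?S"
      by simp
  qed simp_all
  also have "\<dots> \<le> (3 * K * (\<theta> ^ s * norm (x 0)))\<^sup>2 + 9 * K\<^sup>2 * (D\<^sup>2 * ?S)"
  proof -
    define c where "c = D\<^sup>2 * ?S"
    have "1 \<le> K\<^sup>2" using K_ge by simp
    then have "1 * c \<le> K\<^sup>2 * c" using S unfolding c_def by (intro mult_right_mono mult_nonneg_nonneg) auto
    moreover have "0 \<le> K\<^sup>2 * (\<theta> ^ s * norm (x 0))\<^sup>2" by simp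
    moreover have "(3 * K * (\<theta> ^ s * norm (x 0)))\<^sup>2 = 9 * (K\<^sup>2 * (\<theta> ^ s * norm (x 0))\<^sup>2)"
      by (simp add: power_mult_distrib)
    ultimately show ?thesis
      unfolding c_def[symmetric] distrib_left mult.assoc by linarith
  qed
  \<comment> \<open>39 is 3 times the 13 of \<open>decay_constant_le\<close>, with 13 G enlarged to
    its square.\<close>
  also have "9 * K\<^sup>2 * (D\<^sup>2 * ?S) \<le> (39 * G\<^sup>2 * D)\<^sup>2"
  proof -
    have "?S \<le> 13 * G" by (rule decay_constant_le)
    also have "\<dots> \<le> (13 * G)\<^sup>2" using G_ge by (simp add: power2_eq_square)
    finally have "9 * K\<^sup>2 * (D\<^sup>2 * ?S) \<le> 9 * G\<^sup>2 * (D\<^sup>2 * (13 * G)\<^sup>2)"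
      using K_le_G K_pos S by (intro mult_mono[of "9 * K\<^sup>2"] mult_left_mono power_mono) auto
    then show ?thesis by (simp add: power_mult_distrib power2_eq_square mult_ac)
  qed
  finally have "(norm (x s))\<^sup>2 \<le> (3 * K * (\<theta> ^ s * norm (x 0)))\<^sup>2 + (39 * G\<^sup>2 * D)\<^sup>2" by simp
  also have "\<dots> \<le> (3 * K * (\<theta> ^ s * norm (x 0)) + 39 * G\<^sup>2 * D)\<^sup>2"
    using K_pos theta_pos D_nonneg by (simp add: power2_sum)
  finally show ?thesis
    by (rule power2_le_imp_le[THEN order_trans]) (use K_pos theta_pos D_nonneg in \<open>simp_all add: mult.assoc\<close>)
qed

text \<open>Both trajectories share initial state and disturbances, so these defects cancel in the
  difference and the residuals of the closed loop remain. They are bounded by the unweighted sum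
  over all states, which is the origin of the term proportional to \<open>T\<close>.\<close>

lemma closed_loop_opt_distance:
  assumes small: "17 * (K * G * \<epsilon>) \<le> 1"
    and opt: "kkt A B T gf (\<lambda>t. gc (Suc t)) (gf T) (x 0) w xo uo lo"
  shows "sq_sum (Suc T) (\<lambda>t. x t - xo t) + sq_sum T (\<lambda>t. u t - uo t)
    \<le> 1360 * (K\<^sup>2 * G * \<epsilon>)\<^sup>2 * ((norm (x 0))\<^sup>2 + real T * D\<^sup>2)"
proof -
  obtain l r s where sys: "residual_system A B T x u l (\<lambda>t. gf t (x t)) (\<lambda>t. gc (Suc t) (u t)) r s (state_defect (x 0) w)"
    and res: "r 0 = 0" "\<And>t. t < T \<Longrightarrow> norm (r (Suc t)) \<le> 2 * G * \<epsilon> * (norm (x t) + D)"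
     "\<And>t. t < T \<Longrightarrow> norm (s t) \<le> G * \<epsilon> * (norm (x t) + D)"
    using closed_loop_residuals by blast
  have w_sum: "sq_sum T w \<le> real T * D\<^sup>2"
  proof -
    have "sq_sum T w \<le> (\<Sum>t<T. D\<^sup>2)"
      unfolding sq_sum_def by (intro sum_mono power_mono norm_w_le) auto
    then show ?thesis by simp
  qed
  define M where "M = (norm (x 0))\<^sup>2 + real T * D\<^sup>2"
  have "sq_sum (Suc T) (\<lambda>t. 1 *\<^sub>R x t)
      \<le> 8 * K\<^sup>2 * sq_sum (Suc T) (\<lambda>t. 1 *\<^sub>R state_defect (x 0) w t) + D\<^sup>2 * (\<Sum>t<T. 1\<^sup>2)"
    by (rule weighted_state_bound[OF small]) auto
  then have "sq_sum (Suc T) x \<le> 8 * K\<^sup>2 * ((norm (x 0))\<^sup>2 + sq_sum T w) + D\<^sup>2 * real T"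
    by (simp add: sq_sum_state_defect)
  also have "\<dots> \<le> 8 * K\<^sup>2 * M + M"
    unfolding M_def using w_sum by (intro add_mono mult_left_mono) (auto simp: mult.commute)
  finally have x_sum: "sq_sum (Suc T) x \<le> 8 * K\<^sup>2 * M + M" .
  have "sq_sum T x + real T * D\<^sup>2 \<le> 8 * K\<^sup>2 * M + 2 * M"
  proof -
    note x_sum
    moreover have "sq_sum T x \<le> sq_sum (Suc T) x" by (simp add: sq_sum_def)
    moreover have "real T * D\<^sup>2 \<le> M" by (simp add: M_def)
    ultimately show ?thesis by linarith
  qed
  also have "\<dots> \<le> 10 * K\<^sup>2 * M"
  proof -
    have "1 \<le> K\<^sup>2" using K_ge by simp
    then have "1 * M \<le> K\<^sup>2 * M" by (intro mult_right_mono) (auto simp: M_def)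
    then show ?thesis unfolding mult.assoc by linarith
  qed
  finally have xM: "sq_sum T x + real T * D\<^sup>2 \<le> 10 * K\<^sup>2 * M" .
  have "sq_sum (Suc T) (\<lambda>t. x t - xo t) + sq_sum T (\<lambda>t. u t - uo t)
      \<le> energy T (\<lambda>t. x t - xo t) (\<lambda>t. u t - uo t) (\<lambda>t. l t - lo t)"
    by (simp add: energy_def)
  also have "\<dots> \<le> 4 * K\<^sup>2 * energy T (\<lambda>t. r t - 0) (\<lambda>t. s t - 0) (\<lambda>t. state_defect (x 0) w t - state_defect (x 0) w t)"
  proof (rule unweighted_estimate[OF residual_system_diff[OF sys kkt_residual_system[OF opt]]])
    show "block_bounds bx \<mu> L (gf t (x t) - (if t < T then gf t (xo t) else gf T (xo t))) (x t - xo t)"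
      if "t \<le> T" for t
      using gf[OF that] that by (cases "t < T") (auto simp: block_gradient_def)
    show "block_bounds bu \<mu> L (gc (Suc t) (u t) - gc (Suc t) (uo t)) (u t - uo t)" if "t < T" for t
      using gc[of "Suc t"] that by (simp add: block_gradient_def)
  qed
  also have "\<dots> = 4 * K\<^sup>2 * (sq_sum (Suc T) (\<lambda>t. 1 *\<^sub>R r t) + sq_sum T (\<lambda>t. 1 *\<^sub>R s t))"
    by (simp add: energy_def)
  also have "\<dots> \<le> 4 * K\<^sup>2 * (34 * (G * \<epsilon>)\<^sup>2 * (sq_sum T (\<lambda>t. 1 *\<^sub>R x t) + D\<^sup>2 * (\<Sum>t<T. 1\<^sup>2)))"
    by (intro mult_left_mono residual_energy_le res) auto
  also have "\<dots> = 4 * K\<^sup>2 * (34 * (G * \<epsilon>)\<^sup>2 * (sq_sum T x + real T * D\<^sup>2))" by (simp add: mult.commute)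
  also have "\<dots> \<le> 4 * K\<^sup>2 * (34 * (G * \<epsilon>)\<^sup>2 * (10 * K\<^sup>2 * M))"
    by (intro mult_left_mono xM) auto
  also have "\<dots> = 1360 * (K\<^sup>2 * G * \<epsilon>)\<^sup>2 * M" by (simp add: power2_eq_square mult_ac)
  finally show ?thesis unfolding M_def .
qed

end

subsection \<open>Constants\<close>

text \<open>The bridge between the constants of the theorem and \<open>G\<close>. As J^2 is the
  reciprocal of \<open>mu_J\<close>, the ratio H/m of \<open>L_H\<close> to \<open>mu_H\<close> is
  at least 9 G. Moreover 1 - \<open>delta_S\<close> = (1 - \<rho>)/2 \<le> (1 - \<rho>^2)/2 =
  m^2/(H^2 + m^2).\<close>

lemma spatial_rate_bounds:
  assumes L: "1 < L" and \<gamma>: "0 < \<gamma>" "\<gamma> < 1" and \<mu>: "0 < \<mu>" "\<mu> \<le> L"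
    and J: "J = L * sqrt (1 + L\<^sup>2) / (1 - \<gamma>)"
    and G: "G = 4 * (J * L)\<^sup>2 / \<mu> * L" "1 \<le> G"
  shows "0 < delta_S L \<gamma> \<mu>" "delta_S L \<gamma> \<mu> < 1" "81 * G\<^sup>2 * (1 - delta_S L \<gamma> \<mu>) \<le> 1"
proof -
  let ?H = "L_H L" and ?m = "mu_H L \<gamma> \<mu>" and ?\<rho> = "rho_S L \<gamma> \<mu>"
  have J2: "J\<^sup>2 = 1 / mu_J L \<gamma>"
    by (simp add: J mu_J_def power_divide power_mult_distrib)
  have "0 < sqrt (1 + L\<^sup>2)" by (simp add: add_pos_nonneg)
  then have "0 < J" unfolding J using L \<gamma> by (intro divide_pos_pos mult_pos_pos) auto
  then have J2_pos: "0 < J\<^sup>2" by simp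
  have H: "2 * L \<le> ?H" "0 < ?H" using L by (simp_all add: L_H_def)
  \<comment> \<open>The bracket in the definition of \<open>mu_H\<close> is a complete
    square.\<close>
  have inv: "inverse ?m = 1 / \<mu> + (1 + ?H / \<mu>)\<^sup>2 * (?H * J\<^sup>2)"
    unfolding mu_H_def J2 by (simp add: power2_eq_square algebra_simps add_divide_distrib)
  then have "0 < inverse ?m" using \<mu> H J2_pos by (simp add: add_pos_nonneg)
  then have m: "0 < ?m" by simp
  have "9 * G = (2 * L) * (9 * (L / \<mu>) * ((2 * L) * J\<^sup>2))"
    using \<mu> by (simp add: G power2_eq_square field_simps)
  also have "\<dots> \<le> ?H * ((1 + ?H / \<mu>)\<^sup>2 * (?H * J\<^sup>2))"
  proof (intro mult_mono)
    have "1 \<le> L / \<mu>" using \<mu> by simp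
    moreover have "9 * z \<le> (1 + 2 * z)\<^sup>2" if "1 \<le> z" for z :: real
      using mult_nonneg_nonneg[of "4 * z - 1" "z - 1"] that by (simp add: power2_eq_square algebra_simps)
    ultimately have "9 * (L / \<mu>) \<le> (1 + 2 * (L / \<mu>))\<^sup>2" by blast
    also have "\<dots> \<le> (1 + ?H / \<mu>)\<^sup>2"
      using H \<mu> L by (intro power_mono) (auto simp: field_simps)
    finally show "9 * (L / \<mu>) \<le> (1 + ?H / \<mu>)\<^sup>2" .
  qed (use H L \<mu> in auto)
  also have "\<dots> \<le> ?H * inverse ?m" unfolding inv using H \<mu> by (intro mult_left_mono) auto
  finally have "9 * G * ?m \<le> ?H" using m by (simp add: field_simps)
  then have "(9 * G * ?m)\<^sup>2 \<le> ?H\<^sup>2" using G(2) m by (intro power_mono mult_nonneg_nonneg) auto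
  then have Gm: "81 * G\<^sup>2 * ?m\<^sup>2 \<le> ?H\<^sup>2" by (simp add: power_mult_distrib)
  have m2: "0 < ?m\<^sup>2" using m by simp
  have "1 \<le> G\<^sup>2" using G(2) by (rule one_le_power)
  then have "1 * ?m\<^sup>2 \<le> (81 * G\<^sup>2) * ?m\<^sup>2" by (intro mult_right_mono) auto
  then have mH: "?m\<^sup>2 \<le> ?H\<^sup>2" using Gm by simp
  let ?q = "(?H\<^sup>2 - ?m\<^sup>2) / (?H\<^sup>2 + ?m\<^sup>2)"
  have sum_pos: "0 < ?H\<^sup>2 + ?m\<^sup>2" using m2 by (simp add: add_nonneg_pos)
  have q: "0 \<le> ?q" "?q < 1" using mH m2 sum_pos by (simp_all add: divide_less_eq)
  have \<rho>: "0 \<le> ?\<rho>" "?\<rho> < 1" "?\<rho>\<^sup>2 = ?q"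
    using q by (simp_all add: rho_S_def)
  show "0 < delta_S L \<gamma> \<mu>" "delta_S L \<gamma> \<mu> < 1" using \<rho> by (simp_all add: delta_S_def)
  have "?\<rho>\<^sup>2 \<le> ?\<rho>" using \<rho>(1,2) by (simp add: power2_eq_square mult_left_le)
  moreover have "1 - delta_S L \<gamma> \<mu> = (1 - ?\<rho>) / 2" by (simp add: delta_S_def field_simps)
  ultimately have "1 - delta_S L \<gamma> \<mu> \<le> (1 - ?\<rho>\<^sup>2) / 2" by simp
  also have "\<dots> = (1 - ?q) / 2" by (simp only: \<rho>(3))
  also have "\<dots> = ?m\<^sup>2 / (?H\<^sup>2 + ?m\<^sup>2)"
  proof -
    have "(1 - (a - b) / (a + b)) / 2 = b / (a + b)" if "0 < a + b" for a b :: real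
      using that by (simp add: field_simps)
    then show ?thesis using sum_pos by blast
  qed
  finally have "81 * G\<^sup>2 * (1 - delta_S L \<gamma> \<mu>) \<le> 81 * G\<^sup>2 * (?m\<^sup>2 / (?H\<^sup>2 + ?m\<^sup>2))"
    by (intro mult_left_mono) auto
  also have "\<dots> = (81 * G\<^sup>2 * ?m\<^sup>2) / (?H\<^sup>2 + ?m\<^sup>2)" by simp
  also have "\<dots> \<le> 1" unfolding pos_divide_le_eq[OF sum_pos] mult_1
    by (rule add_increasing2[OF less_imp_le[OF m2] Gm])
  finally show "81 * G\<^sup>2 * (1 - delta_S L \<gamma> \<mu>) \<le> 1" .
qed

lemma power_le_of_log_le:
  fixes \<delta> a :: real
  assumes "0 < \<delta>" "\<delta> < 1" "0 < a" "ln a / ln \<delta> \<le> real n"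
  shows "\<delta> ^ n \<le> a"
proof -
  have "ln \<delta> < 0" using assms by simp
  then have "real n * ln \<delta> \<le> ln a" using assms(4) by (simp add: field_simps)
  then have "ln (\<delta> ^ n) \<le> ln a" using assms by (simp add: ln_realpow)
  then show ?thesis using assms by simp
qed

context closed_loop
begin

text \<open>Bernoulli gives \<delta>^4 \<ge> 1 - 4 (1 - \<delta>), and 4 (1 - \<delta>) is at most 1
  - \<theta> = 1/(6 G + 1) by the first hypothesis.\<close>

lemma theta_le_power4:
  assumes "81 * G\<^sup>2 * (1 - \<delta>) \<le> 1" "0 < \<delta>" "\<delta> < 1"
  shows "\<theta> \<le> \<delta> ^ 4"
proof -
  have "4 * (6 * G + 1) \<le> 81 * G * G"
  proof -
    have "4 * (6 * G + 1) \<le> 81 * G * 1" using G_ge by simp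
    also have "\<dots> \<le> 81 * G * G" using G_ge by (intro mult_left_mono) auto
    finally show ?thesis .
  qed
  then have "(4 * (6 * G + 1)) * (1 - \<delta>) \<le> (81 * G * G) * (1 - \<delta>)"
    using assms by (intro mult_right_mono) auto
  then have "4 * (1 - \<delta>) * (6 * G + 1) \<le> 81 * G\<^sup>2 * (1 - \<delta>)"
    by (simp only: power2_eq_square mult_ac)
  also have "\<dots> \<le> 1" by (rule assms)
  finally have "4 * (1 - \<delta>) \<le> 1 / (6 * G + 1)" using G_ge by (simp add: pos_le_divide_eq)
  moreover have "\<theta> = 1 - 1 / (6 * G + 1)" unfolding theta_eq using G_ge by (simp add: field_simps)
  moreover have "1 - 4 * (1 - \<delta>) \<le> \<delta> ^ 4"
    using Bernoulli_inequality[of "\<delta> - 1" 4] assms by simp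
  ultimately show ?thesis by linarith
qed

text \<open>The gain is of order K^2 G^3 \<le> G^5, while \<delta>^\<kappa> and \<delta>^k are
  bounded by multiples of (1 - \<delta>)^2, which compensates only G^4. Since \<theta> \<le>
  \<delta>^4, the error carries (1 - \<delta>)^8, and the product is controlled by the eighth power
  of G^2 (1 - \<delta>). The fourth power of the number of nodes in the denominator likewise
  outweighs its square root.\<close>

lemma small_gain:
  assumes \<delta>: "81 * G\<^sup>2 * (1 - \<delta>) \<le> 1" "0 < \<delta>" "\<delta> < 1"
    and \<kappa>: "\<delta> ^ \<kappa> \<le> (1 - \<delta>)\<^sup>2 / (2 * real CARD('v))" and k: "\<delta> ^ k \<le> (1 - \<delta>)\<^sup>2 / 16"
  shows "17 * (K * G * \<epsilon>) \<le> 1"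
proof -
  let ?h = "1 - \<delta>" and ?N = "real CARD('v)"
  have N: "1 \<le> ?N" by simp
  have pow: "\<theta> ^ n \<le> (\<delta> ^ n) ^ 4" for n
  proof -
    have "\<theta> ^ n \<le> (\<delta> ^ 4) ^ n" using theta_le_power4[OF \<delta>] theta_pos by (intro power_mono) auto
    then show ?thesis by (simp add: mult.commute flip: power_mult)
  qed
  have h8: "(?h\<^sup>2) ^ 4 = ?h ^ 8" by (simp flip: power_mult)
  have "sqrt ?N * \<theta> ^ \<kappa> \<le> ?N ^ 4 * (?h\<^sup>2 / (2 * ?N)) ^ 4"
  proof (intro mult_mono)
    have "sqrt ?N \<le> ?N" using N by (intro real_le_lsqrt) (auto simp: power2_eq_square)
    also have "\<dots> \<le> ?N ^ 4" using N by (intro self_le_power) auto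
    finally show "sqrt ?N \<le> ?N ^ 4" .
    have "(\<delta> ^ \<kappa>) ^ 4 \<le> (?h\<^sup>2 / (2 * ?N)) ^ 4" using \<kappa> \<delta> by (intro power_mono) auto
    then show "\<theta> ^ \<kappa> \<le> (?h\<^sup>2 / (2 * ?N)) ^ 4" using pow[of \<kappa>] by linarith
  qed (use theta_pos in auto)
  also have "\<dots> = ?h ^ 8 / 16" using N by (simp add: power_divide power_mult_distrib h8)
  finally have 1: "sqrt ?N * \<theta> ^ \<kappa> \<le> ?h ^ 8 / 16" .
  have "(\<delta> ^ k) ^ 4 \<le> (?h\<^sup>2 / 16) ^ 4" using k \<delta> by (intro power_mono) auto
  also have "\<dots> \<le> ?h ^ 8 / 16" using \<delta> by (simp add: power_divide h8 divide_left_mono)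
  finally have 2: "\<theta> ^ k \<le> ?h ^ 8 / 16" using pow[of k] by linarith
  have "17 * (K * G * \<epsilon>) = 1836 * (K\<^sup>2 * G ^ 3) * (sqrt ?N * \<theta> ^ \<kappa> + \<theta> ^ k)"
    by (simp add: \<epsilon>_def power2_eq_square power3_eq_cube mult_ac)
  also have "\<dots> \<le> 1836 * (G ^ 16) * (?h ^ 8 / 8)"
  proof (intro mult_mono mult_left_mono)
    have "K\<^sup>2 * G ^ 3 \<le> G\<^sup>2 * G ^ 3" using K_le_G K_pos G_ge by (intro mult_right_mono power_mono) auto
    also have "\<dots> \<le> G ^ 16" using G_ge by (simp flip: power_add)
    finally show "K\<^sup>2 * G ^ 3 \<le> G ^ 16" .
    show "sqrt ?N * \<theta> ^ \<kappa> + \<theta> ^ k \<le> ?h ^ 8 / 8" using 1 2 by simp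
  qed (use theta_pos G_ge in auto)
  also have "\<dots> = 1836 / 8 * (G\<^sup>2 * ?h) ^ 8" by (simp add: power_mult_distrib flip: power_mult)
  also have "\<dots> \<le> 1836 / 8 * (1 / 81) ^ 8"
    using \<delta> by (intro mult_left_mono power_mono) auto
  also have "\<dots> \<le> 1836 / 8 * (1 / 81)\<^sup>2" by (intro mult_left_mono power_decreasing) auto
  also have "\<dots> \<le> 1" by (simp add: power2_eq_square)
  finally show ?thesis .
qed

text \<open>As \<xi> \<le> 1 - \<delta>, the first hypothesis gives 81 G^2 \<le> 1/\<xi>, which
  dominates the constants 3 K and 39 G^2 of \<open>closed_loop_state_bound\<close>; the rate is
  \<theta> \<le> \<delta> \<le> 1 - \<xi>. T - 2 k may be negative, hence the integer power: passing
  to it from T - k only enlarges the bound, the base being below 1.\<close>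

lemma input_to_state_stability:
  fixes \<delta> C :: real
  defines "\<xi> \<equiv> 1 - sqrt \<delta>"
  defines "W \<equiv> 10 * C ^ 3 * L * real CARD('v) / (1 - \<delta>)\<^sup>2 * D"
  assumes \<delta>: "81 * G\<^sup>2 * (1 - \<delta>) \<le> 1" "0 < \<delta>" "\<delta> < 1" and C: "1 \<le> C"
    and small: "17 * (K * G * \<epsilon>) \<le> 1" and t: "t \<le> T"
  shows "norm (x t) \<le>
    (if t \<le> T - k then C / \<xi> * (1 - \<xi>) ^ (t - k) * norm (x 0) + W / \<xi>
     else C\<^sup>2 / \<xi>\<^sup>2 * (1 - \<xi>) powi (int T - 2 * int k) * \<delta> ^ (t + k - T) * norm (x 0) + 2 * C * W / \<xi>\<^sup>2)"
proof -
  let ?s = "sqrt \<delta>" and ?N = "real CARD('v)"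
  have s: "0 < ?s" "?s < 1" "\<delta> \<le> ?s"
    using \<delta> by (auto intro!: real_le_rsqrt simp: power2_eq_square mult_left_le)
  have xi: "0 < \<xi>" "\<xi> \<le> 1 - \<delta>" "1 - \<xi> = ?s" using s by (auto simp: \<xi>_def)
  have "(81 * G\<^sup>2) * \<xi> \<le> (81 * G\<^sup>2) * (1 - \<delta>)" using xi by (intro mult_left_mono) auto
  then have inv_xi: "81 * G\<^sup>2 \<le> 1 / \<xi>" using \<delta>(1) xi by (simp add: pos_le_divide_eq)
  have G1: "G \<le> G\<^sup>2" "1 \<le> G\<^sup>2" using G_ge self_le_power[of G 2] one_le_power[of G 2] by auto
  then have K_xi: "3 * K \<le> 1 / \<xi>" "1 \<le> 1 / \<xi>" using inv_xi K_le_G by linarith+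
  have C_xi: "1 / \<xi> \<le> C / \<xi>" using C xi by (simp add: divide_right_mono)
  have C2_xi: "C / \<xi> \<le> C\<^sup>2 / \<xi>\<^sup>2"
    using mult_right_mono[of 1 "C / \<xi>" "C / \<xi>"] K_xi C_xi by (simp add: power2_eq_square)
  have th: "\<theta> \<le> \<delta>"
    using theta_le_power4[OF \<delta>] power_decreasing[of 1 4 \<delta>] \<delta> by simp
  have ths: "\<theta> ^ n \<le> ?s ^ n" for n using th s theta_pos by (intro power_mono) auto
  have D: "39 * G\<^sup>2 * D \<le> W / \<xi>"
  proof -
    have "1 * 1 \<le> C ^ 3 * (L * ?N)"
      using C L_ge mult_mono[of 1 L 1 ?N] by (intro mult_mono) auto
    also have "\<dots> \<le> C ^ 3 * (L * ?N) / (1 - \<delta>)\<^sup>2"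
      using \<delta> C L_pos power_le_one[of "1 - \<delta>" 2] by (simp add: pos_le_divide_eq mult_left_le)
    finally have "10 * D \<le> 10 * (C ^ 3 * (L * ?N) / (1 - \<delta>)\<^sup>2) * D"
      using D_nonneg by (intro mult_right_mono) auto
    then have DW: "10 * D \<le> W" by (simp add: W_def mult.assoc)
    have "39 * G\<^sup>2 * D \<le> (81 * G\<^sup>2) * (10 * D)" using D_nonneg by simp
    also have "\<dots> \<le> (1 / \<xi>) * W" using inv_xi DW D_nonneg xi by (intro mult_mono) auto
    finally show ?thesis by simp
  qed
  have W0: "0 \<le> W" using C L_pos D_nonneg by (simp add: W_def)
  have bound: "norm (x t) \<le> 3 * K * \<theta> ^ t * norm (x 0) + 39 * G\<^sup>2 * D"
    by (rule closed_loop_state_bound[OF small t])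
  show ?thesis
  proof (cases "t \<le> T - k")
    case True
    have "\<theta> ^ t \<le> \<theta> ^ (t - k)" using theta_pos theta_lt by (intro power_decreasing) auto
    also have "\<dots> \<le> ?s ^ (t - k)" by (rule ths)
    finally have "3 * K * \<theta> ^ t * norm (x 0) \<le> C / \<xi> * ?s ^ (t - k) * norm (x 0)"
      using K_xi C_xi xi C theta_pos by (intro mult_right_mono mult_mono) auto
    then show ?thesis using True bound D xi(3) by simp
  next
    case False
    have "\<theta> ^ t = \<theta> ^ (T - k) * \<theta> ^ (t + k - T)"
      using False k_le by (simp flip: power_add)
    also have "\<dots> \<le> ?s powi (int T - 2 * int k) * \<delta> ^ (t + k - T)"
    proof (intro mult_mono power_mono th)
      have "\<theta> ^ (T - k) \<le> ?s ^ (T - k)" by (rule ths)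
      also have "\<dots> = ?s powi (int (T - k))" by simp
      also have "\<dots> \<le> ?s powi (int T - 2 * int k)"
        using s k_le by (intro power_int_decreasing) auto
      finally show "\<theta> ^ (T - k) \<le> ?s powi (int T - 2 * int k)" .
    qed (use theta_pos s in auto)
    finally have "3 * K * \<theta> ^ t * norm (x 0)
        \<le> C\<^sup>2 / \<xi>\<^sup>2 * (?s powi (int T - 2 * int k) * \<delta> ^ (t + k - T)) * norm (x 0)"
      using K_xi C_xi C2_xi theta_pos by (intro mult_right_mono mult_mono) auto
    moreover have "W / \<xi> \<le> 2 * C * W / \<xi>\<^sup>2"
    proof -
      have "1 \<le> 2 * (C / \<xi>)" using K_xi C_xi by linarith
      then have "1 * (W / \<xi>) \<le> (2 * (C / \<xi>)) * (W / \<xi>)"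
        using W0 xi by (intro mult_right_mono) auto
      then show ?thesis by (simp add: power2_eq_square)
    qed
    ultimately show ?thesis using False bound D xi(3) by (simp add: mult.assoc)
  qed
qed

lemma regret_bound:
  fixes \<delta> :: real and f :: "nat \<Rightarrow> real^'n \<Rightarrow> real" and c :: "nat \<Rightarrow> real^'m \<Rightarrow> real"
  assumes \<delta>: "81 * G\<^sup>2 * (1 - \<delta>) \<le> 1" "0 < \<delta>" "\<delta> < 1"
    and small: "17 * (K * G * \<epsilon>) \<le> 1"
    and f: "\<And>t. t \<le> T \<Longrightarrow> convex_on UNIV (f t)" "\<And>t z. t \<le> T \<Longrightarrow> GDERIV (f t) z :> gf t z"
    and c: "\<And>t. t < T \<Longrightarrow> convex_on UNIV (c (Suc t))" "\<And>t z. t < T \<Longrightarrow> GDERIV (c (Suc t)) z :> gc (Suc t) z"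
    and opt: "ocp_opt A B T f (\<lambda>t. c (Suc t)) (f T) (x 0) w xo uo"
  shows "ocp_cost f (\<lambda>t. c (Suc t)) (f T) T x u - ocp_cost f (\<lambda>t. c (Suc t)) (f T) T xo uo
    \<le> L * (1360 * ((108 * K ^ 3 * G ^ 3)\<^sup>2 * (2 * real CARD('v)))) * (\<delta> ^ \<kappa> + \<delta> ^ k)
        * ((norm (x 0))\<^sup>2 + real T * D\<^sup>2)"
proof -
  let ?N = "real CARD('v)"
  obtain lo where kkt: "kkt A B T gf (\<lambda>t. gc (Suc t)) (gf T) (x 0) w xo uo lo"
    using ocp_opt_kkt[OF opt, of gf "\<lambda>t. gc (Suc t)" "gf T"] f(2) c(2) by auto
  text \<open>The first-order term vanishes because both trajectories are feasible.\<close>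
  have "residual_system A B T (\<lambda>t. x t - xo t) (\<lambda>t. u t - uo t) lo (\<lambda>t. gf t (xo t)) (\<lambda>t. gc (Suc t) (uo t))
      (\<lambda>_. 0) (\<lambda>_. 0) (\<lambda>_. 0)"
    using kkt traj by (simp add: residual_system_def kkt_def trajectory_def matrix_vector_mult_diff_distrib)
  from residual_system_duality[OF this]
  have first_order: "(\<Sum>t<Suc T. gf t (xo t) \<bullet> (x t - xo t)) + (\<Sum>t<T. gc (Suc t) (uo t) \<bullet> (u t - uo t)) = 0"
    by simp
  \<comment> \<open>Tangent inequality at \<open>a\<close>, then the gradient at \<open>a\<close> is
    exchanged for that at \<open>b\<close>. The remainder has L instead of the sharp L/2, which
    saves integrating along the segment.\<close>
  have gap: "h a - h b \<le> g b \<bullet> (a - b) + L * (norm (a - b))\<^sup>2"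
    if "convex_on UNIV h" "\<And>z. GDERIV h z :> g z" "block_gradient bl \<mu> L g"
    for h :: "real^'z::finite \<Rightarrow> real" and g a b and bl :: "'z \<Rightarrow> 'v"
  proof -
    have "h a + g a \<bullet> (b - a) \<le> h b" by (rule convex_gradient_le[OF that(1,2)])
    then have "h a - h b \<le> g a \<bullet> (a - b)" by (simp add: inner_diff_right)
    also have "\<dots> = g b \<bullet> (a - b) + (g a - g b) \<bullet> (a - b)" by (simp add: inner_diff_left)
    also have "(g a - g b) \<bullet> (a - b) \<le> norm (g a - g b) * norm (a - b)" by (rule norm_cauchy_schwarz)
    also have "\<dots> \<le> L * norm (a - b) * norm (a - b)"
      using block_gradient_lipschitz[OF that(3)] L_pos by (intro mult_right_mono) auto
    finally show ?thesis by (simp add: power2_eq_square)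
  qed
  have "ocp_cost f (\<lambda>t. c (Suc t)) (f T) T x u - ocp_cost f (\<lambda>t. c (Suc t)) (f T) T xo uo
      = (\<Sum>t<Suc T. f t (x t) - f t (xo t)) + (\<Sum>t<T. c (Suc t) (u t) - c (Suc t) (uo t))"
    by (simp add: ocp_cost_def sum_subtractf)
  also have "\<dots> \<le> (\<Sum>t<Suc T. gf t (xo t) \<bullet> (x t - xo t) + L * (norm (x t - xo t))\<^sup>2)
      + (\<Sum>t<T. gc (Suc t) (uo t) \<bullet> (u t - uo t) + L * (norm (u t - uo t))\<^sup>2)"
  proof (intro add_mono sum_mono)
    show "f t (x t) - f t (xo t) \<le> gf t (xo t) \<bullet> (x t - xo t) + L * (norm (x t - xo t))\<^sup>2"
      if "t \<in> {..<Suc T}" for t using that by (intro gap[OF f gf]) auto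
    show "c (Suc t) (u t) - c (Suc t) (uo t) \<le> gc (Suc t) (uo t) \<bullet> (u t - uo t) + L * (norm (u t - uo t))\<^sup>2"
      if "t \<in> {..<T}" for t using that by (intro gap[OF c gc]) auto
  qed
  also have "\<dots> = L * (sq_sum (Suc T) (\<lambda>t. x t - xo t) + sq_sum T (\<lambda>t. u t - uo t))"
    using first_order by (simp add: sum.distrib sq_sum_def distrib_left sum_distrib_left)
  also have "\<dots> \<le> L * (1360 * (K\<^sup>2 * G * \<epsilon>)\<^sup>2 * ((norm (x 0))\<^sup>2 + real T * D\<^sup>2))"
    using L_pos by (intro mult_left_mono closed_loop_opt_distance[OF small kkt]) simp
  also have "\<dots> \<le> L * (1360 * ((108 * K ^ 3 * G ^ 3)\<^sup>2 * (2 * ?N * (\<delta> ^ \<kappa> + \<delta> ^ k)))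
      * ((norm (x 0))\<^sup>2 + real T * D\<^sup>2))"
  proof -
    have th: "\<theta> ^ n \<le> \<delta> ^ n" for n
      using theta_le_power4[OF \<delta>] power_decreasing[of 1 4 \<delta>] \<delta> theta_pos by (intro power_mono) auto
    \<comment> \<open>The bound is quadratic in the step error and the claim linear in \<delta>^n,
      so one factor \<theta>^n \<le> 1 is given away.\<close>
    have sq: "(\<theta> ^ n)\<^sup>2 \<le> \<delta> ^ n" for n
      using th[of n] theta_pos theta_lt power_le_one[of \<theta> n]
      by (simp add: power2_eq_square) (meson less_imp_le mult_left_le order_trans zero_le_power)
    have "K\<^sup>2 * G * \<epsilon> = (108 * K ^ 3 * G ^ 3) * (sqrt ?N * \<theta> ^ \<kappa> + \<theta> ^ k)"
      by (simp add: \<epsilon>_def power2_eq_square power3_eq_cube mult_ac)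
    then have "(K\<^sup>2 * G * \<epsilon>)\<^sup>2 = (108 * K ^ 3 * G ^ 3)\<^sup>2 * (sqrt ?N * \<theta> ^ \<kappa> + \<theta> ^ k)\<^sup>2"
      by (simp only: power_mult_distrib)
    also have "(sqrt ?N * \<theta> ^ \<kappa> + \<theta> ^ k)\<^sup>2 \<le> 2 * (sqrt ?N * \<theta> ^ \<kappa>)\<^sup>2 + 2 * (\<theta> ^ k)\<^sup>2"
      using sum_squares_bound[of "sqrt ?N * \<theta> ^ \<kappa>" "\<theta> ^ k"] by (simp add: power2_sum)
    also have "\<dots> = 2 * ?N * (\<theta> ^ \<kappa>)\<^sup>2 + 2 * (\<theta> ^ k)\<^sup>2" by (simp add: power_mult_distrib)
    also have "\<dots> \<le> 2 * ?N * \<delta> ^ \<kappa> + 2 * ?N * \<delta> ^ k"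
    proof (intro add_mono mult_left_mono sq)
      have "1 \<le> ?N" by simp
      then have "1 * \<delta> ^ k \<le> ?N * \<delta> ^ k" using \<delta> by (intro mult_right_mono) auto
      then have "(\<theta> ^ k)\<^sup>2 \<le> ?N * \<delta> ^ k" using sq[of k] by linarith
      then show "2 * (\<theta> ^ k)\<^sup>2 \<le> 2 * ?N * \<delta> ^ k" by simp
    qed simp
    also have "\<dots> = 2 * ?N * (\<delta> ^ \<kappa> + \<delta> ^ k)" by (simp add: distrib_left)
    finally have "(K\<^sup>2 * G * \<epsilon>)\<^sup>2 \<le> (108 * K ^ 3 * G ^ 3)\<^sup>2 * (2 * ?N * (\<delta> ^ \<kappa> + \<delta> ^ k))"
      by (simp add: mult_left_mono)
    then show ?thesis using L_pos by (intro mult_left_mono mult_right_mono) auto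
  qed
  finally show ?thesis by (simp only: mult_ac)
qed

end

subsection \<open>From cost functions to optimality systems\<close>

lemma regular_cost_mu_le:
  fixes f :: "real^'n::finite \<Rightarrow> real"
  assumes "regular_cost \<mu> L f"
  shows "0 < \<mu>" "\<mu> \<le> L"
proof -
  show "0 < \<mu>" using assms by (simp add: regular_cost_def strongly_convex_def)
  obtain g where "\<And>x. GDERIV f x :> g x" and mono: "\<And>x y. \<mu> * (norm (x - y))\<^sup>2 \<le> (g x - g y) \<bullet> (x - y)"
    and lip: "\<And>x y. norm (g x - g y) \<le> L * norm (x - y)"
    using regular_cost_gradient[OF assms] by blast
  obtain e :: "real^'n" where e: "norm e = 1" using vector_choose_size[of 1] by auto
  have "\<mu> \<le> (g e - g 0) \<bullet> e" using mono[of e 0] e by simp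
  also have "\<dots> \<le> norm (g e - g 0) * norm e" by (rule norm_cauchy_schwarz)
  also have "\<dots> \<le> L" using lip[of e 0] e by simp
  finally show "\<mu> \<le> L" .
qed

text \<open>A nonnegative cost that vanishes at 0 is minimal there, whence
  \<open>g 0 = 0\<close>.\<close>

lemma regular_separable_gradient:
  assumes reg: "regular_cost \<mu> L f" and sep: "separable b f"
    and nonneg: "\<And>x. 0 \<le> f x" and zero: "f 0 = 0"
  shows "\<exists>g. (\<forall>x. GDERIV f x :> g x) \<and> block_gradient b \<mu> L g"
proof -
  obtain g where g: "\<And>x. GDERIV f x :> g x" "\<And>x y. \<mu> * (norm (x - y))\<^sup>2 \<le> (g x - g y) \<bullet> (x - y)"
    "\<And>x y. norm (g x - g y) \<le> L * norm (x - y)"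
    using regular_cost_gradient[OF reg] by blast
  have "g 0 = 0" by (rule gradient_zero_at_minimum[OF g(1)]) (simp add: zero nonneg)
  moreover have "block_bounds b \<mu> L (g x - g y) (x - y)" for x y
    using sep g by (rule separable_block_bounds)
  ultimately show ?thesis using g(1) by (auto simp: block_gradient_def)
qed

lemma strongly_convex_ge_quadratic:
  fixes f :: "'a::real_inner \<Rightarrow> real"
  assumes sc: "strongly_convex \<mu> f" and g: "GDERIV f 0 :> 0" and zero: "f 0 = 0"
  shows "\<mu> / 2 * (norm x)\<^sup>2 \<le> f x"
proof -
  have "GDERIV (\<lambda>x. f x - \<mu> / 2 * (norm x)\<^sup>2) 0 :> 0 - \<mu> *\<^sub>R 0"
    by (intro GDERIV_diff g GDERIV_half_norm_sq)
  moreover have "convex_on UNIV (\<lambda>x. f x - \<mu> / 2 * (norm x)\<^sup>2)" using sc by (simp add: strongly_convex_def)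
  ultimately show ?thesis
    using convex_gradient_le[of "\<lambda>x. f x - \<mu> / 2 * (norm x)\<^sup>2" 0 "0 - \<mu> *\<^sub>R 0" x] by (simp add: zero)
qed

text \<open>The gradient is radial; monotonicity against 0 keeps its factor above \<mu>, the
  Lipschitz bound below \<open>L\<close>. At \<open>x = 0\<close> any factor in this range
  serves.\<close>

lemma terminal_cost_gradient:
  fixes F :: "real^'n::finite \<Rightarrow> real"
  assumes "terminal_cost_assms \<mu> L F"
  shows "\<exists>g. (\<forall>x. GDERIV F x :> g x) \<and> (\<forall>x. \<exists>\<phi>. \<mu> \<le> \<phi> \<and> \<phi> \<le> L \<and> g x = \<phi> *\<^sub>R x)"
proof -
  have reg: "regular_cost \<mu> L F" and K: "K_function F" using assms by (auto simp: terminal_cost_assms_def)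
  obtain g where g: "\<And>x. GDERIV F x :> g x" and mono: "\<And>x y. \<mu> * (norm (x - y))\<^sup>2 \<le> (g x - g y) \<bullet> (x - y)"
    and lip: "\<And>x y. norm (g x - g y) \<le> L * norm (x - y)"
    using regular_cost_gradient[OF reg] by blast
  have radial: "\<exists>\<phi>. g x = \<phi> *\<^sub>R x" for x by (rule K_function_radial_gradient[OF K g])
  have g0: "g 0 = 0" using radial[of 0] by simp
  have "\<exists>\<phi>. \<mu> \<le> \<phi> \<and> \<phi> \<le> L \<and> g x = \<phi> *\<^sub>R x" for x
  proof (cases "x = 0")
    case True
    then show ?thesis using g0 regular_cost_mu_le[OF reg] by auto
  next
    case False
    obtain \<phi> where \<phi>: "g x = \<phi> *\<^sub>R x" using radial by blast
    have "\<mu> * (norm x)\<^sup>2 \<le> \<phi> * (norm x)\<^sup>2" using mono[of x 0] by (simp add: g0 \<phi> power2_norm_eq_inner)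
    moreover have "\<bar>\<phi>\<bar> * norm x \<le> L * norm x" using lip[of x 0] by (simp add: g0 \<phi>)
    ultimately show ?thesis using False \<phi> by (intro exI[of _ \<phi>]) auto
  qed
  then show ?thesis using g by blast
qed

text \<open>The cost with index t + \<tau> charges the input at \<tau> - 1; counting by inputs
  instead turns the index into \<open>Suc (t + \<tau>)\<close>.\<close>

lemma truncated_opt_imp_ocp_opt:
  assumes "is_truncated_opt E bx A B f c t p x \<zeta> \<kappa> i g y v"
  shows "ocp_opt (restrict_rows bx (nbhd_upto E \<kappa> i) A) (restrict_rows bx (nbhd_upto E \<kappa> i) B) p
    (\<lambda>\<tau>. f (t + \<tau>)) (\<lambda>\<tau>. c (Suc (t + \<tau>))) g (restrict_vec bx (nbhd_upto E \<kappa> i) x)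
    (\<lambda>\<tau>. restrict_vec bx (nbhd_upto E \<kappa> i) (\<zeta> \<tau>)) y v"
  using assms
  by (auto simp: is_truncated_opt_def Let_def is_arg_min_def ocp_opt_def ocp_cost_def
      sum.atLeast1_atMost_eq not_less)

lemma traj_cost_eq_ocp_cost: "traj_cost f c T x u = ocp_cost f (\<lambda>t. c (Suc t)) (f T) T x u"
  by (simp add: traj_cost_def ocp_cost_def lessThan_Suc_atMost[symmetric])

lemma offline_opt_imp_ocp_opt:
  "is_offline_opt A B f c T w x\<^sub>0 x u \<Longrightarrow> ocp_opt A B T f (\<lambda>t. c (Suc t)) (f T) x\<^sub>0 w x u"
  by (auto simp: is_offline_opt_def is_arg_min_def ocp_opt_def traj_cost_eq_ocp_cost not_less)

subsection \<open>The decay constant is at least one\<close>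

text \<open>Test costs for \<open>temporal_decay\<close>, which quantifies over all admissible stage
  costs and so applies to these.\<close>

lemma quadratic_regular_cost:
  assumes "0 < \<mu>" "\<mu> \<le> L"
  shows "regular_cost \<mu> L (\<lambda>x :: real^'n::finite. \<mu> / 2 * (norm x)\<^sup>2)"
proof -
  let ?f = "\<lambda>x :: real^'n. \<mu> / 2 * (norm x)\<^sup>2"
  have "strongly_convex \<mu> ?f" using assms convex_on_const[of "UNIV :: (real^'n) set" 0]
    by (simp add: strongly_convex_def)
  moreover have "smooth L ?f"
    unfolding smooth_def
  proof (intro exI[of _ "\<lambda>x. \<mu> *\<^sub>R x"] conjI allI)
    show "L-lipschitz_on UNIV (\<lambda>x :: real^'n. \<mu> *\<^sub>R x)"
      using assms by (intro lipschitz_onI) (auto simp: dist_norm mult_right_mono simp flip: scaleR_diff_right)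
  qed (rule GDERIV_half_norm_sq)
  moreover have "twice_cont_diff ?f"
    unfolding twice_cont_diff_def
  proof (intro exI[of _ "\<lambda>x. \<mu> *\<^sub>R x"] exI[of _ "\<lambda>_. mat \<mu>"] conjI allI)
    show "((\<lambda>x. \<mu> *\<^sub>R x) has_derivative (\<lambda>h. mat \<mu> *v h)) (at x)" for x :: "real^'n"
    proof -
      have "mat \<mu> *v h = \<mu> *\<^sub>R h" for h :: "real^'n"
        by (simp add: vec_eq_iff matrix_vector_mult_def mat_def if_distrib[of "\<lambda>u. u * _"] cong: if_cong)
      then show ?thesis by (auto intro!: derivative_eq_intros)
    qed
    show "GDERIV ?f x :> \<mu> *\<^sub>R x" for x by (rule GDERIV_half_norm_sq)
  qed simp
  ultimately show ?thesis by (simp add: regular_cost_def)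
qed

lemma separable_quadratic:
  fixes b :: "'n::finite \<Rightarrow> 'v::finite"
  shows "separable b (\<lambda>x. \<mu> / 2 * (norm x)\<^sup>2)"
  unfolding separable_def
  by (intro exI[of _ "\<lambda>_ y. \<mu> / 2 * (norm y)\<^sup>2"]) (simp add: sum_blocks_norm flip: sum_divide_distrib sum_distrib_left)

text \<open>
  Compares the optimal trajectories from a unit vector and from \<open>0\<close> at time \<open>0\<close>, for ever longer horizons.
\<close>

lemma (in network) temporal_decay_constant_ge_1:
  assumes td: "temporal_decay bx bu A B \<mu> L d \<Omega> \<delta>"
  shows "1 \<le> \<Omega>"
proof -
  have \<Omega>: "0 < \<Omega>" and \<delta>: "0 < \<delta>" "\<delta> < 1" using td by (auto simp: temporal_decay_def)
  let ?f = "\<lambda>(_ :: nat) x :: real^'n. \<mu> / 2 * (norm x)\<^sup>2" and ?c = "\<lambda>(_ :: nat) x :: real^'m. \<mu> / 2 * (norm x)\<^sup>2"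
  let ?e = "axis undefined 1 :: real^'n"
  have stage: "stage_cost_assms bx bu \<mu> L T ?f ?c" for T
    unfolding stage_cost_assms_def
    by (intro conjI ballI allI quadratic_regular_cost mu_pos mu_le separable_quadratic) (use mu_pos in auto)
  have td': "norm (y m - y' m) \<le> \<Omega> * (\<delta> ^ m * norm (x - x') + \<delta> ^ (p - m) * norm (xbar - xbar')
      + (\<Sum>l<p. \<delta> ^ nat \<bar>int m - int l\<bar> * norm (\<zeta> l - \<zeta>' l)))"
    if "stage_cost_assms bx bu \<mu> L T f c" "d \<le> p" "t + p \<le> T" "is_terminal_opt A B f c t p x \<zeta> xbar y v"
      "is_terminal_opt A B f c t p x' \<zeta>' xbar' y' v'" "m \<le> p"
    for T f c t p x \<zeta> xbar x' \<zeta>' xbar' y v y' v' m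
    by (rule td[unfolded temporal_decay_def, THEN conjunct2, THEN conjunct2, THEN conjunct2, rule_format,
          OF conjI[OF that(1) conjI[OF that(2) conjI[OF that(3) conjI[OF that(4,5)]]]] that(6)])
  \<comment> \<open>The end state has norm at most 2 K whatever the horizon, so its contribution
    dies out with \<delta>^p.\<close>
  have bound: "1 \<le> \<Omega> * (1 + \<delta> ^ p * (2 * K))" if "d \<le> p" for p
  proof -
    have "\<exists>y v. ocp_opt A B p ?f ?c (?f p) ?e (\<lambda>_. 0) y v"
      by (rule ocp_opt_exists[where m = \<mu>]; (rule convex_on_half_norm_sq order_refl mu_pos)?)
         (use mu_pos in simp_all)
    then obtain y v where opt: "ocp_opt A B p ?f ?c (?f p) ?e (\<lambda>_. 0) y v" by blast
    have "\<exists>l. kkt A B p (\<lambda>_ x. \<mu> *\<^sub>R x) (\<lambda>_ x. \<mu> *\<^sub>R x) (\<lambda>x. \<mu> *\<^sub>R x) ?e (\<lambda>_. 0) y v l"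
      by (rule ocp_opt_kkt[OF opt]; rule GDERIV_half_norm_sq)
    then obtain l where kkt: "kkt A B p (\<lambda>_ x. \<mu> *\<^sub>R x) (\<lambda>_ x. \<mu> *\<^sub>R x) (\<lambda>x. \<mu> *\<^sub>R x) ?e (\<lambda>_. 0) y v l"
      by blast
    have "energy p y v l \<le> 4 * K\<^sup>2 * ((norm ?e)\<^sup>2 + sq_sum p (\<lambda>_. 0 :: real^'n))"
      by (rule kkt_bound[OF kkt]; rule block_gradient_scaleR) (use mu_pos mu_le in auto)
    then have "energy p y v l \<le> (2 * K)\<^sup>2" by (simp add: norm_axis_1 power_mult_distrib)
    moreover have "(norm (y p))\<^sup>2 \<le> energy p y v l"
      using norm_sq_le_sq_sum[of p "Suc p" y] by (simp add: energy_def add_increasing2)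
    ultimately have "(norm (y p))\<^sup>2 \<le> (2 * K)\<^sup>2" by (rule order_trans[rotated])
    then have yp: "norm (y p) \<le> 2 * K" by (rule power2_le_imp_le) (use K_pos in simp)
    have cost: "(\<Sum>\<tau>\<le>p. ?f (0 + \<tau>) (y' \<tau>)) + (\<Sum>\<tau>=1..p. ?c (0 + \<tau>) (v' (\<tau> - 1))) = ocp_cost ?f ?c (?f p) p y' v'"
      for y' v' by (simp add: ocp_cost_def sum.atLeast1_atMost_eq lessThan_Suc_atMost[symmetric])
    \<comment> \<open>A minimizer with free end is also one among the trajectories with its own end
      state prescribed.\<close>
    have 1: "is_terminal_opt A B ?f ?c 0 p ?e (\<lambda>_. 0) (y p) y v"
      using opt unfolding is_terminal_opt_def is_arg_min_def cost by (auto simp: ocp_opt_def not_less)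
    have 2: "is_terminal_opt A B ?f ?c 0 p 0 (\<lambda>_. 0) 0 (\<lambda>_. 0) (\<lambda>_. 0)"
      unfolding is_terminal_opt_def is_arg_min_def
      using mu_pos by (auto simp: trajectory_def not_less intro!: add_nonneg_nonneg sum_nonneg)
    have "norm (y 0 - 0) \<le> \<Omega> * (\<delta> ^ 0 * norm (?e - 0) + \<delta> ^ (p - 0) * norm (y p - 0)
        + (\<Sum>l<p. \<delta> ^ nat \<bar>int 0 - int l\<bar> * norm (0 - 0 :: real^'n)))"
      by (rule td'[OF stage that _ 1 2, of p]) simp_all
    moreover have "y 0 = ?e" using opt by (simp add: ocp_opt_def trajectory_def)
    ultimately have "1 \<le> \<Omega> * (1 + \<delta> ^ p * norm (y p))" by (simp add: norm_axis_1)
    also have "\<dots> \<le> \<Omega> * (1 + \<delta> ^ p * (2 * K))"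
      using yp \<Omega> \<delta> by (intro mult_left_mono add_left_mono) auto
    finally show ?thesis .
  qed
  have lim: "(\<lambda>p. \<Omega> * (1 + \<delta> ^ p * (2 * K))) \<longlonglongrightarrow> \<Omega> * (1 + 0 * (2 * K))"
    using \<delta> by (intro tendsto_intros LIMSEQ_power_zero) simp
  have "1 \<le> \<Omega> * (1 + 0 * (2 * K))"
    by (rule tendsto_lowerbound[OF lim eventually_sequentiallyI[of d]]) (simp_all only: bound trivial_limit_sequentially not_False_eq_True)
  then show ?thesis by simp
qed

theorem theorem1:
  fixes E :: "('v::finite \<times> 'v) set"
    and bx :: "'n::finite \<Rightarrow> 'v" and bu :: "'m::finite \<Rightarrow> 'v"
    and A :: "real^'n^'n" and B :: "real^'m^'n"
    and L \<gamma> \<sigma> \<mu> \<Omega> :: real and d \<kappa>\<^sub>0 :: nat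
    and p :: "nat \<Rightarrow> real" and F :: "real^'n \<Rightarrow> real"
  assumes "networked_system E bx bu A B"
    and "system_assms E bx A B L \<gamma> \<sigma> d \<kappa>\<^sub>0"
    and "terminal_cost_assms \<mu> L F"
    and "subexponential_growth E p"
  shows "\<exists>M c\<^sub>1 c\<^sub>2. \<exists>\<eta> :: nat \<Rightarrow> nat \<Rightarrow> real \<Rightarrow> real.
    0 < M \<and> 0 < c\<^sub>1 \<and> 0 < c\<^sub>2 \<and>
    (\<forall>k \<kappa> \<delta>. 0 < \<delta> \<and> \<delta> < 1 \<longrightarrow>
       c\<^sub>1 * max (\<delta> ^ k) (\<delta> ^ \<kappa>) \<le> \<eta> k \<kappa> \<delta> \<and> \<eta> k \<kappa> \<delta> \<le> c\<^sub>2 * max (\<delta> ^ k) (\<delta> ^ \<kappa>)) \<and>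
    (\<forall>\<delta>\<^sub>T T k \<kappa> f c w x\<^sub>0 D x u.
       let N = real CARD('v);
           C = max \<Omega> (Gamma_S L \<gamma> \<mu> p);
           \<delta> = max (delta_S L \<gamma> \<mu>) \<delta>\<^sub>T;
           \<xi> = 1 - sqrt \<delta>;
           W = 10 * C ^ 3 * L * N / (1 - \<delta>)\<^sup>2 * D
       in
         temporal_decay bx bu A B \<mu> L d \<Omega> \<delta>\<^sub>T \<longrightarrow>
         stage_cost_assms bx bu \<mu> L T f c \<longrightarrow>
         k \<le> T \<longrightarrow>
         (\<forall>t\<le>T - k. (\<Sum>\<tau><k. norm (w (t + \<tau>))) \<le> D) \<longrightarrow>
         real \<kappa> \<ge> max (real \<kappa>\<^sub>0) (ln ((1 - sqrt \<delta>) * (1 - \<delta>) / (2 * C\<^sup>2 * L * N)) / ln \<delta>) \<longrightarrow>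
         real k \<ge> 2 * ln (\<delta> powr (5 / 2) * (1 - \<delta>) / (4 * C ^ 3)) / ln \<delta> \<longrightarrow>
         dtpc_trajectory E bx bu A B f c F T k \<kappa> w x\<^sub>0 x u \<longrightarrow>
         (\<forall>t\<le>T. norm (x t) \<le>
            (if t \<le> T - k
             then C / \<xi> * (1 - \<xi>) ^ (t - k) * norm x\<^sub>0 + W / \<xi>
             else C\<^sup>2 / \<xi>\<^sup>2 * (1 - \<xi>) powi (int T - 2 * int k) * \<delta> ^ (t + k - T) * norm x\<^sub>0
                  + 2 * C * W / \<xi>\<^sup>2)) \<and>
         (\<forall>xo uo. is_offline_opt A B f c T w x\<^sub>0 xo uo \<longrightarrow>
            \<bar>traj_cost f c T x u - traj_cost f c T xo uo\<bar> \<le>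
              M * (((D + (norm x\<^sub>0 + D) / \<xi>\<^sup>2)\<^sup>2 * \<delta> ^ \<kappa>
                    + (D + \<delta> ^ k * (norm x\<^sub>0 + D) / \<xi>)\<^sup>2 * \<delta> ^ k) * real T
                   + \<eta> k \<kappa> \<delta> * (norm x\<^sub>0)\<^sup>2)))"
proof -
  let ?N = "real CARD('v)" and ?\<delta>S = "delta_S L \<gamma> \<mu>"
  let ?AS = "\<lambda>\<kappa> i. restrict_rows bx (nbhd_upto E \<kappa> i) A" and ?BS = "\<lambda>\<kappa> i. restrict_rows bx (nbhd_upto E \<kappa> i) B"
  have stab: "stabilizable L \<gamma> (?AS \<kappa> i) (?BS \<kappa> i)" if "\<kappa>\<^sub>0 \<le> \<kappa>" for \<kappa> i
    using assms(2) that by (simp add: system_assms_def)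
  have L: "1 < L" and \<gamma>: "0 < \<gamma>" "\<gamma> < 1"
    using stab[of \<kappa>\<^sub>0 undefined] by (auto simp: stabilizable_def)
  have regF: "regular_cost \<mu> L F" using assms(3) by (simp add: terminal_cost_assms_def)
  note \<mu> = regular_cost_mu_le[OF regF]
  define J where "J = L * sqrt (1 + L\<^sup>2) / (1 - \<gamma>)"
  have dualS: "dual_bound J (?AS \<kappa> i) (?BS \<kappa> i)" if "\<kappa>\<^sub>0 \<le> \<kappa>" for \<kappa> i
    unfolding J_def by (rule stabilizable_imp_dual_bound[OF stab[OF that]])
  have J: "L \<le> J"
  proof -
    have "1 * L \<le> (sqrt (1 + L\<^sup>2) / (1 - \<gamma>)) * L"
    proof (rule mult_right_mono)
      have "1 - \<gamma> \<le> sqrt (1 + L\<^sup>2)" using \<gamma> order_trans[of "1 - \<gamma>" 1 "sqrt (1 + L\<^sup>2)"] by simp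
      then show "1 \<le> sqrt (1 + L\<^sup>2) / (1 - \<gamma>)" using \<gamma> by (simp add: pos_le_divide_eq)
    qed (use L in simp)
    then show ?thesis by (simp add: J_def mult.commute)
  qed
  have JL: "2 \<le> (J * L)\<^sup>2"
  proof -
    have "J\<^sup>2 = L\<^sup>2 * (1 + L\<^sup>2) / (1 - \<gamma>)\<^sup>2" by (simp add: J_def power_mult_distrib power_divide)
    moreover have "L\<^sup>2 * (1 + L\<^sup>2) * (1 - \<gamma>)\<^sup>2 \<le> L\<^sup>2 * (1 + L\<^sup>2) * 1"
      using \<gamma> by (intro mult_left_mono power_le_one) auto
    ultimately have "L\<^sup>2 * (1 + L\<^sup>2) \<le> J\<^sup>2" using \<gamma> by (simp add: pos_le_divide_eq)
    moreover have L2: "1 \<le> L\<^sup>2" using L by simp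
    have "1 * 2 \<le> L\<^sup>2 * (1 + L\<^sup>2)" using L2 by (intro mult_mono) auto
    ultimately have "2 \<le> J\<^sup>2" by linarith
    then have "2 * 1 \<le> J\<^sup>2 * L\<^sup>2" using L2 by (intro mult_mono) auto
    then show ?thesis by (simp add: power_mult_distrib)
  qed
  \<comment> \<open>Interpreted before the horizon, \<open>k\<close>, \<open>\<kappa>\<close> and
    the temporal rate are fixed, so that \<open>K\<close>, \<open>G\<close> and with them
    \<open>M\<close> cannot depend on those.\<close>
  interpret network E bx bu A B L J \<mu>
  proof
    show "dual_bound J A B" using assms(1) dualS by (rule dual_bound_components)
  qed (use assms(1,2) \<mu> L J JL in \<open>auto simp: system_assms_def\<close>)
  have \<delta>S: "0 < ?\<delta>S" "?\<delta>S < 1" "81 * G\<^sup>2 * (1 - ?\<delta>S) \<le> 1"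
    using spatial_rate_bounds[OF L \<gamma> \<mu> J_def, of G] G_ge by (simp_all add: G_def K_def)
  obtain gF where gF: "\<And>x. GDERIV F x :> gF x" "\<And>x. \<exists>\<phi>. \<mu> \<le> \<phi> \<and> \<phi> \<le> L \<and> gF x = \<phi> *\<^sub>R x"
    using terminal_cost_gradient[OF assms(3)] by blast
  \<comment> \<open>The factor 2 pays for bounding \<delta>^\<kappa> + \<delta>^k by twice the
    maximum.\<close>
  define M where "M = 2 * (L * (1360 * ((108 * K ^ 3 * G ^ 3)\<^sup>2 * (2 * ?N))))"
  have M: "0 < M" using L K_pos G_ge by (simp add: M_def)
  show ?thesis
    unfolding Let_def
  proof (rule exI[of _ M], rule exI[of _ 1], rule exI[of _ 1], rule exI[of _ "\<lambda>k \<kappa> \<delta>. max (\<delta> ^ k) (\<delta> ^ \<kappa>)"],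
      intro conjI allI impI)
    show "0 < M" by (rule M)
  next
    fix \<delta>\<^sub>T :: real and T k \<kappa> :: nat and f c w x\<^sub>0 D x u
    define C where "C = max \<Omega> (Gamma_S L \<gamma> \<mu> p)"
    define \<delta> where "\<delta> = max ?\<delta>S \<delta>\<^sub>T"
    assume td: "temporal_decay bx bu A B \<mu> L d \<Omega> \<delta>\<^sub>T"
      and stage: "stage_cost_assms bx bu \<mu> L T f c" and kT: "k \<le> T"
      and window: "\<forall>t\<le>T - k. (\<Sum>\<tau><k. norm (w (t + \<tau>))) \<le> D"
      and \<kappa>_ge: "max (real \<kappa>\<^sub>0) (ln ((1 - sqrt (max ?\<delta>S \<delta>\<^sub>T)) * (1 - max ?\<delta>S \<delta>\<^sub>T)
          / (2 * (max \<Omega> (Gamma_S L \<gamma> \<mu> p))\<^sup>2 * L * ?N)) / ln (max ?\<delta>S \<delta>\<^sub>T)) \<le> real \<kappa>"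
      and k_ge: "2 * ln (max ?\<delta>S \<delta>\<^sub>T powr (5 / 2) * (1 - max ?\<delta>S \<delta>\<^sub>T)
          / (4 * max \<Omega> (Gamma_S L \<gamma> \<mu> p) ^ 3)) / ln (max ?\<delta>S \<delta>\<^sub>T) \<le> real k"
      and dtpc: "dtpc_trajectory E bx bu A B f c F T k \<kappa> w x\<^sub>0 x u"
    \<comment> \<open>This allows powers of \<open>C\<close> to be dropped from the denominators
      inside the two logarithms.\<close>
    have C: "1 \<le> C" using temporal_decay_constant_ge_1[OF td] by (simp add: C_def)
    have \<delta>T: "0 < \<delta>\<^sub>T" "\<delta>\<^sub>T < 1" using td by (auto simp: temporal_decay_def)
    have \<delta>: "0 < \<delta>" "\<delta> < 1" using \<delta>S \<delta>T by (auto simp: \<delta>_def)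
    have "81 * G\<^sup>2 * (1 - \<delta>) \<le> 81 * G\<^sup>2 * (1 - ?\<delta>S)" by (intro mult_left_mono) (auto simp: \<delta>_def)
    then have G\<delta>: "81 * G\<^sup>2 * (1 - \<delta>) \<le> 1" using \<delta>S(3) by linarith
    have s: "\<delta> \<le> sqrt \<delta>" "sqrt \<delta> < 1" using \<delta> by (auto intro!: real_le_rsqrt simp: power2_eq_square mult_left_le)
    have \<kappa>0: "\<kappa>\<^sub>0 \<le> \<kappa>" using \<kappa>_ge by simp
    have \<delta>\<kappa>: "\<delta> ^ \<kappa> \<le> (1 - \<delta>)\<^sup>2 / (2 * ?N)"
    proof -
      let ?a = "(1 - sqrt \<delta>) * (1 - \<delta>) / (2 * C\<^sup>2 * L * ?N)"
      have "0 < ?a" using s \<delta> C L by simp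
      then have "\<delta> ^ \<kappa> \<le> ?a" using \<delta> \<kappa>_ge by (intro power_le_of_log_le) (simp_all add: C_def \<delta>_def)
      also have "\<dots> \<le> ((1 - \<delta>) * (1 - \<delta>)) / (2 * ?N)"
      proof (rule frac_le)
        show "(1 - sqrt \<delta>) * (1 - \<delta>) \<le> (1 - \<delta>) * (1 - \<delta>)" using s \<delta> by (intro mult_right_mono) auto
        have "1 * 1 \<le> C\<^sup>2 * L" using C L by (intro mult_mono) auto
        then have "1 * ?N \<le> (C\<^sup>2 * L) * ?N" by (intro mult_right_mono) auto
        then show "2 * ?N \<le> 2 * C\<^sup>2 * L * ?N" by simp
      qed (use \<delta> in auto)
      finally show ?thesis by (simp add: power2_eq_square)
    qed
    \<comment> \<open>The factor 2 in front of the logarithm becomes a square, so \<delta>^k is at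
      most the square of its argument.\<close>
    have \<delta>k: "\<delta> ^ k \<le> (1 - \<delta>)\<^sup>2 / 16"
    proof -
      let ?a = "\<delta> powr (5 / 2) * (1 - \<delta>) / (4 * C ^ 3)"
      have a0: "0 < ?a" using \<delta> C by simp
      have "\<delta> ^ k \<le> ?a\<^sup>2"
      proof (rule power_le_of_log_le[OF \<delta>])
        have "ln (?a\<^sup>2) = 2 * ln ?a" using a0 by (simp only: ln_realpow)
        then show "ln (?a\<^sup>2) / ln \<delta> \<le> real k" using k_ge by (simp only: C_def \<delta>_def)
      qed (rule zero_less_power[OF a0])
      also have "\<dots> \<le> ((1 - \<delta>) / 4)\<^sup>2"
      proof (rule power_mono)
        have "\<delta> powr (5 / 2) \<le> 1" using \<delta> by (simp add: powr_le1)
        then have "\<delta> powr (5 / 2) * (1 - \<delta>) \<le> 1 * (1 - \<delta>)" using \<delta> by (intro mult_right_mono) auto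
        moreover have "1 \<le> C ^ 3" using C by simp
        ultimately show "?a \<le> (1 - \<delta>) / 4" using \<delta> by (intro frac_le) auto
      qed (rule less_imp_le[OF a0])
      finally show ?thesis by (simp add: power_divide)
    qed
    \<comment> \<open>For \<open>k = 0\<close> the bound just shown would read 1 \<le> (1 -
      \<delta>)^2/16.\<close>
    have k_pos: "0 < k"
    proof (rule ccontr)
      assume "\<not> 0 < k"
      then have "16 \<le> (1 - \<delta>)\<^sup>2" using \<delta>k by simp
      moreover have "(1 - \<delta>)\<^sup>2 \<le> 1" using \<delta> by (intro power_le_one) auto
      ultimately show False by simp
    qed
    have tr: "trajectory A B T w x\<^sub>0 x u" and agents: "\<And>t i. t < T \<Longrightarrow> \<exists>y v.
        is_truncated_opt E bx A B f c t (if t + k < T then k else T - t) (x t)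
          (\<lambda>\<tau>. w (t + \<tau>)) \<kappa> i (if t + k < T then F else f T) y v \<and>
        restrict_vec bu {i} (u t) = restrict_vec bu {i} (v 0)"
      using dtpc by (auto simp: dtpc_trajectory_def)
    have f: "separable bx (f t)" "regular_cost \<mu> L (f t)" "\<And>z. 0 \<le> f t z" "f t 0 = 0" if "t \<le> T" for t
      using stage that by (auto simp: stage_cost_assms_def)
    have c: "separable bu (c t)" "regular_cost \<mu> L (c t)" "\<And>z. 0 \<le> c t z" "c t 0 = 0" if "1 \<le> t" "t \<le> T" for t
      using stage that by (auto simp: stage_cost_assms_def)
    have "\<forall>t. \<exists>g. t \<le> T \<longrightarrow> (\<forall>z. GDERIV (f t) z :> g z) \<and> block_gradient bx \<mu> L g"
      using regular_separable_gradient[OF f(2,1,3,4)] by blast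
    then obtain gf where gf: "\<And>t z. t \<le> T \<Longrightarrow> GDERIV (f t) z :> gf t z" "\<And>t. t \<le> T \<Longrightarrow> block_gradient bx \<mu> L (gf t)"
      by metis
    have "\<forall>t. \<exists>g. 1 \<le> t \<longrightarrow> t \<le> T \<longrightarrow> (\<forall>z. GDERIV (c t) z :> g z) \<and> block_gradient bu \<mu> L g"
      using regular_separable_gradient[OF c(2,1,3,4)] by blast
    then obtain gc where gc: "\<And>t z. 1 \<le> t \<Longrightarrow> t \<le> T \<Longrightarrow> GDERIV (c t) z :> gc t z"
        "\<And>t. 1 \<le> t \<Longrightarrow> t \<le> T \<Longrightarrow> block_gradient bu \<mu> L (gc t)"
      by metis
    have f_cvx: "convex_on UNIV (f t)" if "t \<le> T" for t
      using f(2)[OF that] by (auto simp: regular_cost_def intro: strongly_convex_imp_convex)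
    have c_cvx: "convex_on UNIV (c t)" if "1 \<le> t" "t \<le> T" for t
      using c(2)[OF that] by (auto simp: regular_cost_def intro: strongly_convex_imp_convex)
    have c_ge: "\<mu> / 2 * (norm v)\<^sup>2 \<le> c t v" if "1 \<le> t" "t \<le> T" for t v
    proof (rule strongly_convex_ge_quadratic)
      show "GDERIV (c t) 0 :> 0"
        using gc(1)[OF that, of 0] gc(2)[OF that] by (simp add: block_gradient_def)
    qed (use c[OF that] in \<open>auto simp: regular_cost_def\<close>)
    \<comment> \<open>The terminal cost \<open>h\<close> is left open, to cover both the stage costs
      and the quadratic costs with gradient \<open>\<phi> *\<^sub>R y\<close>.\<close>
    have ex: "\<exists>y v l. kkt A B q (\<lambda>\<tau>. gf (t + \<tau>)) (\<lambda>\<tau>. gc (Suc (t + \<tau>))) gT z \<zeta> y v l"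
      if "t + q \<le> T" "convex_on UNIV h" "\<And>z. 0 \<le> h z" "\<And>z. GDERIV h z :> gT z" for t q h gT z \<zeta>
    proof -
      have "\<exists>y v. ocp_opt A B q (\<lambda>\<tau>. f (t + \<tau>)) (\<lambda>\<tau>. c (Suc (t + \<tau>))) h z \<zeta> y v"
      proof (rule ocp_opt_exists[OF _ _ _ \<mu>(1) _ that(2,3)])
        fix \<tau> assume \<tau>: "\<tau> < q"
        show "convex_on UNIV (f (t + \<tau>))" using f_cvx \<tau> that(1) by simp
        show "0 \<le> f (t + \<tau>) z" for z using f(3)[of "t + \<tau>" z] \<tau> that(1) by simp
        show "convex_on UNIV (c (Suc (t + \<tau>)))" using c_cvx \<tau> that(1) by simp
        show "\<mu> / 2 * (norm v)\<^sup>2 \<le> c (Suc (t + \<tau>)) v" for v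
          by (rule c_ge) (use \<tau> that(1) in auto)
      qed
      then obtain y v where opt: "ocp_opt A B q (\<lambda>\<tau>. f (t + \<tau>)) (\<lambda>\<tau>. c (Suc (t + \<tau>))) h z \<zeta> y v" by blast
      have "\<exists>l. kkt A B q (\<lambda>\<tau>. gf (t + \<tau>)) (\<lambda>\<tau>. gc (Suc (t + \<tau>))) gT z \<zeta> y v l"
        by (rule ocp_opt_kkt[OF opt]) (use gf gc that in auto)
      then show ?thesis by blast
    qed
    note gf_grad = gf(1) and gc_grad = gc(1)
    interpret closed_loop E bx bu A B L J \<mu> T k \<kappa> gf gc w x u D
    proof
      show "\<exists>y v l. kkt A B q (\<lambda>\<tau>. gf (t + \<tau>)) (\<lambda>\<tau>. gc (Suc (t + \<tau>))) (gf (t + q)) z \<zeta> y v l"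
        if "t + q \<le> T" for t q z \<zeta>
        by (rule ex[OF that f_cvx f(3) gf(1)]) (use that in auto)
      show "\<exists>y v l. kkt A B q (\<lambda>\<tau>. gf (t + \<tau>)) (\<lambda>\<tau>. gc (Suc (t + \<tau>))) (\<lambda>y. \<phi> *\<^sub>R y) z \<zeta> y v l"
        if "t + q \<le> T" "\<mu> \<le> \<phi>" "\<phi> \<le> L" for t q z \<zeta> \<phi>
        by (rule ex[OF that(1) convex_on_half_norm_sq _ GDERIV_half_norm_sq]) (use that \<mu> in auto)
      show "dual_bound J (?AS \<kappa> i) (?BS \<kappa> i)" for i by (rule dualS[OF \<kappa>0])
      show "x (Suc t) = A *v x t + B *v u t + w t" if "t < T" for t
        using tr that by (simp add: trajectory_def)
      show "\<exists>\<phi> y v l. \<mu> \<le> \<phi> \<and> \<phi> \<le> L \<and>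
        kkt (?AS \<kappa> i) (?BS \<kappa> i) k (\<lambda>\<tau>. gf (t + \<tau>)) (\<lambda>\<tau>. gc (Suc (t + \<tau>))) (\<lambda>y. \<phi> *\<^sub>R y)
          (restrict_vec bx (nbhd_upto E \<kappa> i) (x t)) (\<lambda>\<tau>. restrict_vec bx (nbhd_upto E \<kappa> i) (w (t + \<tau>))) y v l \<and>
        restrict_vec bu {i} (u t) = restrict_vec bu {i} (v 0)" if early: "t + k < T" for t i
      proof -
        have "t < T" using early by simp
        then obtain y v where yv: "is_truncated_opt E bx A B f c t k (x t) (\<lambda>\<tau>. w (t + \<tau>)) \<kappa> i F y v"
          "restrict_vec bu {i} (u t) = restrict_vec bu {i} (v 0)"
          using agents[of t i] early by auto
        obtain l where l: "kkt (?AS \<kappa> i) (?BS \<kappa> i) k (\<lambda>\<tau>. gf (t + \<tau>)) (\<lambda>\<tau>. gc (Suc (t + \<tau>))) gF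
          (restrict_vec bx (nbhd_upto E \<kappa> i) (x t)) (\<lambda>\<tau>. restrict_vec bx (nbhd_upto E \<kappa> i) (w (t + \<tau>))) y v l"
          using ocp_opt_kkt[OF truncated_opt_imp_ocp_opt[OF yv(1)], of "\<lambda>\<tau>. gf (t + \<tau>)" "\<lambda>\<tau>. gc (Suc (t + \<tau>))" gF]
            gf(1) gc(1) gF(1) early by auto
        \<comment> \<open>\<open>kkt\<close> sees the terminal gradient at \<open>y k\<close> only,
          so \<open>gF\<close> can be exchanged for multiplication by this factor.\<close>
        obtain \<phi> where "\<mu> \<le> \<phi>" "\<phi> \<le> L" "gF (y k) = \<phi> *\<^sub>R y k" using gF(2) by blast
        then show ?thesis using l yv(2) unfolding kkt_def by metis
      qed
      show "\<exists>y v l. kkt (?AS \<kappa> i) (?BS \<kappa> i) (T - t) (\<lambda>\<tau>. gf (t + \<tau>)) (\<lambda>\<tau>. gc (Suc (t + \<tau>))) (gf T)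
          (restrict_vec bx (nbhd_upto E \<kappa> i) (x t)) (\<lambda>\<tau>. restrict_vec bx (nbhd_upto E \<kappa> i) (w (t + \<tau>))) y v l \<and>
        restrict_vec bu {i} (u t) = restrict_vec bu {i} (v 0)" if late: "t < T" "T \<le> t + k" for t i
      proof -
        obtain y v where yv: "is_truncated_opt E bx A B f c t (T - t) (x t) (\<lambda>\<tau>. w (t + \<tau>)) \<kappa> i (f T) y v"
          "restrict_vec bu {i} (u t) = restrict_vec bu {i} (v 0)"
          using agents[of t i] late by auto
        obtain l where "kkt (?AS \<kappa> i) (?BS \<kappa> i) (T - t) (\<lambda>\<tau>. gf (t + \<tau>)) (\<lambda>\<tau>. gc (Suc (t + \<tau>))) (gf T)
          (restrict_vec bx (nbhd_upto E \<kappa> i) (x t)) (\<lambda>\<tau>. restrict_vec bx (nbhd_upto E \<kappa> i) (w (t + \<tau>))) y v l"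
          using ocp_opt_kkt[OF truncated_opt_imp_ocp_opt[OF yv(1)], of "\<lambda>\<tau>. gf (t + \<tau>)" "\<lambda>\<tau>. gc (Suc (t + \<tau>))" "gf T"]
            gf(1) gc(1) late by auto
        then show ?thesis using yv(2) by blast
      qed
    qed (use gf gc k_pos kT window in auto)
    have x0: "x 0 = x\<^sub>0" using tr by (simp add: trajectory_def)
    have small: "17 * (K * G * \<epsilon>) \<le> 1" by (rule small_gain[OF G\<delta> \<delta> \<delta>\<kappa> \<delta>k])
    show "norm (x t) \<le>
        (if t \<le> T - k
         then max \<Omega> (Gamma_S L \<gamma> \<mu> p) / (1 - sqrt (max ?\<delta>S \<delta>\<^sub>T)) * (1 - (1 - sqrt (max ?\<delta>S \<delta>\<^sub>T))) ^ (t - k) * norm x\<^sub>0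
           + 10 * max \<Omega> (Gamma_S L \<gamma> \<mu> p) ^ 3 * L * ?N / (1 - max ?\<delta>S \<delta>\<^sub>T)\<^sup>2 * D / (1 - sqrt (max ?\<delta>S \<delta>\<^sub>T))
         else (max \<Omega> (Gamma_S L \<gamma> \<mu> p))\<^sup>2 / (1 - sqrt (max ?\<delta>S \<delta>\<^sub>T))\<^sup>2
             * (1 - (1 - sqrt (max ?\<delta>S \<delta>\<^sub>T))) powi (int T - 2 * int k) * max ?\<delta>S \<delta>\<^sub>T ^ (t + k - T) * norm x\<^sub>0
           + 2 * max \<Omega> (Gamma_S L \<gamma> \<mu> p)
             * (10 * max \<Omega> (Gamma_S L \<gamma> \<mu> p) ^ 3 * L * ?N / (1 - max ?\<delta>S \<delta>\<^sub>T)\<^sup>2 * D) / (1 - sqrt (max ?\<delta>S \<delta>\<^sub>T))\<^sup>2)"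
      if "t \<le> T" for t
      using input_to_state_stability[OF G\<delta> \<delta> C small that] unfolding C_def \<delta>_def x0 .
    fix xo uo assume offline: "is_offline_opt A B f c T w x\<^sub>0 xo uo"
    define \<xi> where "\<xi> = 1 - sqrt \<delta>"
    define X where "X = norm x\<^sub>0"
    define a b where "a = D + (X + D) / \<xi>\<^sup>2" and "b = D + \<delta> ^ k * (X + D) / \<xi>"
    define gap where "gap = traj_cost f c T x u - traj_cost f c T xo uo"
    have xi: "0 < \<xi>" using s by (simp add: \<xi>_def)
    have opt: "ocp_opt A B T f (\<lambda>t. c (Suc t)) (f T) (x 0) w xo uo"
      using offline_opt_imp_ocp_opt[OF offline] by (simp add: x0)
    \<comment> \<open>The controlled trajectory is feasible for the offline problem, which settles
      the lower side of the absolute value.\<close>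
    have "0 \<le> gap"
      using opt tr by (simp add: gap_def traj_cost_eq_ocp_cost ocp_opt_def x0)
    \<comment> \<open>The estimate produces D^2 T times each of \<delta>^\<kappa> and \<delta>^k;
      the squares in the claimed bound dominate D^2, having \<open>D\<close> as one of two
      nonnegative summands.\<close>
    have ab: "D\<^sup>2 \<le> a\<^sup>2" "D\<^sup>2 \<le> b\<^sup>2"
      using D_nonneg xi \<delta> by (auto simp: a_def b_def X_def intro!: power_mono)
    have m: "\<delta> ^ \<kappa> + \<delta> ^ k \<le> 2 * max (\<delta> ^ k) (\<delta> ^ \<kappa>)" by simp
    have "gap \<le> L * (1360 * ((108 * K ^ 3 * G ^ 3)\<^sup>2 * (2 * ?N))) * (\<delta> ^ \<kappa> + \<delta> ^ k) * (X\<^sup>2 + real T * D\<^sup>2)"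
      unfolding gap_def traj_cost_eq_ocp_cost X_def x0[symmetric]
      by (rule regret_bound[OF G\<delta> \<delta> small f_cvx gf_grad c_cvx gc_grad opt]) auto
    also have "\<dots> = M / 2 * ((\<delta> ^ \<kappa> + \<delta> ^ k) * X\<^sup>2 + (D\<^sup>2 * \<delta> ^ \<kappa> + D\<^sup>2 * \<delta> ^ k) * real T)"
      by (simp add: M_def algebra_simps)
    also have "\<dots> \<le> M / 2 * (2 * max (\<delta> ^ k) (\<delta> ^ \<kappa>) * X\<^sup>2 + (a\<^sup>2 * \<delta> ^ \<kappa> + b\<^sup>2 * \<delta> ^ k) * real T)"
      using M \<delta> m ab by (intro mult_left_mono add_mono mult_right_mono) auto
    also have "\<dots> \<le> M / 2 * (2 * ((a\<^sup>2 * \<delta> ^ \<kappa> + b\<^sup>2 * \<delta> ^ k) * real T + max (\<delta> ^ k) (\<delta> ^ \<kappa>) * X\<^sup>2))"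
      using M \<delta> by (intro mult_left_mono) auto
    also have "\<dots> = M * ((a\<^sup>2 * \<delta> ^ \<kappa> + b\<^sup>2 * \<delta> ^ k) * real T + max (\<delta> ^ k) (\<delta> ^ \<kappa>) * X\<^sup>2)"
    proof -
      have "M / 2 * (2 * z) = M * z" for z by simp
      then show ?thesis .
    qed
    finally have "\<bar>gap\<bar> \<le> M * ((a\<^sup>2 * \<delta> ^ \<kappa> + b\<^sup>2 * \<delta> ^ k) * real T + max (\<delta> ^ k) (\<delta> ^ \<kappa>) * X\<^sup>2)"
      using \<open>0 \<le> gap\<close> by simp
    then show "\<bar>traj_cost f c T x u - traj_cost f c T xo uo\<bar> \<le>
        M * (((D + (norm x\<^sub>0 + D) / (1 - sqrt (max ?\<delta>S \<delta>\<^sub>T))\<^sup>2)\<^sup>2 * max ?\<delta>S \<delta>\<^sub>T ^ \<kappa>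
              + (D + max ?\<delta>S \<delta>\<^sub>T ^ k * (norm x\<^sub>0 + D) / (1 - sqrt (max ?\<delta>S \<delta>\<^sub>T)))\<^sup>2 * max ?\<delta>S \<delta>\<^sub>T ^ k) * real T
             + max (max ?\<delta>S \<delta>\<^sub>T ^ k) (max ?\<delta>S \<delta>\<^sub>T ^ \<kappa>) * (norm x\<^sub>0)\<^sup>2)"
      unfolding gap_def a_def b_def X_def \<xi>_def \<delta>_def .
  qed auto
qed

end
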